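(* Let $\psi$ be a parameter of dimension $n$, all of whose $\rho$'s are self-dual, with image in the dual group ${}^LH_n$ (that is, $Sp(n,\mathbb C)$ if $n$ is even, $SO(n,\mathbb C)$ if $n$ is odd). For $?\in\{\emptyset,W,U\}$ let $\epsilon_?$ be the character defined by $\epsilon_?(\rho,a,b)=(-1)^{|\mathcal Z_?(\psi)_{(\rho,a,b)}|}$ for $(\rho,a,b)\in Jord(\psi)$, and let $z_?(\psi)=(-1)^{\frac12|\mathcal Z_?(\psi)|}$. Then $$\epsilon_?(z)=1\qquad\text{and}\qquad\epsilon_?(c_{2,\psi})=z_?(\psi).$$
   Context: $W_F$ is the Weil group of a non-archimedean local field $F$. $\psi$ is a sum of irreducible representations $\rho\otimes[a]\otimes[b]$ of $W_F\times SL(2,\mathbb C)\times SL(2,\mathbb C)$ ($[c]$ the $c$-dimensional irreducible representation of $SL(2,\mathbb C)$), $\rho$ self-dual; $Jord(\psi)$ is the multiset of the triples $(\rho,a,b)$. $H_n$ is split $SO(n+1,F)$ for $n$ even, $Sp(n-1,F)$ for $n$ odd. $\mathcal Z_\emptyset(\psi)=\mathcal Z(\psi)$ is the set of ordered pairs $((\rho,a,b),(\rho,a',b'))$ of members (with multiplicity) of $Jord(\psi)$ with the same $\rho$ such that $\sup(a,a')$ and $\sup(b,b')$ are even while $\inf(a,a')$ and $\inf(b,b')$ are odd. $\mathcal Z_W(\psi)\subset\mathcal Z(\psi)$ is the subset of pairs with $a+a'<b+b'$, or with $a-b=b'-a'\neq0$ and $\zeta(a+b)+\zeta'(a'+b')<0$,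 $\zeta,\zeta'$ being the signs of $a-b$, $a'-b'$. $\mathcal Z_U(\psi)=\mathcal Z(\psi)\setminus\mathcal Z_W(\psi)$. $\mathcal Z_?(\psi)_{(\rho,a,b)}$ is the set (with multiplicity) of $(\rho,a',b')\in Jord(\psi)$ such that $((\rho,a,b),(\rho,a',b'))\in\mathcal Z_?(\psi)$. A map $\epsilon:Jord(\psi)\to\{\pm1\}$ is viewed as a character of the centralizer of $\psi$ in ${}^LH_n$ (in $O(n,\mathbb C)$ if $n$ is odd), the element acting by $-1$ on one copy of $\rho\otimes[a]\otimes[b]$ and by $+1$ on a complement having value $\epsilon(\rho,a,b)$. $z$ is the nontrivial element $-1$ of the center of $Sp(n,\mathbb C)$ (resp. of $O(n,\mathbb C)$), so $\epsilon(z)=\prod_{(\rho,a,b)\in Jord(\psi)}\epsilon(\rho,a,b)$ (product with multiplicities), and $c_{2,\psi}=\psi(1,1,-1)$ is the image of the nontrivial central element of the second copy of $SL(2,\mathbb C)$, so $\epsilon(c_{2,\psi})=\prod_{(\rho,a,b)\in Jord(\psi),\,b\text{ even}}\epsilon(\rho,a,b)$. *)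

theory Defs
  imports
    "HOL-Algebra.Algebraic_Closure_Type"
    "HOL-Library.Multiset"
    "Jordan_Normal_Form.VS_Connect"
begin

section \<open>Non-archimedean local fields and their Weil groups\<close>

text \<open>
  A non-archimedean local field is a field of type \<open>'f\<close> that is complete for a normalized
  discrete valuation \<open>v\<close> with finite residue field. The value \<open>v 0\<close> is irrelevant:
  \<open>val_ge v m x\<close> reads ``the valuation of \<open>x\<close> is at least \<open>m\<close>'', with
  the valuation of 0 infinite.
\<close>

definition val_ge :: "('f::field \<Rightarrow> int) \<Rightarrow> int \<Rightarrow> 'f \<Rightarrow> bool" where
  "val_ge v m x \<longleftrightarrow> x = 0 \<or> v x \<ge> m"

definition val_ring :: "('f::field \<Rightarrow> int) \<Rightarrow> 'f set" where
  "val_ring v = {x. val_ge v 0 x}"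

definition residue_field :: "('f::field \<Rightarrow> int) \<Rightarrow> 'f set set" where
  "residue_field v = val_ring v // {(x, y). x \<in> val_ring v \<and> y \<in> val_ring v \<and> val_ge v 1 (x - y)}"

definition residue_card :: "('f::field \<Rightarrow> int) \<Rightarrow> nat" where
  "residue_card v = card (residue_field v)"

locale nonarch_local_field =
  fixes v :: "'f::field \<Rightarrow> int"
  assumes val_mult: "x \<noteq> 0 \<Longrightarrow> y \<noteq> 0 \<Longrightarrow> v (x * y) = v x + v y"
    and val_add: "val_ge v m x \<Longrightarrow> val_ge v m y \<Longrightarrow> val_ge v m (x + y)"
    and val_normalized: "\<exists>x. x \<noteq> 0 \<and> v x = 1"
    and val_complete:
      "\<And>s :: nat \<Rightarrow> 'f. (\<And>m. \<exists>N. \<forall>i\<ge>N. \<forall>j\<ge>N. val_ge v m (s i - s j)) \<Longrightarrow>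
         \<exists>l. \<forall>m. \<exists>N. \<forall>i\<ge>N. val_ge v m (s i - l)"
    and finite_residue_field: "finite (residue_field v)"

text \<open>The integral closure of the valuation ring in the algebraic closure; for a local field
  this is again a local ring, so its maximal ideal consists of the non-units.\<close>

definition int_closure :: "('f::field \<Rightarrow> int) \<Rightarrow> 'f alg_closure set" where
  "int_closure v = {x. \<exists>p. Polynomial.lead_coeff p = 1 \<and> (\<forall>i. poly.coeff p i \<in> val_ring v) \<and>
                          poly (map_poly to_ac p) x = 0}"

definition int_closure_max_ideal :: "('f::field \<Rightarrow> int) \<Rightarrow> 'f alg_closure set" where
  "int_closure_max_ideal v =
     {x \<in> int_closure v. \<not> (\<exists>y \<in> int_closure v. x * y = 1)}"

text \<open>
  Restriction identifies the \<open>F\<close>-automorphisms of an algebraic closure with the absolute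
  Galois group of \<open>F\<close>, also in positive characteristic, where the separable closure is
  smaller.
\<close>

definition Galois_aut :: "('f::field alg_closure \<Rightarrow> 'f alg_closure) \<Rightarrow> bool" where
  "Galois_aut \<sigma> \<longleftrightarrow> bij \<sigma> \<and> (\<forall>x y. \<sigma> (x + y) = \<sigma> x + \<sigma> y) \<and>
     (\<forall>x y. \<sigma> (x * y) = \<sigma> x * \<sigma> y) \<and> (\<forall>c. \<sigma> (to_ac c) = to_ac c)"

text \<open>\<open>\<sigma>\<close> induces the \<open>m\<close>-th power of the Frobenius \<open>x \<mapsto> x^q\<close>
  on the residue field of the algebraic closure.\<close>

definition induces_Frob_power ::
  "('f::field \<Rightarrow> int) \<Rightarrow> ('f alg_closure \<Rightarrow> 'f alg_closure) \<Rightarrow> int \<Rightarrow> bool" where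
  "induces_Frob_power v \<sigma> m \<longleftrightarrow>
     (\<forall>x \<in> int_closure v.
        if m \<ge> 0 then \<sigma> x - x ^ (residue_card v ^ nat m) \<in> int_closure_max_ideal v
        else \<sigma> x ^ (residue_card v ^ nat (- m)) - x \<in> int_closure_max_ideal v)"

definition Weil_group :: "('f::field \<Rightarrow> int) \<Rightarrow> ('f alg_closure \<Rightarrow> 'f alg_closure) monoid" where
  "Weil_group v =
     \<lparr>carrier = {\<sigma>. Galois_aut \<sigma> \<and> (\<exists>m. induces_Frob_power v \<sigma> m)}, monoid.mult = (\<circ>), one = id\<rparr>"

definition inertia :: "('f::field \<Rightarrow> int) \<Rightarrow> ('f alg_closure \<Rightarrow> 'f alg_closure) set" where
  "inertia v = {\<sigma>. Galois_aut \<sigma> \<and> induces_Frob_power v \<sigma> 0}"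

section \<open>Finite-dimensional complex matrix representations\<close>

definition GL :: "nat \<Rightarrow> complex mat monoid" where
  "GL n = \<lparr>carrier = {A \<in> carrier_mat n n. invertible_mat A}, monoid.mult = (*), one = 1\<^sub>m n\<rparr>"

definition SL2 :: "complex mat monoid" where
  "SL2 = \<lparr>carrier = {A \<in> carrier_mat 2 2. det A = 1}, monoid.mult = (*), one = 1\<^sub>m 2\<rparr>"

definition mat_rep :: "('g, 'h) monoid_scheme \<Rightarrow> nat \<Rightarrow> ('g \<Rightarrow> complex mat) \<Rightarrow> bool" where
  "mat_rep G n \<rho> \<longleftrightarrow> \<rho> \<in> hom G (GL n)"

definition rep_dim :: "('g, 'h) monoid_scheme \<Rightarrow> ('g \<Rightarrow> complex mat) \<Rightarrow> nat" where
  "rep_dim G \<rho> = dim_row (\<rho> \<one>\<^bsub>G\<^esub>)"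

definition rep_equiv ::
  "('g, 'h) monoid_scheme \<Rightarrow> nat \<Rightarrow> ('g \<Rightarrow> complex mat) \<Rightarrow> ('g \<Rightarrow> complex mat) \<Rightarrow> bool" where
  "rep_equiv G n \<rho> \<sigma> \<longleftrightarrow>
     (\<exists>P \<in> carrier (GL n). \<forall>g \<in> carrier G.
        \<rho> g \<in> carrier_mat n n \<and> \<sigma> g \<in> carrier_mat n n \<and> \<rho> g * P = P * \<sigma> g)"

definition irreducible_rep :: "('g, 'h) monoid_scheme \<Rightarrow> nat \<Rightarrow> ('g \<Rightarrow> complex mat) \<Rightarrow> bool" where
  "irreducible_rep G n \<rho> \<longleftrightarrow> mat_rep G n \<rho> \<and> n > 0 \<and>
     (\<forall>U. subspace class_ring U (module_vec TYPE(complex) n) \<longrightarrow>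
          (\<forall>g \<in> carrier G. \<forall>u \<in> U. \<rho> g *\<^sub>v u \<in> U) \<longrightarrow>
          U = {0\<^sub>v n} \<or> U = carrier_vec n)"

definition dual_rep :: "('g, 'h) monoid_scheme \<Rightarrow> ('g \<Rightarrow> complex mat) \<Rightarrow> 'g \<Rightarrow> complex mat" where
  "dual_rep G \<rho> g = transpose_mat (\<rho> (inv\<^bsub>G\<^esub> g))"

definition self_dual :: "('g, 'h) monoid_scheme \<Rightarrow> nat \<Rightarrow> ('g \<Rightarrow> complex mat) \<Rightarrow> bool" where
  "self_dual G n \<rho> \<longleftrightarrow> rep_equiv G n \<rho> (dual_rep G \<rho>)"

text \<open>Continuity of a finite-dimensional complex representation of the Weil group: it is trivial
  on an open subgroup of inertia, i.e. on the part of inertia fixing some finite set.\<close>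

definition smooth_rep ::
  "('f::field \<Rightarrow> int) \<Rightarrow> nat \<Rightarrow> (('f alg_closure \<Rightarrow> 'f alg_closure) \<Rightarrow> complex mat) \<Rightarrow> bool" where
  "smooth_rep v n \<rho> \<longleftrightarrow>
     (\<exists>S. finite S \<and> (\<forall>\<sigma> \<in> inertia v. (\<forall>x \<in> S. \<sigma> x = x) \<longrightarrow> \<rho> \<sigma> = 1\<^sub>m n))"

definition kron :: "complex mat \<Rightarrow> complex mat \<Rightarrow> complex mat" where
  "kron A B = mat (dim_row A * dim_row B) (dim_col A * dim_col B)
     (\<lambda>(i, j). A $$ (i div dim_row B, j div dim_col B) * B $$ (i mod dim_row B, j mod dim_col B))"

text \<open>
  The \<open>c\<close>-dimensional irreducible representation \<open>[c]\<close> of \<open>SL(2)\<close>: the binary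
  forms of degree \<open>c - 1\<close> in the basis \<open>X^i Y^(c-1-i)\<close>, with \<open>A\<close> acting by
  \<open>X \<mapsto> A00 X + A10 Y\<close> and \<open>Y \<mapsto> A01 X + A11 Y\<close>, dehomogenized at
  \<open>Y = 1\<close>.
\<close>

definition sym_rep :: "nat \<Rightarrow> complex mat \<Rightarrow> complex mat" where
  "sym_rep c A = mat c c (\<lambda>(k, i).
     poly.coeff ([:A $$ (1,0), A $$ (0,0):] ^ i * [:A $$ (1,1), A $$ (0,1):] ^ (c - 1 - i)) k)"

section \<open>Parameters\<close>

type_synonym 'f Weil_rep = "('f alg_closure \<Rightarrow> 'f alg_closure) \<Rightarrow> complex mat"
type_synonym 'f param_elt = "('f alg_closure \<Rightarrow> 'f alg_closure) \<times> complex mat \<times> complex mat"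

definition param_group :: "('f::field \<Rightarrow> int) \<Rightarrow> 'f param_elt monoid" where
  "param_group v = Weil_group v \<times>\<times> (SL2 \<times>\<times> SL2)"

definition triple_rep :: "'f::field Weil_rep \<times> nat \<times> nat \<Rightarrow> 'f param_elt \<Rightarrow> complex mat" where
  "triple_rep = (\<lambda>(\<rho>, a, b) (w, g, h). kron (\<rho> w) (kron (sym_rep a g) (sym_rep b h)))"

definition triple_dim :: "('f::field \<Rightarrow> int) \<Rightarrow> 'f Weil_rep \<times> nat \<times> nat \<Rightarrow> nat" where
  "triple_dim v = (\<lambda>(\<rho>, a, b). rep_dim (Weil_group v) \<rho> * (a * b))"

definition Sp :: "nat \<Rightarrow> complex mat set" where
  "Sp n = (let k = n div 2;
               \<Omega> = four_block_mat (0\<^sub>m k k) (1\<^sub>m k) (- 1\<^sub>m k) (0\<^sub>m k k)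
           in {A \<in> carrier_mat n n. transpose_mat A * \<Omega> * A = \<Omega>})"

definition O_group :: "nat \<Rightarrow> complex mat set" where
  "O_group n = {A \<in> carrier_mat n n. transpose_mat A * A = 1\<^sub>m n}"

definition SO_group :: "nat \<Rightarrow> complex mat set" where
  "SO_group n = {A \<in> O_group n. det A = 1}"

definition dual_group :: "nat \<Rightarrow> complex mat set" where
  "dual_group n = (if even n then Sp n else SO_group n)"

definition parameter :: "('f::field \<Rightarrow> int) \<Rightarrow> nat \<Rightarrow> ('f param_elt \<Rightarrow> complex mat) \<Rightarrow> bool" where
  "parameter v n \<psi> \<longleftrightarrow>
     mat_rep (param_group v) n \<psi> \<and> (\<forall>g \<in> carrier (param_group v). \<psi> g \<in> dual_group n)"

text \<open>
  \<open>J\<close> is the multiset of triples occurring in \<open>\<psi>\<close>, the \<open>\<rho>\<close>'s being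
  self-dual. An isomorphism class of representations of the Weil group is recorded by one chosen
  representative, so that equality of first components means isomorphism.
\<close>

definition is_Jord ::
  "('f::field \<Rightarrow> int) \<Rightarrow> nat \<Rightarrow> ('f param_elt \<Rightarrow> complex mat) \<Rightarrow>
     ('f Weil_rep \<times> nat \<times> nat) multiset \<Rightarrow> bool" where
  "is_Jord v n \<psi> J \<longleftrightarrow>
     (\<forall>(\<rho>, a, b) \<in># J. a \<ge> 1 \<and> b \<ge> 1 \<and>
        irreducible_rep (Weil_group v) (rep_dim (Weil_group v) \<rho>) \<rho> \<and>
        smooth_rep v (rep_dim (Weil_group v) \<rho>) \<rho> \<and>
        self_dual (Weil_group v) (rep_dim (Weil_group v) \<rho>) \<rho>) \<and>
     (\<forall>(\<rho>, a, b) \<in># J. \<forall>(\<rho>', a', b') \<in># J.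
        rep_equiv (Weil_group v) (rep_dim (Weil_group v) \<rho>) \<rho> \<rho>' \<longrightarrow> \<rho> = \<rho>') \<and>
     (\<exists>xs. mset xs = J \<and>
        rep_equiv (param_group v) n \<psi> (\<lambda>g. diag_block_mat (map (\<lambda>x. triple_rep x g) xs)))"

section \<open>Characters of the centralizer\<close>

definition centralizer ::
  "('f::field \<Rightarrow> int) \<Rightarrow> nat \<Rightarrow> ('f param_elt \<Rightarrow> complex mat) \<Rightarrow> complex mat monoid" where
  "centralizer v n \<psi> =
     \<lparr>carrier = {s \<in> (if even n then Sp n else O_group n).
                  \<forall>g \<in> carrier (param_group v). s * \<psi> g = \<psi> g * s},
      monoid.mult = (*), one = 1\<^sub>m n\<rparr>"

definition complex_units :: "complex monoid" where
  "complex_units = \<lparr>carrier = - {0}, monoid.mult = (*), one = 1\<rparr>"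

text \<open>\<open>s\<close> acts by \<open>-1\<close> on one copy of the representation \<open>x\<close> in
  \<open>\<psi>\<close> and by \<open>+1\<close> on an invariant complement; the columns of \<open>P\<close> form
  a basis adapted to this decomposition.\<close>

definition minus_on_one_copy ::
  "('f::field \<Rightarrow> int) \<Rightarrow> nat \<Rightarrow> ('f param_elt \<Rightarrow> complex mat) \<Rightarrow>
     'f Weil_rep \<times> nat \<times> nat \<Rightarrow> complex mat \<Rightarrow> bool" where
  "minus_on_one_copy v n \<psi> x s \<longleftrightarrow>
     (let d = triple_dim v x; e = n - d in d \<le> n \<and>
      (\<exists>P \<in> carrier (GL n).
         s * P = P * four_block_mat (- 1\<^sub>m d) (0\<^sub>m d e) (0\<^sub>m e d) (1\<^sub>m e) \<and>
         (\<forall>g \<in> carrier (param_group v). \<exists>D \<in> carrier_mat e e.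
            \<psi> g * P = P * four_block_mat (triple_rep x g) (0\<^sub>m d e) (0\<^sub>m e d) D)))"

text \<open>\<open>\<chi>\<close> is the map \<open>\<epsilon>\<close> viewed as a character of the centralizer.
  It is determined by \<open>\<epsilon>\<close>: the centralizer is a product of groups \<open>O(m)\<close>, which
  are generated by reflections, and of perfect groups \<open>Sp(m)\<close>.\<close>

definition is_character_of ::
  "('f::field \<Rightarrow> int) \<Rightarrow> nat \<Rightarrow> ('f param_elt \<Rightarrow> complex mat) \<Rightarrow>
     ('f Weil_rep \<times> nat \<times> nat) multiset \<Rightarrow> ('f Weil_rep \<times> nat \<times> nat \<Rightarrow> int) \<Rightarrow>
     (complex mat \<Rightarrow> complex) \<Rightarrow> bool" where
  "is_character_of v n \<psi> J \<epsilon> \<chi> \<longleftrightarrow>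
     \<chi> \<in> hom (centralizer v n \<psi>) complex_units \<and>
     (\<forall>x \<in># J. \<forall>s \<in> carrier (centralizer v n \<psi>).
        minus_on_one_copy v n \<psi> x s \<longrightarrow> \<chi> s = of_int (\<epsilon> x))"

definition central_z :: "nat \<Rightarrow> complex mat" where
  "central_z n = - 1\<^sub>m n"

definition c2 :: "('f::field param_elt \<Rightarrow> complex mat) \<Rightarrow> complex mat" where
  "c2 \<psi> = \<psi> (id, 1\<^sub>m 2, - 1\<^sub>m 2)"

section \<open>The sets \<open>\<Z>\<close>, \<open>\<Z>\<^sub>W\<close>, \<open>\<Z>\<^sub>U\<close>\<close>

datatype Z_kind = Z_all | Z_W | Z_U

definition in_Z :: "('r \<times> nat \<times> nat) \<times> ('r \<times> nat \<times> nat) \<Rightarrow> bool" where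
  "in_Z = (\<lambda>((\<rho>, a, b), (\<rho>', a', b')).
     \<rho> = \<rho>' \<and> even (max a a') \<and> even (max b b') \<and> odd (min a a') \<and> odd (min b b'))"

definition W_condition :: "('r \<times> nat \<times> nat) \<times> ('r \<times> nat \<times> nat) \<Rightarrow> bool" where
  "W_condition = (\<lambda>((\<rho>, a, b), (\<rho>', a', b')).
     a + a' < b + b' \<or>
     (int a - int b = int b' - int a' \<and> int a - int b \<noteq> 0 \<and>
      sgn (int a - int b) * int (a + b) + sgn (int a' - int b') * int (a' + b') < 0))"

fun in_Z_kind :: "Z_kind \<Rightarrow> ('r \<times> nat \<times> nat) \<times> ('r \<times> nat \<times> nat) \<Rightarrow> bool" where
  "in_Z_kind Z_all p = in_Z p"
| "in_Z_kind Z_W p = (in_Z p \<and> W_condition p)"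
| "in_Z_kind Z_U p = (in_Z p \<and> \<not> W_condition p)"

definition Z_set ::
  "Z_kind \<Rightarrow> ('r \<times> nat \<times> nat) multiset \<Rightarrow> (('r \<times> nat \<times> nat) \<times> ('r \<times> nat \<times> nat)) multiset" where
  "Z_set k J = filter_mset (in_Z_kind k) (\<Sum>x\<in>#J. image_mset (Pair x) J)"

definition Z_at ::
  "Z_kind \<Rightarrow> ('r \<times> nat \<times> nat) multiset \<Rightarrow> 'r \<times> nat \<times> nat \<Rightarrow> ('r \<times> nat \<times> nat) multiset" where
  "Z_at k J x = filter_mset (\<lambda>y. in_Z_kind k (x, y)) J"

definition eps :: "Z_kind \<Rightarrow> ('r \<times> nat \<times> nat) multiset \<Rightarrow> 'r \<times> nat \<times> nat \<Rightarrow> int" where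
  "eps k J x = (- 1) ^ size (Z_at k J x)"

definition z_sign :: "Z_kind \<Rightarrow> ('r \<times> nat \<times> nat) multiset \<Rightarrow> int" where
  "z_sign k J = (- 1) ^ (size (Z_set k J) div 2)"

text \<open>The truncating division in \<open>z_sign\<close> is exact.\<close>

lemma in_Z_kind_sym: "in_Z_kind k (x, y) \<longleftrightarrow> in_Z_kind k (y, x)"
proof -
  obtain \<rho> a b \<rho>' a' b' where xy: "x = (\<rho>, a, b)" "y = (\<rho>', a', b')"
    by (cases x, cases y) auto
  have "in_Z (x, y) \<longleftrightarrow> in_Z (y, x)"
    unfolding xy in_Z_def by (auto simp: max.commute min.commute)
  moreover have "W_condition (x, y) \<longleftrightarrow> W_condition (y, x)"
  proof -
    have "int a - int b = int b' - int a' \<and> int a - int b \<noteq> 0 \<longleftrightarrow>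
        int a' - int b' = int b - int a \<and> int a' - int b' \<noteq> 0"
      by linarith
    then show ?thesis
      unfolding xy W_condition_def prod.case by (metis add.commute)
  qed
  ultimately show ?thesis
    by (cases k) auto
qed

lemma in_Z_kind_irrefl: "\<not> in_Z_kind k (x, x)"
  by (cases k; cases x) (auto simp: in_Z_def)

lemma even_size_Z_set: "even (size (Z_set k J))"
proof -
  have step: "size (filter_mset P (\<Sum>x\<in>#K. add_mset (x, y) (image_mset (Pair x) J))) =
      size (filter_mset P (\<Sum>x\<in>#K. image_mset (Pair x) J)) + size (filter_mset (\<lambda>x. P (x, y)) K)"
    for P :: "'c \<times> 'c \<Rightarrow> bool" and K J y
    by (induction K) auto
  have size_image: "size (filter_mset P (image_mset (Pair y) J)) = size (filter_mset (\<lambda>x. P (y, x)) J)"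
    for P :: "'c \<times> 'c \<Rightarrow> bool" and J y
    by (induction J) auto
  show ?thesis
    unfolding Z_set_def
  proof (induction J)
    case (add y J)
    have "filter_mset (\<lambda>x. in_Z_kind k (x, y)) J = filter_mset (\<lambda>x. in_Z_kind k (y, x)) J"
      using in_Z_kind_sym[of k _ y] by (intro filter_mset_cong) auto
    then show ?case
      using add by (simp add: step size_image in_Z_kind_irrefl)
  qed simp
qed

end

theory Submission
  imports Defs
begin

text \<open>
  The parameter \<open>\<psi>\<close> preserves a form \<open>B\<close> and is a direct sum of the representations in \<open>J\<close>. By Schur's
  lemma a \<open>B\<close>-pairing between two summands is zero or perfect, and in the latter case the summands
  are isomorphic. Hence the space is an orthogonal sum of nondegenerate copies of some \<open>x\<close> and of
  hyperbolic planes \<open>x \<oplus> x\<close>. On a nondegenerate copy, \<open>-1\<close> is a reflection, on which \<open>\<chi>\<close> takes the value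
  \<open>\<epsilon> x\<close>. On a hyperbolic plane, \<open>-1\<close> is the square of a torus element that is conjugate to its inverse,
  so that \<open>\<chi>\<close> takes the value \<open>1 = (\<epsilon> x)\<^sup>2\<close>. Whatever the signs of the forms, \<open>\<chi> (-1)\<close> and \<open>\<chi> c\<^sub>2\<close> are therefore
  the products of the \<open>\<epsilon> x\<close> over all \<open>x\<close> and over those with \<open>b\<close> even. The exponents are the
  number of pairs in \<open>\<Z>\<close> and the number of those whose first member has even \<open>b\<close>, and the latter
  is half of the former.
\<close>

text \<open>Besides multiplicativity, the hypothesis on \<open>\<chi>\<close> speaks only of
  elements that are -1 on one copy, and such an isometry exists only for a copy on which the form is
  nondegenerate. Instead of computing the sign of the form on \<rho> \<otimes> [a] \<otimes> [b],
  each step asks whether one of the copies at hand is nondegenerate. If none is, each copy pairs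
  with another, and the relation \<open>s * (w * s) = w\<close> between explicit isometries does the
  work of the perfectness of Sp(m).

  Projecting the other copies away from a summand that is split off can change their Gram matrices,
  so the question is asked anew at each step. The induction therefore runs over self-adjoint
  projections \<open>f\<close>, with the element that is \<open>z\<close> on the image of
  \<open>f\<close> and 1 on its kernel.

  A copy is a rectangular matrix with a left inverse rather than a subspace, so that invariance,
  orthogonality and Gram matrices become matrix equations. Schur's lemma is proved for invariant
  pairings because the Gram matrix of two copies is one; self-duality turns such a pairing into an
  isomorphism of the \<rho>'s.\<close>

section \<open>Complex matrices\<close>

text \<open>The library rules restated with equations between dimensions as premises: unlike
  \<open>carrier_mat\<close> premises, these have no free variables, so the simplifier can discharge them.\<close>

lemma mat_assoc_dim:
  fixes A B C :: "complex mat"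
  shows "dim_col A = dim_row B \<Longrightarrow> dim_col B = dim_row C \<Longrightarrow> A * B * C = A * (B * C)"
  by (rule assoc_mult_mat[of _ "dim_row A" "dim_row B" _ "dim_row C" _ "dim_col C"]) auto

lemma mat_add_distrib_dim:
  fixes A B C :: "complex mat"
  shows "dim_row B = dim_row C \<Longrightarrow> dim_col B = dim_col C \<Longrightarrow> dim_col A = dim_row B \<Longrightarrow>
      A * (B + C) = A * B + A * C"
    and "dim_row A = dim_row B \<Longrightarrow> dim_col A = dim_col B \<Longrightarrow> dim_col A = dim_row C \<Longrightarrow>
      (A + B) * C = A * C + B * C"
  by (rule mult_add_distrib_mat[of _ "dim_row A" "dim_row B" _ "dim_col C"]; auto)
     (rule add_mult_distrib_mat[of _ "dim_row A" "dim_col A" _ _ "dim_col C"]; auto)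

lemma mat_minus_distrib_dim:
  fixes A B C :: "complex mat"
  shows "dim_row B = dim_row C \<Longrightarrow> dim_col B = dim_col C \<Longrightarrow> dim_col A = dim_row B \<Longrightarrow>
      A * (B - C) = A * B - A * C"
    and "dim_row A = dim_row B \<Longrightarrow> dim_col A = dim_col B \<Longrightarrow> dim_col A = dim_row C \<Longrightarrow>
      (A - B) * C = A * C - B * C"
  by (rule mult_minus_distrib_mat[of _ "dim_row A" "dim_row B" _ "dim_col C"]; auto)
     (rule minus_mult_distrib_mat[of _ "dim_row A" "dim_col A" _ _ "dim_col C"]; auto)

lemma mat_smult_dim:
  fixes A B :: "complex mat"
  shows "dim_col A = dim_row B \<Longrightarrow> A * (c \<cdot>\<^sub>m B) = c \<cdot>\<^sub>m (A * B)"
    and "dim_col A = dim_row B \<Longrightarrow> (c \<cdot>\<^sub>m A) * B = c \<cdot>\<^sub>m (A * B)"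
  by (rule mult_smult_distrib[of _ "dim_row A" "dim_row B" _ "dim_col B"]; auto)
     (rule mult_smult_assoc_mat[of _ "dim_row A" "dim_row B" _ "dim_col B"]; auto)

lemma mat_transpose_dim:
  fixes A B :: "complex mat"
  shows "dim_col A = dim_row B \<Longrightarrow> (A * B)\<^sup>T = B\<^sup>T * A\<^sup>T"
    and "dim_row A = dim_row B \<Longrightarrow> dim_col A = dim_col B \<Longrightarrow> (A + B)\<^sup>T = A\<^sup>T + B\<^sup>T"
    and "dim_row A = dim_row B \<Longrightarrow> dim_col A = dim_col B \<Longrightarrow> (A - B)\<^sup>T = A\<^sup>T - B\<^sup>T"
    and "(c \<cdot>\<^sub>m A)\<^sup>T = c \<cdot>\<^sub>m A\<^sup>T"
  by (rule transpose_mult[of _ "dim_row A" "dim_row B" _ "dim_col B"]; auto) auto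

lemma mat_unit_dim:
  fixes A :: "complex mat"
  shows "dim_row A = m \<Longrightarrow> 1\<^sub>m m * A = A" and "dim_col A = m \<Longrightarrow> A * 1\<^sub>m m = A"
    and "dim_row A = m \<Longrightarrow> 0\<^sub>m l m * A = 0\<^sub>m l (dim_col A)"
    and "dim_col A = m \<Longrightarrow> A * 0\<^sub>m m l = 0\<^sub>m (dim_row A) l"
    and "dim_row A = m \<Longrightarrow> dim_col A = l \<Longrightarrow> 0\<^sub>m m l + A = A"
    and "dim_row A = m \<Longrightarrow> dim_col A = l \<Longrightarrow> A + 0\<^sub>m m l = A"
    and "dim_row A = m \<Longrightarrow> dim_col A = l \<Longrightarrow> A - 0\<^sub>m m l = A"
    and "c \<cdot>\<^sub>m 0\<^sub>m m l = 0\<^sub>m m l"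
    and "A - A = 0\<^sub>m (dim_row A) (dim_col A)"
    and "1 \<cdot>\<^sub>m A = A" and "c \<cdot>\<^sub>m (c' \<cdot>\<^sub>m A) = (c * c') \<cdot>\<^sub>m A"
  by (auto simp: left_mult_one_mat' right_mult_one_mat')

lemmas mat_dim_simps = mat_add_distrib_dim mat_minus_distrib_dim mat_smult_dim
  mat_transpose_dim mat_unit_dim mat_assoc_dim

text \<open>Padding \<open>A\<close> with zero rows gives a square matrix \<open>M\<close> with a
  vanishing row \<open>r\<close>, hence of determinant 0, and \<open>A\<close> kills every vector
  that \<open>M\<close> kills.\<close>

lemma exists_kernel_vector:
  fixes A :: "complex mat"
  assumes A: "A \<in> carrier_mat r c" and rc: "r < c"
  shows "\<exists>v. v \<in> carrier_vec c \<and> v \<noteq> 0\<^sub>v c \<and> A *\<^sub>v v = 0\<^sub>v r"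
proof -
  define M where "M = mat c c (\<lambda>(i, j). if i < r then A $$ (i, j) else 0)"
  have M: "M \<in> carrier_mat c c" by (simp add: M_def)
  have "row M r = 0\<^sub>v c" using rc by (auto simp: M_def)
  have "det M = 0"
  proof (rule ccontr)
    assume "det M \<noteq> 0"
    then have "M \<in> Units (ring_mat TYPE(complex) c ())"
      by (rule det_non_zero_imp_unit[OF M])
    then obtain N where N: "N \<in> carrier_mat c c" "M * N = 1\<^sub>m c"
      by (auto simp: Units_def ring_mat_simps)
    have "(M * N) $$ (r, r) = 0"
      using rc M N(1) \<open>row M r = 0\<^sub>v c\<close> by simp
    then show False using N rc by simp
  qed
  then obtain v where v: "v \<in> carrier_vec c" "v \<noteq> 0\<^sub>v c" "M *\<^sub>v v = 0\<^sub>v c"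
    using det_0_iff_vec_prod_zero[OF M] by auto
  have "A *\<^sub>v v = 0\<^sub>v r"
  proof (rule eq_vecI)
    fix i assume "i < dim_vec (0\<^sub>v r :: complex vec)"
    then have i: "i < r" by simp
    have "row M i = row A i" using A i rc by (intro eq_vecI) (auto simp: M_def)
    then have "vec_index (A *\<^sub>v v) i = vec_index (M *\<^sub>v v) i" using A M i rc by simp
    then show "vec_index (A *\<^sub>v v) i = vec_index (0\<^sub>v r) i" using v(3) i rc by simp
  qed (use A in auto)
  with v show ?thesis by blast
qed

text \<open>The shape in which Schur's lemma delivers its result. Squareness is part of the
  conclusion, since a kernel vector exists as soon as \<open>A\<close> or its transpose has more
  columns than rows.\<close>

lemma invertible_if_trivial_kernels:
  fixes A :: "complex mat"
  assumes A: "A \<in> carrier_mat r c"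
    and inj: "\<And>v. v \<in> carrier_vec c \<Longrightarrow> A *\<^sub>v v = 0\<^sub>v r \<Longrightarrow> v = 0\<^sub>v c"
    and injT: "\<And>v. v \<in> carrier_vec r \<Longrightarrow> A\<^sup>T *\<^sub>v v = 0\<^sub>v c \<Longrightarrow> v = 0\<^sub>v r"
  shows "r = c \<and> (\<exists>A' \<in> carrier_mat c r. A' * A = 1\<^sub>m c \<and> A * A' = 1\<^sub>m r)"
proof -
  have "\<not> r < c" using exists_kernel_vector[OF A] inj by blast
  moreover have "\<not> c < r" using exists_kernel_vector[of "A\<^sup>T" c r] A injT by auto
  ultimately have rc: "r = c" by simp
  have "det A \<noteq> 0" using det_0_iff_vec_prod_zero[of A c] A inj rc by auto
  then show ?thesis
    using det_non_zero_imp_unit[of A c "()"] A rc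
    by (auto simp: Units_def ring_mat_simps)
qed

text \<open>The new column is a kernel vector \<open>v\<close> of \<open>q\<close>, and the new row is
  \<open>r0 * (1 - p * q)\<close> for a coordinate form \<open>r0\<close> with \<open>r0 * v = 1\<close>.\<close>

lemma extend_to_invertible:
  fixes p q :: "complex mat"
  assumes "p \<in> carrier_mat n d" "q \<in> carrier_mat d n" "q * p = 1\<^sub>m d"
  shows "d \<le> n \<and> (\<exists>P \<in> carrier_mat n n. \<exists>Q \<in> carrier_mat n n. Q * P = 1\<^sub>m n \<and>
      (\<forall>i<n. \<forall>j<d. P $$ (i, j) = p $$ (i, j)) \<and> (\<forall>i<d. \<forall>j<n. Q $$ (i, j) = q $$ (i, j)))"
  using assms
proof (induction "n - d" arbitrary: d p q)
  \<comment> \<open>Subtraction is truncated, so this case includes \<open>d > n\<close>, which the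
    injectivity of \<open>p\<close> excludes.\<close>
  case 0
  have "d = n"
  proof (rule ccontr)
    assume "d \<noteq> n"
    then have "n < d" using 0 by simp
    then obtain v where v: "v \<in> carrier_vec d" "v \<noteq> 0\<^sub>v d" "p *\<^sub>v v = 0\<^sub>v n"
      using exists_kernel_vector[OF 0(2)] by auto
    have "v = (q * p) *\<^sub>v v" using v 0 by simp
    also have "\<dots> = q *\<^sub>v (p *\<^sub>v v)" using v 0 by (intro assoc_mult_mat_vec) auto
    also have "\<dots> = 0\<^sub>v d" using v 0 by auto
    finally show False using v by simp
  qed
  then show ?case using 0 by auto
next
  case (Suc k)
  note p = Suc(3) and q = Suc(4) and qp = Suc(5)
  have dn: "d < n" using Suc(2) by simp
  obtain v where v: "v \<in> carrier_vec n" "v \<noteq> 0\<^sub>v n" "q *\<^sub>v v = 0\<^sub>v d"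
    using exists_kernel_vector[OF q dn] by auto
  then obtain m where m: "m < n" "vec_index v m \<noteq> 0"
    by (metis eq_vecI carrier_vecD index_zero_vec)
  define V where "V = mat n 1 (\<lambda>(i, j). vec_index v i)"
  have V: "V \<in> carrier_mat n 1" by (simp add: V_def)
  have colV: "col V 0 = v" using v by (auto simp: V_def)
  have qV: "q * V = 0\<^sub>m d 1"
    using v(3) q V colV by (intro eq_matI) (auto simp flip: index_mult_mat_vec)
  define r0 where "r0 = mat 1 n (\<lambda>(i, j). if j = m then 1 / vec_index v m else 0)"
  have r0: "r0 \<in> carrier_mat 1 n" by (simp add: r0_def)
  have r0V: "r0 * V = 1\<^sub>m 1"
    using m by (intro eq_matI) (auto simp: r0_def V_def scalar_prod_def if_distrib[of "\<lambda>x. x * _"] cong: if_cong)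
  define r where "r = r0 * (1\<^sub>m n - p * q)"
  have r: "r \<in> carrier_mat 1 n" using r0 p q by (auto simp: r_def)
  note dims = carrier_matD[OF p] carrier_matD[OF q] carrier_matD[OF V] carrier_matD[OF r0]
  have rV: "r * V = 1\<^sub>m 1" and rp: "r * p = 0\<^sub>m 1 d"
    by (simp_all add: r_def dims mat_dim_simps qV r0V qp)
  define p' where "p' = mat n (Suc d) (\<lambda>(i, j). if j < d then p $$ (i, j) else vec_index v i)"
  define q' where "q' = mat (Suc d) n (\<lambda>(i, j). if i < d then q $$ (i, j) else r $$ (0, j))"
  have p': "p' \<in> carrier_mat n (Suc d)" and q': "q' \<in> carrier_mat (Suc d) n"
    by (simp_all add: p'_def q'_def)
  have colp: "col p' j = (if j < d then col p j else col V 0)" if "j < Suc d" for j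
    using that p colV v by (auto simp: p'_def V_def)
  have rowq: "row q' i = (if i < d then row q i else row r 0)" if "i < Suc d" for i
    using that q r by (auto simp: q'_def)
  have entry: "(q' * p') $$ (i, j) = (if i < d then (if j < d then (q * p) $$ (i, j) else (q * V) $$ (i, 0))
      else (if j < d then (r * p) $$ (0, j) else (r * V) $$ (0, 0)))" if "i < Suc d" "j < Suc d" for i j
    using that p q V r p' q' by (simp add: colp rowq)
  have "q' * p' = 1\<^sub>m (Suc d)"
    using p' q' by (intro eq_matI) (auto simp: entry qp qV rp rV simp del: index_mult_mat(1))
  with Suc(1)[of "Suc d" p' q'] Suc(2) p' q' have
    "Suc d \<le> n \<and> (\<exists>P \<in> carrier_mat n n. \<exists>Q \<in> carrier_mat n n. Q * P = 1\<^sub>m n \<and>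
      (\<forall>i<n. \<forall>j<Suc d. P $$ (i, j) = p' $$ (i, j)) \<and> (\<forall>i<Suc d. \<forall>j<n. Q $$ (i, j) = q' $$ (i, j)))"
    by simp
  then obtain P Q where PQ: "Suc d \<le> n" "P \<in> carrier_mat n n" "Q \<in> carrier_mat n n" "Q * P = 1\<^sub>m n"
     "\<forall>i<n. \<forall>j<Suc d. P $$ (i, j) = p' $$ (i, j)" "\<forall>i<Suc d. \<forall>j<n. Q $$ (i, j) = q' $$ (i, j)"
    by (elim conjE bexE) (rule that)
  have "\<forall>i<n. \<forall>j<d. P $$ (i, j) = p $$ (i, j)" "\<forall>i<d. \<forall>j<n. Q $$ (i, j) = q $$ (i, j)"
    using PQ by (auto simp: p'_def q'_def)
  then show ?case using PQ dn by (meson less_imp_le_nat)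
qed

text \<open>Products are normalised to the right, where \<open>A * B\<close> occurs inside a longer
  product as \<open>A * (B * Y)\<close>; this form lets the equation act there.\<close>

lemma mat_prod_rewrite:
  fixes A B C Y :: "complex mat"
  shows "A * B = C \<Longrightarrow> dim_col A = dim_row B \<Longrightarrow> dim_col B = dim_row Y \<Longrightarrow> A * (B * Y) = C * Y"
  using mat_assoc_dim[of A B Y] by simp

section \<open>Isometries of an invariant form\<close>

text \<open>\<open>\<delta>\<close> is the sign of the form: 1 in the orthogonal and -1 in the
  symplectic case. \<open>schur\<close> speaks of pairings of two representations, not of maps
  between them: \<open>\<beta>\<close> is to be the Gram matrix of a copy of \<open>y\<close>
  against a copy of \<open>y'\<close>. It yields invertibility, but not uniqueness up to
  scalars.\<close>

locale invariant_form =
  fixes n :: nat and B B' :: "complex mat" and \<delta> :: complex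
    and G :: "'g set" and \<psi> :: "'g \<Rightarrow> complex mat"
    and Irr :: "'x set" and d :: "'x \<Rightarrow> nat" and R :: "'x \<Rightarrow> 'g \<Rightarrow> complex mat"
  assumes B: "B \<in> carrier_mat n n" "B' \<in> carrier_mat n n" "B' * B = 1\<^sub>m n"
    and B_transpose: "B\<^sup>T = \<delta> \<cdot>\<^sub>m B" "\<delta> * \<delta> = 1"
    and \<psi>_carrier: "g \<in> G \<Longrightarrow> \<psi> g \<in> carrier_mat n n"
    and \<psi>_invariant: "g \<in> G \<Longrightarrow> (\<psi> g)\<^sup>T * (B * \<psi> g) = B"
    and R_carrier: "y \<in> Irr \<Longrightarrow> g \<in> G \<Longrightarrow> R y g \<in> carrier_mat (d y) (d y)"
    and d_pos: "y \<in> Irr \<Longrightarrow> d y > 0"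
    and schur: "y \<in> Irr \<Longrightarrow> y' \<in> Irr \<Longrightarrow> \<beta> \<in> carrier_mat (d y) (d y') \<Longrightarrow>
      (\<And>g. g \<in> G \<Longrightarrow> (R y g)\<^sup>T * (\<beta> * R y' g) = \<beta>) \<Longrightarrow> \<beta> \<noteq> 0\<^sub>m (d y) (d y') \<Longrightarrow>
      y = y' \<and> (\<exists>\<beta>' \<in> carrier_mat (d y) (d y). \<beta>' * \<beta> = 1\<^sub>m (d y) \<and> \<beta> * \<beta>' = 1\<^sub>m (d y))"
begin

definition isometries :: "complex mat set" where
  "isometries = {s \<in> carrier_mat n n. s\<^sup>T * (B * s) = B \<and> (\<forall>g\<in>G. s * \<psi> g = \<psi> g * s)}"

definition intertwiner :: "'x \<Rightarrow> complex mat \<Rightarrow> bool" where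
  "intertwiner y p \<longleftrightarrow> y \<in> Irr \<and> p \<in> carrier_mat n (d y) \<and> (\<forall>g\<in>G. \<psi> g * p = p * R y g)"

text \<open>These are the projections commuting with \<open>\<psi>\<close> whose image and kernel
  are orthogonal for \<open>B\<close>; the image is then nondegenerate.\<close>

definition self_adjoint_idem :: "complex mat \<Rightarrow> bool" where
  "self_adjoint_idem e \<longleftrightarrow> e \<in> carrier_mat n n \<and> e * e = e \<and> e\<^sup>T * B = B * e \<and>
     (\<forall>g\<in>G. e * \<psi> g = \<psi> g * e)"

text \<open>The images of the \<open>p i\<close> are independent and together span the image of \<open>f\<close>;
  the spanning condition is stated by duality, which avoids sums of matrices.\<close>

definition decomposes ::
  "complex mat \<Rightarrow> 'i set \<Rightarrow> ('i \<Rightarrow> complex mat) \<Rightarrow> ('i \<Rightarrow> complex mat) \<Rightarrow> ('i \<Rightarrow> 'x) \<Rightarrow> bool" where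
  "decomposes f I p q x \<longleftrightarrow> finite I \<and> f \<in> carrier_mat n n \<and> f\<^sup>T * B = B * f \<and>
     (\<forall>i\<in>I. intertwiner (x i) (p i) \<and> q i \<in> carrier_mat (d (x i)) n \<and>
        q i * p i = 1\<^sub>m (d (x i)) \<and> f * p i = p i) \<and>
     (\<forall>i\<in>I. \<forall>j\<in>I. i \<noteq> j \<longrightarrow> q i * p j = 0\<^sub>m (d (x i)) (d (x j))) \<and>
     (\<forall>m. \<forall>A \<in> carrier_mat m n. (\<forall>i\<in>I. A * p i = 0\<^sub>m m (d (x i))) \<longrightarrow> A * f = 0\<^sub>m m n)"

lemmas dims[simp] = carrier_matD[OF B(1)] carrier_matD[OF B(2)]
  carrier_matD[OF \<psi>_carrier] carrier_matD[OF R_carrier]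

lemma B_cancel:
  assumes "B * M = B * N" "M \<in> carrier_mat n m" "N \<in> carrier_mat n m"
  shows "M = N"
proof -
  have "B' * (B * L) = L" if "L \<in> carrier_mat n m" for L
    using assoc_mult_mat[OF B(2) B(1) that] left_mult_one_mat[OF that] B(3) by simp
  from this[OF assms(2)] this[OF assms(3)] show ?thesis
    unfolding assms(1) by (rule box_equals[rotated 1]) (rule refl)
qed

text \<open>A Gram-Schmidt step: \<open>1 - e\<close> projects the remaining copies into the
  orthogonal complement of the image of \<open>e\<close>. As \<open>q i * e = 0\<close>, the old
  \<open>q i\<close> remain dual to the projected copies. If \<open>A\<close> kills these, then
  \<open>A - A * e\<close> kills all \<open>p i\<close>, hence \<open>f\<close>, and
  \<open>e * f = e\<close> turns this into \<open>A * (f - e) = 0\<close>.\<close>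

lemma decomposes_diff:
  assumes f: "decomposes f I p q x" and e: "self_adjoint_idem e" and fe: "f * e = e"
    and K: "K \<subseteq> I" "\<And>k. k \<in> K \<Longrightarrow> e * p k = p k"
    and qe: "\<And>i. i \<in> I - K \<Longrightarrow> q i * e = 0\<^sub>m (d (x i)) n"
  shows "decomposes (f - e) (I - K) (\<lambda>i. p i - e * p i) q x"
proof -
  have fc: "f \<in> carrier_mat n n" and fB: "f\<^sup>T * B = B * f" using f by (auto simp: decomposes_def)
  have ec: "e \<in> carrier_mat n n" and eB: "e\<^sup>T * B = B * e" and ee: "e * e = e"
    and e\<psi>: "\<And>g. g \<in> G \<Longrightarrow> e * \<psi> g = \<psi> g * e"
    using e by (auto simp: self_adjoint_idem_def)
  note [simp] = carrier_matD[OF fc] carrier_matD[OF ec]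
  \<comment> \<open>This is the adjoint of \<open>f * e = e\<close>, both factors being self-adjoint
    for the nondegenerate \<open>B\<close>.\<close>
  have ef: "e * f = e"
  proof (rule B_cancel)
    have "B * (e * f) = e\<^sup>T * (f\<^sup>T * B)"
      by (simp add: fB mat_prod_rewrite[OF eB] mat_assoc_dim)
    also have "\<dots> = (f * e)\<^sup>T * B" by (simp add: mat_dim_simps)
    finally show "B * (e * f) = B * e" by (simp add: fe eB)
  qed (use fc ec in auto)
  have p: "intertwiner (x i) (p i)" "q i \<in> carrier_mat (d (x i)) n"
      "q i * p i = 1\<^sub>m (d (x i))" "f * p i = p i" "x i \<in> Irr"
      "p i \<in> carrier_mat n (d (x i))" "\<And>g. g \<in> G \<Longrightarrow> \<psi> g * p i = p i * R (x i) g" if "i \<in> I" for i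
    using f that by (auto simp: decomposes_def intertwiner_def)
  have pd[simp]: "dim_row (p i) = n" "dim_col (p i) = d (x i)" "dim_row (q i) = d (x i)" "dim_col (q i) = n"
    if "i \<in> I" for i using p[OF that] by auto
  show ?thesis
    unfolding decomposes_def
  proof (intro conjI ballI allI impI)
    show "finite (I - K)" using f by (auto simp: decomposes_def)
    show "f - e \<in> carrier_mat n n" by (rule minus_carrier_mat[OF ec])
    show "(f - e)\<^sup>T * B = B * (f - e)" by (simp add: mat_dim_simps fB eB)
  next
    fix i assume "i \<in> I - K"
    then have i: "i \<in> I" "i \<in> I - K" by auto
    note [simp] = p(5)[OF i(1)]
    show "intertwiner (x i) (p i - e * p i)"
      unfolding intertwiner_def
    proof (intro conjI ballI)
      show "p i - e * p i \<in> carrier_mat n (d (x i))" using i by (intro carrier_matI) auto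
      fix g assume g: "g \<in> G"
      then show "\<psi> g * (p i - e * p i) = (p i - e * p i) * R (x i) g"
        using i by (simp add: mat_dim_simps p(7) mat_prod_rewrite[OF e\<psi>[symmetric]])
    qed (use p i in auto)
    show "q i \<in> carrier_mat (d (x i)) n" using p i by auto
    show "q i * (p i - e * p i) = 1\<^sub>m (d (x i))"
      using i by (simp add: mat_dim_simps p(3) mat_prod_rewrite[OF qe])
    show "(f - e) * (p i - e * p i) = p i - e * p i"
      using i by (simp add: mat_dim_simps p(4) mat_prod_rewrite[OF fe] mat_prod_rewrite[OF ee])
  next
    fix i j assume "i \<in> I - K" "j \<in> I - K" "i \<noteq> j"
    then have i: "i \<in> I" "i \<in> I - K" "j \<in> I" "i \<noteq> j" by auto
    then have "q i * p j = 0\<^sub>m (d (x i)) (d (x j))"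
      using f by (auto simp: decomposes_def)
    then show "q i * (p j - e * p j) = 0\<^sub>m (d (x i)) (d (x j))"
      using i by (simp add: mat_dim_simps mat_prod_rewrite[OF qe])
  next
    fix m A
    assume A: "A \<in> carrier_mat m n" "\<forall>i\<in>I - K. A * (p i - e * p i) = 0\<^sub>m m (d (x i))"
    note [simp] = carrier_matD[OF A(1)]
    have "(A - A * e) * p i = 0\<^sub>m m (d (x i))" if i: "i \<in> I" for i
    proof (cases "i \<in> K")
      case True
      then show ?thesis using i by (simp add: mat_dim_simps K(2))
    next
      case False
      then show ?thesis using i A(2)[rule_format, of i] by (simp add: mat_dim_simps)
    qed
    moreover have "A - A * e \<in> carrier_mat m n"
      by (rule minus_carrier_mat[OF mult_carrier_mat[OF A(1) ec]])
    ultimately have "(A - A * e) * f = 0\<^sub>m m n"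
      using f unfolding decomposes_def by blast
    then show "A * (f - e) = 0\<^sub>m m n"
      by (simp add: mat_dim_simps ef)
  qed
qed

lemma isometriesI:
  assumes "s \<in> carrier_mat n n" "s\<^sup>T * (B * s) = B" "\<And>g. g \<in> G \<Longrightarrow> s * \<psi> g = \<psi> g * s"
  shows "s \<in> isometries"
  using assms by (auto simp: isometries_def)

lemma one_isometry: "1\<^sub>m n \<in> isometries"
  by (rule isometriesI) (simp_all add: mat_unit_dim)

lemma mult_isometry:
  assumes "s \<in> isometries" "t \<in> isometries"
  shows "s * t \<in> isometries"
proof (rule isometriesI)
  have s: "s \<in> carrier_mat n n" "s\<^sup>T * (B * s) = B" "\<And>g. g \<in> G \<Longrightarrow> s * \<psi> g = \<psi> g * s"
    and t: "t \<in> carrier_mat n n" "t\<^sup>T * (B * t) = B" "\<And>g. g \<in> G \<Longrightarrow> t * \<psi> g = \<psi> g * t"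
    using assms by (auto simp: isometries_def)
  note [simp] = carrier_matD[OF s(1)] carrier_matD[OF t(1)]
  show "s * t \<in> carrier_mat n n" by (rule mult_carrier_mat[OF s(1) t(1)])
  have "s\<^sup>T * (B * (s * t)) = (s\<^sup>T * (B * s)) * t" by (simp add: mat_assoc_dim)
  then show "(s * t)\<^sup>T * (B * (s * t)) = B" by (simp add: mat_transpose_dim mat_assoc_dim s t)
  fix g assume g: "g \<in> G"
  show "s * t * \<psi> g = \<psi> g * (s * t)"
    using g by (simp add: mat_assoc_dim t(3) mat_prod_rewrite[OF s(3)[OF g]])
qed

lemma reflection_isometry:
  assumes "self_adjoint_idem e"
  shows "1\<^sub>m n - e - e \<in> isometries"
proof -
  have ec: "e \<in> carrier_mat n n" and eB: "e\<^sup>T * B = B * e" and ee: "e * e = e"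
    and e\<psi>: "\<And>g. g \<in> G \<Longrightarrow> e * \<psi> g = \<psi> g * e"
    using assms by (auto simp: self_adjoint_idem_def)
  note [simp] = carrier_matD[OF ec]
  show ?thesis
  proof (rule isometriesI)
    have "(1\<^sub>m n - e - e)\<^sup>T * (B * (1\<^sub>m n - e - e)) = B - B * e - B * e - (B * e - B * e - B * e) - (B * e - B * e - B * e)"
      by (simp add: mat_dim_simps mat_prod_rewrite[OF eB] eB ee)
    also have "\<dots> = B" by (intro eq_matI) (simp_all del: index_mult_mat(1))
    finally show "(1\<^sub>m n - e - e)\<^sup>T * (B * (1\<^sub>m n - e - e)) = B" .
    fix g assume g: "g \<in> G"
    show "(1\<^sub>m n - e - e) * \<psi> g = \<psi> g * (1\<^sub>m n - e - e)"
      by (simp add: mat_dim_simps e\<psi> g)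
  qed (rule minus_carrier_mat[OF ec])
qed

lemma intertwinerD:
  assumes "intertwiner y p"
  shows "y \<in> Irr" "p \<in> carrier_mat n (d y)" "dim_row p = n" "dim_col p = d y"
    "g \<in> G \<Longrightarrow> \<psi> g * p = p * R y g"
  using assms by (auto simp: intertwiner_def)

text \<open>This makes the Gram matrix of two copies an invariant pairing, the input of
  \<open>schur\<close>.\<close>

lemma gram_invariant:
  assumes p: "intertwiner y p" and r: "intertwiner y' r" and g: "g \<in> G"
  shows "(R y g)\<^sup>T * ((p\<^sup>T * (B * r)) * R y' g) = p\<^sup>T * (B * r)"
proof -
  note [simp] = intertwinerD(1,3,4)[OF p] intertwinerD(1,3,4)[OF r] g
  have "(p * R y g)\<^sup>T * (B * (r * R y' g)) = (\<psi> g * p)\<^sup>T * (B * (\<psi> g * r))"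
    by (simp add: intertwinerD(5)[OF p] intertwinerD(5)[OF r])
  also have "\<dots> = p\<^sup>T * (((\<psi> g)\<^sup>T * (B * \<psi> g)) * r)"
    by (simp add: mat_dim_simps)
  finally show ?thesis
    by (simp add: \<psi>_invariant mat_dim_simps)
qed

text \<open>\<open>b' * (p\<^sup>T * B)\<close> is a left inverse of every \<open>r\<close> with \<open>p\<^sup>T * (B * r) = b\<close>.\<close>

lemma dual_intertwiner:
  assumes p: "intertwiner y p" and b: "b \<in> carrier_mat (d y) (d y)" "b' \<in> carrier_mat (d y) (d y)"
    "b' * b = 1\<^sub>m (d y)" "b * b' = 1\<^sub>m (d y)"
    and inv: "(R y g)\<^sup>T * (b * R y g) = b" and g: "g \<in> G"
  shows "(b' * (p\<^sup>T * B)) * \<psi> g = R y g * (b' * (p\<^sup>T * B))"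
proof -
  \<comment> \<open>Invariance makes \<open>?r * b'\<close> the inverse of
    \<open>?r\<^sup>T * b\<close>. Multiplied by the latter, both sides of the goal become
    \<open>p\<^sup>T * B\<close>, so they agree.\<close>
  let ?r = "R y g" and ?q = "b' * (p\<^sup>T * B)"
  note [simp] = intertwinerD(1,3,4)[OF p] carrier_matD[OF b(1)] carrier_matD[OF b(2)] g
  have "(?r\<^sup>T * b) * (?r * b') = (?r\<^sup>T * (b * ?r)) * b'"
    by (simp add: mat_assoc_dim)
  then have "(?r\<^sup>T * b) * (?r * b') = 1\<^sub>m (d y)" by (simp add: inv b)
  moreover have "?r\<^sup>T * b \<in> carrier_mat (d y) (d y)" "?r * b' \<in> carrier_mat (d y) (d y)"
    by (intro carrier_matI; simp)+
  ultimately have L: "(?r * b') * (?r\<^sup>T * b) = 1\<^sub>m (d y)"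
    using mat_mult_left_right_inverse by blast
  have "(?r\<^sup>T * b) * (?q * \<psi> g) = (p * ?r)\<^sup>T * (B * \<psi> g)"
    by (simp add: mat_dim_simps mat_prod_rewrite[OF b(4)])
  also have "\<dots> = (\<psi> g * p)\<^sup>T * (B * \<psi> g)" by (simp add: intertwinerD(5)[OF p])
  also have "\<dots> = p\<^sup>T * B" by (simp add: mat_dim_simps \<psi>_invariant)
  finally have 1: "(?r\<^sup>T * b) * (?q * \<psi> g) = p\<^sup>T * B" .
  have "(?r\<^sup>T * b) * (?r * ?q) = (?r\<^sup>T * (b * ?r)) * ?q" by (simp add: mat_assoc_dim)
  also have "\<dots> = p\<^sup>T * B" by (simp add: inv mat_dim_simps mat_prod_rewrite[OF b(4)])
  finally have 2: "(?r\<^sup>T * b) * (?r * ?q) = p\<^sup>T * B" .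
  have cancel: "M = (?r * b') * ((?r\<^sup>T * b) * M)" if "M \<in> carrier_mat (d y) n" for M
    using mat_assoc_dim[of "?r * b'" "?r\<^sup>T * b" M] L that by (simp add: mat_unit_dim)
  have "?q * \<psi> g \<in> carrier_mat (d y) n" "?r * ?q \<in> carrier_mat (d y) n"
    by (intro carrier_matI; simp)+
  then have "?q * \<psi> g = (?r * b') * (p\<^sup>T * B)" "?r * ?q = (?r * b') * (p\<^sup>T * B)"
    using cancel[of "?q * \<psi> g"] cancel[of "?r * ?q"] unfolding 1 2 by blast+
  then show ?thesis by simp
qed

text \<open>The Gram matrix \<open>?b\<close> is invertible by \<open>schur\<close>, and
  \<open>h = b' * (p\<^sup>T * B)\<close> reads off the coordinates of the orthogonal projection
  \<open>p * h\<close> onto the copy.\<close>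

lemma anisotropic_summand:
  assumes p: "intertwiner y p" and nz: "p\<^sup>T * (B * p) \<noteq> 0\<^sub>m (d y) (d y)"
  obtains h where "h \<in> carrier_mat (d y) n" "h * p = 1\<^sub>m (d y)"
    "\<And>g. g \<in> G \<Longrightarrow> h * \<psi> g = R y g * h" "self_adjoint_idem (p * h)"
proof -
  note [simp] = intertwinerD(1,3,4)[OF p]
  let ?b = "p\<^sup>T * (B * p)"
  have bc: "?b \<in> carrier_mat (d y) (d y)" by (intro carrier_matI) simp_all
  obtain b' where b': "b' \<in> carrier_mat (d y) (d y)" "b' * ?b = 1\<^sub>m (d y)" "?b * b' = 1\<^sub>m (d y)"
    using schur[OF _ _ bc gram_invariant[OF p p] nz] by auto
  note [simp] = carrier_matD[OF b'(1)]
  define h where "h = b' * (p\<^sup>T * B)"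
  have hc: "h \<in> carrier_mat (d y) n" by (intro carrier_matI) (simp_all add: h_def)
  note [simp] = carrier_matD[OF hc]
  have hp: "h * p = 1\<^sub>m (d y)" by (simp add: h_def mat_assoc_dim b')
  have h\<psi>: "h * \<psi> g = R y g * h" if "g \<in> G" for g
    unfolding h_def by (rule dual_intertwiner[OF p bc b' gram_invariant[OF p p that] that])
  have pB: "p\<^sup>T * B = ?b * h"
  proof -
    have "?b * h = (?b * b') * (p\<^sup>T * B)" by (simp add: h_def mat_assoc_dim)
    then show ?thesis by (simp only: b') (simp add: mat_unit_dim)
  qed
  have bT: "?b\<^sup>T = \<delta> \<cdot>\<^sub>m ?b" by (simp add: mat_dim_simps B_transpose)
  have "\<delta> \<cdot>\<^sub>m (B * p) = (p\<^sup>T * B)\<^sup>T" by (simp add: mat_dim_simps B_transpose)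
  also have "\<dots> = \<delta> \<cdot>\<^sub>m (h\<^sup>T * ?b)" unfolding pB by (simp add: mat_transpose_dim(1)[of ?b] bT mat_smult_dim)
  \<comment> \<open>Multiplying by \<open>\<delta>\<close> once more lets
    \<open>\<delta> * \<delta> = 1\<close> remove it from both sides.\<close>
  finally have "\<delta> \<cdot>\<^sub>m (\<delta> \<cdot>\<^sub>m (B * p)) = \<delta> \<cdot>\<^sub>m (\<delta> \<cdot>\<^sub>m (h\<^sup>T * ?b))" by simp
  then have Bp: "B * p = h\<^sup>T * ?b" by (simp add: mat_unit_dim B_transpose)
  have "self_adjoint_idem (p * h)"
    unfolding self_adjoint_idem_def
  proof (intro conjI ballI)
    show "p * h \<in> carrier_mat n n" by (intro carrier_matI) simp_all
    show "p * h * (p * h) = p * h" by (simp add: mat_dim_simps mat_prod_rewrite[OF hp])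
    have "(p * h)\<^sup>T * B = h\<^sup>T * (p\<^sup>T * B)" by (simp add: mat_dim_simps)
    also have "\<dots> = (h\<^sup>T * ?b) * h" unfolding pB by (simp add: mat_assoc_dim)
    also have "\<dots> = B * (p * h)" by (simp add: mat_assoc_dim flip: Bp)
    finally show "(p * h)\<^sup>T * B = B * (p * h)" .
    fix g assume g: "g \<in> G"
    have "p * h * \<psi> g = p * (R y g * h)" using g by (simp add: mat_assoc_dim h\<psi>)
    also have "\<dots> = (\<psi> g * p) * h" using g by (simp add: mat_assoc_dim intertwinerD(5)[OF p])
    finally show "p * h * \<psi> g = \<psi> g * (p * h)" using g by (simp add: mat_assoc_dim)
  qed
  then show thesis using that[OF hc hp h\<psi>] by blast
qed

text \<open>On the hyperbolic plane spanned by two isotropic copies, the torus element \<open>s\<close> of order 4 is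
  inverted by \<open>w\<close>, so its square, which is \<open>-1\<close> on the plane, is killed by every character.\<close>

lemma hyperbolic_summand:
  assumes p1: "intertwiner y p1" and p2: "intertwiner y p2"
    and iso: "p1\<^sup>T * (B * p1) = 0\<^sub>m (d y) (d y)" "p2\<^sup>T * (B * p2) = 0\<^sub>m (d y) (d y)"
    and nz: "p1\<^sup>T * (B * p2) \<noteq> 0\<^sub>m (d y) (d y)"
  obtains h1 h2 s w where "h1 \<in> carrier_mat (d y) n" "h2 \<in> carrier_mat (d y) n"
    "h1 * p1 = 1\<^sub>m (d y)" "h1 * p2 = 0\<^sub>m (d y) (d y)"
    "h2 * p1 = 0\<^sub>m (d y) (d y)" "h2 * p2 = 1\<^sub>m (d y)"
    "self_adjoint_idem (p1 * h1 + p2 * h2)"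
    "s \<in> isometries" "w \<in> isometries" "s * (w * s) = w"
    "s * s = 1\<^sub>m n - (p1 * h1 + p2 * h2) - (p1 * h1 + p2 * h2)"
proof -
  note [simp] = intertwinerD(1,3,4)[OF p1] intertwinerD(1,3,4)[OF p2]
  let ?e = "1\<^sub>m (d y)"
  define b where "b = p1\<^sup>T * (B * p2)"
  define c where "c = p2\<^sup>T * (B * p1)"
  have bc: "b \<in> carrier_mat (d y) (d y)" and cc: "c \<in> carrier_mat (d y) (d y)"
    by (intro carrier_matI; simp add: b_def c_def)+
  note [simp] = carrier_matD[OF bc] carrier_matD[OF cc]
  have bT: "b\<^sup>T = \<delta> \<cdot>\<^sub>m c" and cT: "c\<^sup>T = \<delta> \<cdot>\<^sub>m b"
    by (simp_all add: b_def c_def mat_dim_simps B_transpose)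
  have binv: "(R y g)\<^sup>T * (b * R y g) = b" and cinv: "(R y g)\<^sup>T * (c * R y g) = c" if "g \<in> G" for g
    unfolding b_def c_def by (rule gram_invariant[OF p1 p2 that] gram_invariant[OF p2 p1 that])+
  obtain b' where b': "b' \<in> carrier_mat (d y) (d y)" "b' * b = ?e" "b * b' = ?e"
    using schur[OF _ _ bc binv] nz by (auto simp: b_def)
  note [simp] = carrier_matD[OF b'(1)]
  \<comment> \<open>Since \<open>c\<close> is \<open>\<delta> \<cdot>\<^sub>m b\<^sup>T\<close>, its
    inverse comes from that of \<open>b\<close>, without a second appeal to
    \<open>schur\<close>.\<close>
  define c' where "c' = \<delta> \<cdot>\<^sub>m b'\<^sup>T"
  have c'c: "c' \<in> carrier_mat (d y) (d y)" by (intro carrier_matI) (simp_all add: c'_def)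
  note [simp] = carrier_matD[OF c'c]
  have cb: "c = \<delta> \<cdot>\<^sub>m b\<^sup>T" by (simp add: bT mat_unit_dim B_transpose)
  have "c * c' = (b' * b)\<^sup>T" "c' * c = (b * b')\<^sup>T"
    unfolding cb c'_def by (simp_all add: mat_smult_dim mat_transpose_dim mat_unit_dim B_transpose)
  then have c': "c * c' = ?e" "c' * c = ?e" by (simp_all add: b')
  \<comment> \<open>The copies are isotropic, so the coordinate along \<open>p1\<close> is read off
    by pairing with \<open>p2\<close>, and conversely.\<close>
  define h1 where "h1 = c' * (p2\<^sup>T * B)"
  define h2 where "h2 = b' * (p1\<^sup>T * B)"
  have hc: "h1 \<in> carrier_mat (d y) n" "h2 \<in> carrier_mat (d y) n"
    by (intro carrier_matI; simp add: h1_def h2_def)+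
  note [simp] = carrier_matD[OF hc(1)] carrier_matD[OF hc(2)]
  have hp: "h1 * p1 = ?e" "h1 * p2 = 0\<^sub>m (d y) (d y)" "h2 * p1 = 0\<^sub>m (d y) (d y)" "h2 * p2 = ?e"
    by (simp_all add: h1_def h2_def mat_assoc_dim iso b' c' mat_unit_dim flip: b_def c_def)
  have h\<psi>: "h1 * \<psi> g = R y g * h1" "h2 * \<psi> g = R y g * h2" if g: "g \<in> G" for g
    unfolding h1_def h2_def
    by (rule dual_intertwiner[OF p2 cc c'c c'(2,1) cinv[OF g] g]
        dual_intertwiner[OF p1 bc b' binv[OF g] g])+
  have pB: "p1\<^sup>T * B = b * h2" "p2\<^sup>T * B = c * h1"
    by (simp_all add: h1_def h2_def mat_prod_rewrite[OF b'(3)] mat_prod_rewrite[OF c'(1)] mat_unit_dim)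
  have "\<delta> \<cdot>\<^sub>m (B * p1) = (p1\<^sup>T * B)\<^sup>T" "\<delta> \<cdot>\<^sub>m (B * p2) = (p2\<^sup>T * B)\<^sup>T"
    by (simp_all add: mat_dim_simps B_transpose)
  then have "\<delta> \<cdot>\<^sub>m (\<delta> \<cdot>\<^sub>m (B * p1)) = \<delta> \<cdot>\<^sub>m (\<delta> \<cdot>\<^sub>m (h2\<^sup>T * c))"
      "\<delta> \<cdot>\<^sub>m (\<delta> \<cdot>\<^sub>m (B * p2)) = \<delta> \<cdot>\<^sub>m (\<delta> \<cdot>\<^sub>m (h1\<^sup>T * b))"
    by (simp_all add: pB mat_transpose_dim bT cT mat_smult_dim)
  then have Bp: "B * p1 = h2\<^sup>T * c" "B * p2 = h1\<^sup>T * b"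
    by (simp_all add: mat_unit_dim B_transpose)
  define e where "e = p1 * h1 + p2 * h2"
  have ec: "e \<in> carrier_mat n n" by (intro carrier_matI) (simp_all add: e_def)
  note [simp] = carrier_matD[OF ec]
  have ee: "e * e = e"
    by (simp add: e_def mat_dim_simps mat_prod_rewrite[OF hp(1)] mat_prod_rewrite[OF hp(2)]
        mat_prod_rewrite[OF hp(3)] mat_prod_rewrite[OF hp(4)])
  have Be: "B * e = h2\<^sup>T * (c * h1) + h1\<^sup>T * (b * h2)"
    by (simp add: e_def mat_dim_simps mat_prod_rewrite[OF Bp(1)] mat_prod_rewrite[OF Bp(2)])
  have eB: "e\<^sup>T * B = B * e"
    unfolding Be
    by (simp add: e_def mat_dim_simps pB) (rule comm_add_mat[of _ n n]; intro carrier_matI; simp)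
  have e\<psi>: "e * \<psi> g = \<psi> g * e" if g: "g \<in> G" for g
    using g by (simp add: e_def mat_dim_simps h\<psi> mat_prod_rewrite[OF intertwinerD(5)[OF p1 g]]
        mat_prod_rewrite[OF intertwinerD(5)[OF p2 g]])
  have e: "self_adjoint_idem e"
    using ec ee eB e\<psi> by (simp add: self_adjoint_idem_def)
  define f where "f = 1\<^sub>m n - e"
  have fd[simp]: "dim_row f = n" "dim_col f = n" by (simp_all add: f_def)
  have ep: "e * p1 = p1" "e * p2 = p2" and he: "h1 * e = h1" "h2 * e = h2"
    by (simp_all add: e_def mat_dim_simps hp mat_prod_rewrite[OF hp(1)] mat_prod_rewrite[OF hp(2)]
        mat_prod_rewrite[OF hp(3)] mat_prod_rewrite[OF hp(4)])
  have fp: "f * p1 = 0\<^sub>m n (d y)" "f * p2 = 0\<^sub>m n (d y)"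
    and hf: "h1 * f = 0\<^sub>m (d y) n" "h2 * f = 0\<^sub>m (d y) n" and ff: "f * f = f"
    by (simp_all add: f_def mat_dim_simps ep he ee)
  have f\<psi>: "f * \<psi> g = \<psi> g * f" if "g \<in> G" for g
    using that by (simp add: f_def mat_dim_simps e\<psi>)
  have fTB: "f\<^sup>T * B = B * f" by (simp add: f_def mat_dim_simps eB)
  have hpT: "p1\<^sup>T * h1\<^sup>T = ?e" "p2\<^sup>T * h1\<^sup>T = 0\<^sub>m (d y) (d y)" "p1\<^sup>T * h2\<^sup>T = 0\<^sub>m (d y) (d y)"
      "p2\<^sup>T * h2\<^sup>T = ?e" "f\<^sup>T * h1\<^sup>T = 0\<^sub>m n (d y)" "f\<^sup>T * h2\<^sup>T = 0\<^sub>m n (d y)"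
    by (simp_all add: hp hf flip: mat_transpose_dim(1))
  have BfBe: "B * f + B * e = B"
    by (simp add: f_def mat_dim_simps) (intro eq_matI; simp del: index_mult_mat(1))
  note relations = mat_dim_simps fTB pB Bp fp hf ff hp hpT
    mat_prod_rewrite[OF hp(1)] mat_prod_rewrite[OF hp(2)] mat_prod_rewrite[OF hp(3)]
    mat_prod_rewrite[OF hp(4)] mat_prod_rewrite[OF Bp(1)] mat_prod_rewrite[OF Bp(2)]
    mat_prod_rewrite[OF pB(1)] mat_prod_rewrite[OF pB(2)] mat_prod_rewrite[OF fTB]
    mat_prod_rewrite[OF fp(1)] mat_prod_rewrite[OF fp(2)] mat_prod_rewrite[OF hf(1)]
    mat_prod_rewrite[OF hf(2)] mat_prod_rewrite[OF ff] mat_prod_rewrite[OF hpT(1)]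
    mat_prod_rewrite[OF hpT(2)] mat_prod_rewrite[OF hpT(3)] mat_prod_rewrite[OF hpT(4)]
    mat_prod_rewrite[OF hpT(5)] mat_prod_rewrite[OF hpT(6)]
  \<comment> \<open>The factors \<open>\<i>\<close> on \<open>p1\<close> and \<open>- \<i>\<close>
    on \<open>p2\<close> have product 1, so the pairing of the two copies is preserved, and their
    squares are both -1.\<close>
  define s where "s = f + (\<i> \<cdot>\<^sub>m (p1 * h1) + (- \<i>) \<cdot>\<^sub>m (p2 * h2))"
  \<comment> \<open>\<open>w\<close> is to exchange the copies by \<open>p1 \<mapsto> p2\<close> and
    \<open>p2 \<mapsto> p1 * u\<close>. Preserving both Gram matrices requires
    \<open>c * u = b\<close> and \<open>u\<^sup>T * b = c\<close>; the first equation dictates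
    \<open>u\<close>, and the second follows by transposition.\<close>
  define u where "u = c' * b"
  have uc: "u \<in> carrier_mat (d y) (d y)" by (intro carrier_matI) (simp_all add: u_def)
  note [simp] = carrier_matD[OF uc]
  have cu: "c * u = b" by (simp add: u_def mat_prod_rewrite[OF c'(1)] mat_unit_dim)
  have "(c * u)\<^sup>T = \<delta> \<cdot>\<^sub>m c" by (simp add: cu bT)
  then have "\<delta> \<cdot>\<^sub>m (\<delta> \<cdot>\<^sub>m (u\<^sup>T * b)) = \<delta> \<cdot>\<^sub>m (\<delta> \<cdot>\<^sub>m c)"
    by (simp add: mat_transpose_dim cT mat_smult_dim)
  then have uTb: "u\<^sup>T * b = c" by (simp add: mat_unit_dim B_transpose)
  \<comment> \<open>The ratio of two invariant pairings commutes with the representation: both sides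
    agree after multiplication by the invertible \<open>(R y g)\<^sup>T * c\<close>.\<close>
  have uR: "u * R y g = R y g * u" if g: "g \<in> G" for g
  proof -
    let ?r = "R y g"
    note [simp] = g
    have 1: "(?r\<^sup>T * c) * (?r * c') = ?e"
      using mat_prod_rewrite[OF cinv[OF g], of c'] by (simp add: mat_assoc_dim c')
    have "?r\<^sup>T * c \<in> carrier_mat (d y) (d y)" "?r * c' \<in> carrier_mat (d y) (d y)"
      by (intro carrier_matI; simp)+
    then have L: "(?r * c') * (?r\<^sup>T * c) = ?e"
      using mat_mult_left_right_inverse 1 by blast
    have "(?r\<^sup>T * c) * (u * ?r) = ?r\<^sup>T * ((c * u) * ?r)" by (simp add: mat_assoc_dim)
    then have 2: "(?r\<^sup>T * c) * (u * ?r) = b" by (simp add: cu binv)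
    have "(?r\<^sup>T * c) * (?r * u) = (?r\<^sup>T * (c * ?r)) * u" by (simp add: mat_assoc_dim)
    then have 3: "(?r\<^sup>T * c) * (?r * u) = b" by (simp add: cinv cu)
    have cancel: "M = (?r * c') * ((?r\<^sup>T * c) * M)" if "M \<in> carrier_mat (d y) (d y)" for M
      using mat_assoc_dim[of "?r * c'" "?r\<^sup>T * c" M] L that by (simp add: mat_unit_dim)
    have "u * ?r \<in> carrier_mat (d y) (d y)" "?r * u \<in> carrier_mat (d y) (d y)"
      by (intro carrier_matI; simp)+
    then have "u * ?r = (?r * c') * b" "?r * u = (?r * c') * b"
      using cancel[of "u * ?r"] cancel[of "?r * u"] unfolding 2 3 by blast+
    then show ?thesis by simp
  qed
  define w where "w = f + (p2 * h1 + p1 * (u * h2))"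
  have sd: "s \<in> carrier_mat n n" "w \<in> carrier_mat n n"
    by (intro carrier_matI; simp add: s_def w_def)+
  have s: "s \<in> isometries"
  proof (rule isometriesI)
    have "s\<^sup>T * (B * s) = B * f + B * e"
      unfolding Be by (simp add: s_def relations)
    then show "s\<^sup>T * (B * s) = B" by (simp add: BfBe)
    fix g assume g: "g \<in> G"
    then show "s * \<psi> g = \<psi> g * s"
      by (simp add: s_def mat_dim_simps f\<psi> h\<psi> mat_prod_rewrite[OF intertwinerD(5)[OF p1 g]]
          mat_prod_rewrite[OF intertwinerD(5)[OF p2 g]])
  qed (rule sd)
  have w: "w \<in> isometries"
  proof (rule isometriesI)
    have "w\<^sup>T * (B * w) = B * f + B * e"
      unfolding Be by (simp add: w_def relations mat_prod_rewrite[OF cu] mat_prod_rewrite[OF uTb])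
    then show "w\<^sup>T * (B * w) = B" by (simp add: BfBe)
    fix g assume g: "g \<in> G"
    then show "w * \<psi> g = \<psi> g * w"
      by (simp add: w_def mat_dim_simps f\<psi> h\<psi> mat_prod_rewrite[OF intertwinerD(5)[OF p1 g]]
          mat_prod_rewrite[OF intertwinerD(5)[OF p2 g]] mat_prod_rewrite[OF uR[OF g]])
  qed (rule sd)
  \<comment> \<open>\<open>w\<close> exchanges the eigenspaces of \<open>s\<close> for
    \<open>\<i>\<close> and \<open>- \<i>\<close>, so the two factors multiply to 1.\<close>
  have sws: "s * (w * s) = w"
    by (simp add: s_def w_def relations)
  have "s * s = f + ((-1) \<cdot>\<^sub>m (p1 * h1) + (-1) \<cdot>\<^sub>m (p2 * h2))"
    by (simp add: s_def relations)
  also have "\<dots> = 1\<^sub>m n - e - e"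
    unfolding f_def e_def by (intro eq_matI) (simp_all del: index_mult_mat(1))
  finally have ss: "s * s = 1\<^sub>m n - e - e" .
  show thesis
    by (rule that[OF hc hp _ s w sws]) (use e ss in \<open>simp_all add: e_def\<close>)
qed

end


text \<open>The reflection is described by a copy \<open>p\<close> and coordinates \<open>h\<close>
  on it instead of an adapted basis; \<open>minus_on_one_copyI\<close> below translates.
  \<open>\<epsilon>_square\<close> serves the hyperbolic planes, which contribute two equal
  factors.\<close>

locale invariant_form_character = invariant_form n B B' \<delta> G \<psi> Irr d R
  for n B B' \<delta> and G :: "'g set" and \<psi> and Irr :: "'x set" and d R +
  fixes \<chi> :: "complex mat \<Rightarrow> complex" and \<epsilon> :: "'x \<Rightarrow> complex"
  assumes \<chi>_mult: "s \<in> isometries \<Longrightarrow> t \<in> isometries \<Longrightarrow> \<chi> (s * t) = \<chi> s * \<chi> t"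
    and \<chi>_nonzero: "s \<in> isometries \<Longrightarrow> \<chi> s \<noteq> 0"
    and \<chi>_reflection: "intertwiner y p \<Longrightarrow> h \<in> carrier_mat (d y) n \<Longrightarrow> h * p = 1\<^sub>m (d y) \<Longrightarrow>
      (\<And>g. g \<in> G \<Longrightarrow> h * \<psi> g = R y g * h) \<Longrightarrow> 1\<^sub>m n - p * h - p * h \<in> isometries \<Longrightarrow>
      \<chi> (1\<^sub>m n - p * h - p * h) = \<epsilon> y"
    and \<epsilon>_square: "y \<in> Irr \<Longrightarrow> \<epsilon> y * \<epsilon> y = 1"
begin

lemma \<chi>_one: "\<chi> (1\<^sub>m n) = 1"
  using \<chi>_mult[OF one_isometry one_isometry] \<chi>_nonzero[OF one_isometry] by (simp add: mat_unit_dim)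

text \<open>In the commutative target, \<open>s * (w * s) = w\<close> reads
  \<open>\<chi> s * \<chi> s * \<chi> w = \<chi> w\<close>.\<close>

lemma \<chi>_square_of_inverted:
  assumes s: "s \<in> isometries" and w: "w \<in> isometries" and sws: "s * (w * s) = w"
  shows "\<chi> (s * s) = 1"
proof -
  have "\<chi> s * (\<chi> w * \<chi> s) = \<chi> w"
    using \<chi>_mult[OF s mult_isometry[OF w s]] \<chi>_mult[OF w s] sws by simp
  then have "(\<chi> s * \<chi> s) * \<chi> w = 1 * \<chi> w" by (simp add: mult_ac)
  then show ?thesis using \<chi>_nonzero[OF w] \<chi>_mult[OF s s] by simp
qed

text \<open>For a projection \<open>f\<close>, \<open>1 - f + z * f\<close> is \<open>z\<close> on
  the image and the identity on the kernel. Enlarging \<open>f - e\<close> to \<open>f\<close>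
  multiplies it by the reflection \<open>1 - e - e\<close> if \<open>z\<close> is -1 on the image of
  \<open>e\<close>, and leaves it unchanged if \<open>z\<close> is 1 there.\<close>

lemma split_off_summand:
  assumes c: "f \<in> carrier_mat n n" "z \<in> carrier_mat n n" and e: "self_adjoint_idem e" "f * e = e"
    and ze: "z * e = \<sigma> \<cdot>\<^sub>m e" and \<sigma>: "\<sigma> = 1 \<or> \<sigma> = -1"
    and M: "1\<^sub>m n - (f - e) + z * (f - e) \<in> isometries"
  shows "1\<^sub>m n - f + z * f \<in> isometries"
    and "\<chi> (1\<^sub>m n - f + z * f) = \<chi> (1\<^sub>m n - (f - e) + z * (f - e)) *
           (if \<sigma> = -1 then \<chi> (1\<^sub>m n - e - e) else 1)"
proof -
  have ec: "e \<in> carrier_mat n n" and ee: "e * e = e" using e by (auto simp: self_adjoint_idem_def)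
  note [simp] = carrier_matD[OF c(1)] carrier_matD[OF c(2)] carrier_matD[OF ec]
  let ?M = "1\<^sub>m n - (f - e) + z * (f - e)"
  have "1\<^sub>m n - f + z * f \<in> isometries \<and> \<chi> (1\<^sub>m n - f + z * f) = \<chi> ?M *
           (if \<sigma> = -1 then \<chi> (1\<^sub>m n - e - e) else 1)"
  proof (cases "\<sigma> = -1")
    case True
    have "z * (f - e) = z * f + e"
      by (simp add: mat_dim_simps ze True) (intro eq_matI; simp del: index_mult_mat(1))
    moreover have "?M * e = e"
      by (simp add: mat_dim_simps ze e(2) ee)
    ultimately have "?M * (1\<^sub>m n - e - e) = 1\<^sub>m n - (f - e) + (z * f + e) - e - e"
      by (simp add: mat_minus_distrib_dim mat_unit_dim)
    also have "\<dots> = 1\<^sub>m n - f + z * f"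
      by (intro eq_matI) (simp_all del: index_mult_mat(1))
    finally have "1\<^sub>m n - f + z * f = ?M * (1\<^sub>m n - e - e)" ..
    then show ?thesis
      using True mult_isometry[OF M reflection_isometry[OF e(1)]]
        \<chi>_mult[OF M reflection_isometry[OF e(1)]] by simp
  next
    case False
    then have "\<sigma> = 1" using \<sigma> by simp
    have "?M = 1\<^sub>m n - f + z * f"
      by (simp add: mat_dim_simps ze \<open>\<sigma> = 1\<close>) (intro eq_matI; simp del: index_mult_mat(1))
    then show ?thesis using M False by simp
  qed
  then show "1\<^sub>m n - f + z * f \<in> isometries"
    "\<chi> (1\<^sub>m n - f + z * f) = \<chi> ?M * (if \<sigma> = -1 then \<chi> (1\<^sub>m n - e - e) else 1)"
    by blast+
qed

text \<open>If \<open>p i\<close> were orthogonal to all \<open>p j\<close>, the spanning condition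
  would give \<open>(p i)\<^sup>T * B * f = 0\<close>. Self-adjointness moves \<open>f\<close> onto
  \<open>p i\<close>, where it is the identity, so \<open>p i\<close> would lie in the radical of
  \<open>B\<close>.\<close>

lemma exists_pairing:
  assumes f: "decomposes f I p q x" and i: "i \<in> I"
  shows "\<exists>j\<in>I. (p i)\<^sup>T * (B * p j) \<noteq> 0\<^sub>m (d (x i)) (d (x j))"
proof (rule ccontr)
  assume contr: "\<not> ?thesis"
  have fc: "f \<in> carrier_mat n n" and fB: "f\<^sup>T * B = B * f" using f by (auto simp: decomposes_def)
  have p: "intertwiner (x j) (p j)" "q j \<in> carrier_mat (d (x j)) n"
      "q j * p j = 1\<^sub>m (d (x j))" "f * p j = p j" if "j \<in> I" for j
    using f that by (auto simp: decomposes_def)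
  note [simp] = carrier_matD[OF fc] intertwinerD(1,3,4)[OF p(1)] carrier_matD[OF p(2)] i
  let ?A = "(p i)\<^sup>T * B"
  have "?A * p j = 0\<^sub>m (d (x i)) (d (x j))" if "j \<in> I" for j
    using contr that by (simp add: mat_assoc_dim)
  moreover have "?A \<in> carrier_mat (d (x i)) n" by (intro carrier_matI) simp_all
  ultimately have "?A * f = 0\<^sub>m (d (x i)) n"
    using f unfolding decomposes_def by blast
  then have "(f * p i)\<^sup>T * B = 0\<^sub>m (d (x i)) n"
    by (simp add: mat_transpose_dim mat_assoc_dim fB)
  then have "(p i)\<^sup>T * B = 0\<^sub>m (d (x i)) n" by (simp add: p)
  then have "((p i)\<^sup>T * B)\<^sup>T = 0\<^sub>m n (d (x i))" by simp
  then have "\<delta> \<cdot>\<^sub>m (\<delta> \<cdot>\<^sub>m (B * p i)) = \<delta> \<cdot>\<^sub>m 0\<^sub>m n (d (x i))"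
    by (simp add: mat_transpose_dim B_transpose mat_smult_dim)
  then have "B * p i = 0\<^sub>m n (d (x i))" by (simp add: mat_unit_dim B_transpose)
  then have "p i = 0\<^sub>m n (d (x i))"
    by (intro B_cancel[where m = "d (x i)" and M = "p i" and N = "0\<^sub>m n (d (x i))"]) (simp_all add: mat_unit_dim intertwinerD(2)[OF p(1)])
  then have "1\<^sub>m (d (x i)) = (0\<^sub>m (d (x i)) (d (x i)) :: complex mat)"
    using p(3)[OF i] by (simp add: mat_unit_dim)
  then have "(1\<^sub>m (d (x i)) :: complex mat) $$ (0, 0) = 0\<^sub>m (d (x i)) (d (x i)) $$ (0, 0)" by (rule arg_cong)
  then show False using d_pos[of "x i"] by simp
qed

text \<open>The element \<open>z\<close> acts on every copy of \<open>y\<close> by the sign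
  \<open>\<sigma> y\<close>. One summand or two are removed at a time, hence the strong induction on
  \<open>card I\<close>; a removed pair has equal labels, so its two factors multiply to 1.\<close>

lemma character_value:
  assumes "decomposes f I p q x" and z: "z \<in> carrier_mat n n"
    and zr: "\<And>y r. intertwiner y r \<Longrightarrow> z * r = \<sigma> y \<cdot>\<^sub>m r"
    and \<sigma>: "\<And>y. y \<in> Irr \<Longrightarrow> \<sigma> y = 1 \<or> \<sigma> y = -1"
  shows "1\<^sub>m n - f + z * f \<in> isometries \<and>
    \<chi> (1\<^sub>m n - f + z * f) = (\<Prod>i\<in>I. if \<sigma> (x i) = -1 then \<epsilon> (x i) else 1)"
  using assms(1)
proof (induction "card I" arbitrary: f I p rule: less_induct)
  case less
  note f = less(2)
  have fin: "finite I" and fc: "f \<in> carrier_mat n n" and fB: "f\<^sup>T * B = B * f"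
    using f by (auto simp: decomposes_def)
  have p: "intertwiner (x j) (p j)" "q j \<in> carrier_mat (d (x j)) n"
      "q j * p j = 1\<^sub>m (d (x j))" "f * p j = p j" if "j \<in> I" for j
    using f that by (auto simp: decomposes_def)
  have qp: "q i * p j = 0\<^sub>m (d (x i)) (d (x j))" if "i \<in> I" "j \<in> I" "i \<noteq> j" for i j
    using f that by (auto simp: decomposes_def)
  note [simp] = carrier_matD[OF fc] intertwinerD(1,3,4)[OF p(1)] carrier_matD[OF p(2)] carrier_matD[OF z]
  let ?g = "\<lambda>i. if \<sigma> (x i) = -1 then \<epsilon> (x i) else 1"
  show ?case
  proof (cases "\<exists>k\<in>I. (p k)\<^sup>T * (B * p k) \<noteq> 0\<^sub>m (d (x k)) (d (x k))")
    case True
    then obtain k where k: "k \<in> I" "(p k)\<^sup>T * (B * p k) \<noteq> 0\<^sub>m (d (x k)) (d (x k))" by blast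
    obtain h where h: "h \<in> carrier_mat (d (x k)) n" "h * p k = 1\<^sub>m (d (x k))"
      "\<And>g. g \<in> G \<Longrightarrow> h * \<psi> g = R (x k) g * h" "self_adjoint_idem (p k * h)"
      using anisotropic_summand[OF p(1)[OF k(1)] k(2)] by blast
    note [simp] = carrier_matD[OF h(1)] k(1)
    let ?e = "p k * h"
    have fe: "f * ?e = ?e" by (simp add: mat_prod_rewrite[OF p(4)[OF k(1)]])
    have dec: "decomposes (f - ?e) (I - {k}) (\<lambda>i. p i - ?e * p i) q x"
    proof (rule decomposes_diff[OF f h(4) fe])
      show "?e * p j = p j" if "j \<in> {k}" for j using that by (simp add: mat_assoc_dim h(2) mat_unit_dim)
      show "q i * ?e = 0\<^sub>m (d (x i)) n" if "i \<in> I - {k}" for i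
        using that by (simp add: mat_prod_rewrite[OF qp] mat_unit_dim)
    qed simp
    have IH: "1\<^sub>m n - (f - ?e) + z * (f - ?e) \<in> isometries"
      "\<chi> (1\<^sub>m n - (f - ?e) + z * (f - ?e)) = (\<Prod>i\<in>I - {k}. ?g i)"
      using less(1)[OF card_Diff1_less[OF fin k(1)] dec] by simp_all
    have ze: "z * ?e = \<sigma> (x k) \<cdot>\<^sub>m ?e"
      by (simp add: mat_prod_rewrite[OF zr[OF p(1)[OF k(1)]]] mat_smult_dim)
    have "\<chi> (1\<^sub>m n - ?e - ?e) = \<epsilon> (x k)"
      by (rule \<chi>_reflection[OF p(1)[OF k(1)] h(1-3) reflection_isometry[OF h(4)]])
    moreover have "(\<Prod>i\<in>I. ?g i) = ?g k * (\<Prod>i\<in>I - {k}. ?g i)"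
      using fin k(1) by (rule prod.remove)
    ultimately show ?thesis
      using split_off_summand[OF fc z h(4) fe ze \<sigma> IH(1)] IH(2) by simp
  next
    case isotropic: False
    show ?thesis
    proof (cases "I = {}")
      case True
      \<comment> \<open>With no summands, the spanning condition applies to the identity matrix and
        gives \<open>f = 0\<close>.\<close>
      then have "1\<^sub>m n * f = 0\<^sub>m n n"
        using f one_carrier_mat[of n] unfolding decomposes_def by blast
      then have "f = 0\<^sub>m n n" by (simp add: mat_unit_dim)
      then show ?thesis using True by (simp add: mat_unit_dim one_isometry \<chi>_one)
    next
      case False
      then obtain i where i: "i \<in> I" by blast
      then obtain j where j: "j \<in> I" "(p i)\<^sup>T * (B * p j) \<noteq> 0\<^sub>m (d (x i)) (d (x j))"
        using exists_pairing[OF f] by blast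
      then have ij: "i \<noteq> j" using isotropic i by auto
      note [simp] = i j(1)
      have "(p i)\<^sup>T * (B * p j) \<in> carrier_mat (d (x i)) (d (x j))" by (intro carrier_matI) simp_all
      then have xij: "x i = x j"
        using schur[OF _ _ _ gram_invariant[OF p(1)[OF i] p(1)[OF j(1)]] j(2)] by simp
      have dim_xi[simp]: "dim_row (p i) = n" "dim_col (p i) = d (x j)" by (simp_all add: xij)
      obtain h1 h2 s w where h: "h1 \<in> carrier_mat (d (x j)) n" "h2 \<in> carrier_mat (d (x j)) n"
        "h1 * p i = 1\<^sub>m (d (x j))" "h1 * p j = 0\<^sub>m (d (x j)) (d (x j))"
        "h2 * p i = 0\<^sub>m (d (x j)) (d (x j))" "h2 * p j = 1\<^sub>m (d (x j))"
        and idem: "self_adjoint_idem (p i * h1 + p j * h2)"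
        and sw: "s \<in> isometries" "w \<in> isometries" "s * (w * s) = w"
        "s * s = 1\<^sub>m n - (p i * h1 + p j * h2) - (p i * h1 + p j * h2)"
        using hyperbolic_summand[of "x j" "p i" "p j"] p(1)[OF i] p(1)[OF j(1)] isotropic i j
        unfolding xij by (metis (no_types, lifting) xij)
      note [simp] = carrier_matD[OF h(1)] carrier_matD[OF h(2)]
      define e where "e = p i * h1 + p j * h2"
      have ec: "e \<in> carrier_mat n n" and e: "self_adjoint_idem e"
        using idem by (auto simp: e_def self_adjoint_idem_def)
      note [simp] = carrier_matD[OF ec]
      have fe: "f * e = e"
        by (simp add: e_def mat_dim_simps mat_prod_rewrite[OF p(4)[OF i]] mat_prod_rewrite[OF p(4)[OF j(1)]])
      have dec: "decomposes (f - e) (I - {i, j}) (\<lambda>i. p i - e * p i) q x"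
      proof (rule decomposes_diff[OF f e fe])
        show "e * p k = p k" if "k \<in> {i, j}" for k
          using that by (auto simp: e_def mat_dim_simps h)
        fix k assume k: "k \<in> I - {i, j}"
        then have "q k * p i = 0\<^sub>m (d (x k)) (d (x j))" "q k * p j = 0\<^sub>m (d (x k)) (d (x j))"
          using qp[of k i] qp[of k j] by (auto simp: xij)
        note this[THEN mat_prod_rewrite]
        then show "q k * e = 0\<^sub>m (d (x k)) n"
          using k by (simp add: e_def mat_dim_simps)
      qed simp
      have "card (I - {i, j}) < card I"
        by (rule psubset_card_mono[OF fin]) (use i in blast)
      from less(1)[OF this dec]
      have IH: "1\<^sub>m n - (f - e) + z * (f - e) \<in> isometries"
        "\<chi> (1\<^sub>m n - (f - e) + z * (f - e)) = (\<Prod>i\<in>I - {i, j}. ?g i)"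
        by simp_all
      have ze: "z * e = \<sigma> (x j) \<cdot>\<^sub>m e"
        using mat_prod_rewrite[OF zr[OF p(1)[OF i]], of h1]
        by (simp add: e_def mat_dim_simps mat_prod_rewrite[OF zr[OF p(1)[OF j(1)]]] xij)
          (rule add_smult_distrib_left_mat[symmetric, of _ n n]; intro carrier_matI; simp)
      have "\<chi> (1\<^sub>m n - e - e) = 1"
        using \<chi>_square_of_inverted[OF sw(1-3)] sw(4) by (simp add: e_def)
      moreover have "(\<Prod>i\<in>I. ?g i) = ?g i * (?g j * (\<Prod>i\<in>I - {i} - {j}. ?g i))"
        using fin i j(1) ij by (subst prod.remove[of I i], simp, simp, subst prod.remove[of "I - {i}" j]) auto
      moreover have "I - {i} - {j} = I - {i, j}" by blast
      moreover have "?g i * ?g j = 1" using xij \<epsilon>_square[of "x j"] by simp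
      ultimately show ?thesis
        using split_off_summand[OF fc z e fe ze \<sigma> IH(1)] IH(2) by (simp add: mult.assoc[symmetric])
    qed
  qed
qed

end

section \<open>Invariant forms on \<open>\<rho> \<otimes> [a] \<otimes> [b]\<close>\<close>

lemma kron_dim[simp]: "dim_row (kron A B) = dim_row A * dim_row B" "dim_col (kron A B) = dim_col A * dim_col B"
  by (simp_all add: kron_def)

lemma kron_index:
  "i < dim_row A * dim_row B \<Longrightarrow> j < dim_col A * dim_col B \<Longrightarrow>
   kron A B $$ (i, j) = A $$ (i div dim_row B, j div dim_col B) * B $$ (i mod dim_row B, j mod dim_col B)"
  by (simp add: kron_def)

lemma div_mod_less_mult:
  fixes i a b :: nat
  assumes "i < a * b" shows "i div b < a" "i mod b < b"
proof -
  have "b > 0" using assms by (cases b) auto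
  then show "i div b < a" "i mod b < b" using assms by (auto simp: less_mult_imp_div_less)
qed

lemma sum_div_mod:
  fixes f :: "nat \<Rightarrow> nat \<Rightarrow> complex"
  shows "(\<Sum>k\<in>{0..<m * s}. f (k div s) (k mod s)) = (\<Sum>i\<in>{0..<m}. \<Sum>j\<in>{0..<s}. f i j)"
proof -
  have "(\<Sum>k\<in>{0..<m * s}. f (k div s) (k mod s)) = (\<Sum>i<m. \<Sum>k\<in>{i * s..<i * s + s}. f (k div s) (k mod s))"
    using sum.nat_group[of "\<lambda>k. f (k div s) (k mod s)" s m] by (simp add: lessThan_atLeast0)
  also have "\<dots> = (\<Sum>i<m. \<Sum>j\<in>{0..<s}. f i j)"
  proof (rule sum.cong[OF refl])
    fix i
    have "(\<Sum>k\<in>{i * s..<i * s + s}. f (k div s) (k mod s)) = (\<Sum>k\<in>{0 + i * s..<s + i * s}. f (k div s) (k mod s))"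
      by (simp add: add.commute)
    also have "\<dots> = (\<Sum>j\<in>{0..<s}. f ((j + i * s) div s) ((j + i * s) mod s))"
      by (rule sum.shift_bounds_nat_ivl)
    finally show "(\<Sum>k\<in>{i * s..<i * s + s}. f (k div s) (k mod s)) = (\<Sum>j\<in>{0..<s}. f i j)"
      by simp
  qed
  finally show ?thesis by (simp add: lessThan_atLeast0)
qed

lemma kron_mult:
  assumes "dim_col A = dim_row C" "dim_col B = dim_row D"
  shows "kron A B * kron C D = kron (A * C) (B * D)"
proof (rule eq_matI)
  fix i j assume "i < dim_row (kron (A * C) (B * D))" "j < dim_col (kron (A * C) (B * D))"
  then have ij: "i < dim_row A * dim_row B" "j < dim_col C * dim_col D" by simp_all
  note ij' = div_mod_less_mult[OF ij(1)] div_mod_less_mult[OF ij(2)]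
  have "(kron A B * kron C D) $$ (i, j) = (\<Sum>k\<in>{0..<dim_row C * dim_row D}. kron A B $$ (i, k) * kron C D $$ (k, j))"
    using ij assms by (auto simp: scalar_prod_def intro!: sum.cong)
  also have "\<dots> = (\<Sum>k\<in>{0..<dim_row C * dim_row D}.
      (\<lambda>r s. A $$ (i div dim_row B, r) * B $$ (i mod dim_row B, s) *
        (C $$ (r, j div dim_col D) * D $$ (s, j mod dim_col D))) (k div dim_row D) (k mod dim_row D))"
    by (rule sum.cong[OF refl]) (use ij assms in \<open>simp add: kron_index\<close>)
  also have "\<dots> = (\<Sum>r\<in>{0..<dim_row C}. \<Sum>s\<in>{0..<dim_row D}.
      (A $$ (i div dim_row B, r) * C $$ (r, j div dim_col D)) *
      (B $$ (i mod dim_row B, s) * D $$ (s, j mod dim_col D)))"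
    by (subst sum_div_mod) (simp add: mult_ac)
  also have "\<dots> = (A * C) $$ (i div dim_row B, j div dim_col D) * (B * D) $$ (i mod dim_row B, j mod dim_col D)"
    using ij' assms by (simp add: scalar_prod_def sum_product)
  also have "\<dots> = kron (A * C) (B * D) $$ (i, j)"
    using ij by (simp add: kron_index)
  finally show "(kron A B * kron C D) $$ (i, j) = kron (A * C) (B * D) $$ (i, j)" .
qed simp_all

lemma kron_transpose: "(kron A B)\<^sup>T = kron A\<^sup>T B\<^sup>T"
  by (rule eq_matI) (auto simp: kron_index div_mod_less_mult)

lemma kron_one: "kron (1\<^sub>m a) (1\<^sub>m b) = 1\<^sub>m (a * b)"
proof (rule eq_matI)
  fix i j assume "i < dim_row (1\<^sub>m (a * b) :: complex mat)" "j < dim_col (1\<^sub>m (a * b) :: complex mat)"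
  then have ij: "i < a * b" "j < a * b" by simp_all
  have "i div b = j div b \<and> i mod b = j mod b \<longleftrightarrow> i = j" by (metis div_mult_mod_eq)
  then show "kron (1\<^sub>m a) (1\<^sub>m b) $$ (i, j) = 1\<^sub>m (a * b) $$ (i, j)"
    using ij div_mod_less_mult[OF ij(1)] div_mod_less_mult[OF ij(2)] by (auto simp: kron_index)
qed simp_all

lemma kron_smult: "kron (c \<cdot>\<^sub>m A) B = c \<cdot>\<^sub>m kron A B" "kron A (c \<cdot>\<^sub>m B) = c \<cdot>\<^sub>m kron A B"
  by (rule eq_matI; auto simp: kron_index div_mod_less_mult)+

lemma kron_zero: "kron A (0\<^sub>m b b') = 0\<^sub>m (dim_row A * b) (dim_col A * b')"
  "kron (0\<^sub>m a a') B = 0\<^sub>m (a * dim_row B) (a' * dim_col B)"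
  by (rule eq_matI; auto simp: kron_index div_mod_less_mult)+

lemma block_index_less:
  fixes r i m s :: nat
  assumes "r < m" "i < s" shows "r * s + i < m * s"
proof -
  have "r * s + i < (r + 1) * s" using assms by simp
  also have "\<dots> \<le> m * s" using assms by (intro mult_le_mono1) simp
  finally show ?thesis .
qed

lemma kron_block:
  assumes "r < dim_row A" "r' < dim_col A" "i < dim_row B" "j < dim_col B"
  shows "kron A B $$ (r * dim_row B + i, r' * dim_col B + j) = A $$ (r, r') * B $$ (i, j)"
  using assms block_index_less[OF assms(1,3)] block_index_less[OF assms(2,4)] by (simp add: kron_index)

lemma kron_right_cancel:
  assumes "kron A J = kron B J" "dim_row A = dim_row B" "dim_col A = dim_col B"
    and "J \<noteq> 0\<^sub>m (dim_row J) (dim_col J)"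
  shows "A = B"
proof (rule eq_matI)
  obtain i j where ij: "i < dim_row J" "j < dim_col J" "J $$ (i, j) \<noteq> 0"
    using assms(4) by (metis eq_matI index_zero_mat)
  fix r r' assume r: "r < dim_row B" "r' < dim_col B"
  have "A $$ (r, r') * J $$ (i, j) = B $$ (r, r') * J $$ (i, j)"
    using kron_block[of r A r' i J j] kron_block[of r B r' i J j] assms ij r by simp
  then show "A $$ (r, r') = B $$ (r, r')" using ij by simp
qed (use assms in auto)

text \<open>Cut \<open>\<beta>\<close> into blocks of size \<open>s\<close> by \<open>s'\<close>.
  Each block is a pairing invariant under \<open>S\<close> and \<open>S'\<close>, hence a multiple
  of \<open>J\<close>, and the multiples are the entries of \<open>\<gamma>\<close>.\<close>

lemma invariant_form_kron:
  fixes S S' :: "'h \<Rightarrow> complex mat"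
  assumes \<beta>: "\<beta> \<in> carrier_mat (m * s) (m' * s')" and J: "J \<in> carrier_mat s s'"
    and S: "\<And>h. h \<in> H \<Longrightarrow> S h \<in> carrier_mat s s" "\<And>h. h \<in> H \<Longrightarrow> S' h \<in> carrier_mat s' s'"
    and inv: "\<And>h. h \<in> H \<Longrightarrow> (kron (1\<^sub>m m) (S h))\<^sup>T * (\<beta> * kron (1\<^sub>m m') (S' h)) = \<beta>"
    and uniq: "\<And>c. c \<in> carrier_mat s s' \<Longrightarrow> (\<And>h. h \<in> H \<Longrightarrow> (S h)\<^sup>T * (c * S' h) = c) \<Longrightarrow>
      \<exists>\<kappa>. c = \<kappa> \<cdot>\<^sub>m J"
  shows "\<exists>\<gamma> \<in> carrier_mat m m'. \<beta> = kron \<gamma> J"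
proof -
  \<comment> \<open>\<open>E t l r\<close> includes the \<open>r\<close>-th summand of
    \<open>t\<close> copies of an \<open>l\<close>-dimensional space, and intertwines
    \<open>Y\<close> with \<open>kron (1\<^sub>m t) Y\<close>.\<close>
  define E where "E t l r = mat (t * l) l (\<lambda>(K, i). if K = r * l + i then 1 else 0 :: complex)" for t l r
  have Ed[simp]: "dim_row (E t l r) = t * l" "dim_col (E t l r) = l" for t l r by (simp_all add: E_def)
  have E: "kron (1\<^sub>m t) Y * E t l r = E t l r * Y" if Y: "Y \<in> carrier_mat l l" and r: "r < t" for t l r Y
  proof (rule eq_matI)
    fix K i assume "K < dim_row (E t l r * Y)" "i < dim_col (E t l r * Y)"
    then have K: "K < t * l" and i: "i < l" using Y by simp_all
    note K' = div_mod_less_mult[OF K]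
    have ri: "r * l + i < t * l" using block_index_less[OF r i] .
    have "(kron (1\<^sub>m t) Y * E t l r) $$ (K, i) = kron (1\<^sub>m t) Y $$ (K, r * l + i)"
      using K i Y ri by (simp add: scalar_prod_def E_def if_distrib[of "\<lambda>x. _ * x"] sum.delta cong: if_cong)
    also have "\<dots> = (if K div l = r then Y $$ (K mod l, i) else 0)"
      using K i Y ri K' r by (simp add: kron_index)
    also have "\<dots> = (\<Sum>j\<in>{0..<l}. if K = r * l + j then Y $$ (j, i) else 0)"
    proof (cases "K div l = r")
      case True
      then have eq: "K = r * l + j \<longleftrightarrow> j = K mod l" if "j < l" for j
        using div_mult_mod_eq[of K l] that True[symmetric] by (metis add_left_cancel)
      have "(\<Sum>j\<in>{0..<l}. if K = r * l + j then Y $$ (j, i) else 0) =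
          (\<Sum>j\<in>{0..<l}. if j = K mod l then Y $$ (j, i) else 0)"
        by (rule sum.cong) (simp_all add: eq)
      then show ?thesis using K' True by simp
    next
      case False
      then have "K \<noteq> r * l + j" if "j < l" for j using that by auto
      then show ?thesis using False by (simp add: sum.neutral)
    qed
    also have "\<dots> = (E t l r * Y) $$ (K, i)"
      using K i Y by (simp add: scalar_prod_def E_def if_distrib[of "\<lambda>x. x * _"] cong: if_cong)
    finally show "(kron (1\<^sub>m t) Y * E t l r) $$ (K, i) = (E t l r * Y) $$ (K, i)" .
  qed (use Y in auto)
  \<comment> \<open>This is the block of \<open>\<beta>\<close> in block row \<open>r\<close> and
    block column \<open>r'\<close>.\<close>
  define c where "c r r' = (E m s r)\<^sup>T * (\<beta> * E m' s' r')" for r r'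
  note [simp] = carrier_matD[OF \<beta>] carrier_matD[OF S(1)] carrier_matD[OF S(2)] carrier_matD[OF J]
  have c_dim: "c r r' \<in> carrier_mat s s'" for r r' by (intro carrier_matI) (simp_all add: c_def)
  have "\<exists>\<kappa>. c r r' = \<kappa> \<cdot>\<^sub>m J" if r: "r < m" "r' < m'" for r r'
  proof (rule uniq[OF c_dim])
    fix h assume h: "h \<in> H"
    have "(S h)\<^sup>T * (c r r' * S' h) = (E m s r * S h)\<^sup>T * (\<beta> * (E m' s' r' * S' h))"
      using h by (simp add: c_def mat_dim_simps)
    also have "\<dots> = (E m s r)\<^sup>T * (((kron (1\<^sub>m m) (S h))\<^sup>T * (\<beta> * kron (1\<^sub>m m') (S' h))) * E m' s' r')"
      using h by (simp add: mat_transpose_dim mat_assoc_dim flip: E[OF S(1) r(1)] E[OF S(2) r(2)])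
    also have "\<dots> = c r r'" using h by (simp only: inv) (simp add: c_def)
    finally show "(S h)\<^sup>T * (c r r' * S' h) = c r r'" .
  qed
  then obtain \<kappa> where \<kappa>: "\<And>r r'. r < m \<Longrightarrow> r' < m' \<Longrightarrow> c r r' = \<kappa> r r' \<cdot>\<^sub>m J" by metis
  have c_entry: "c r r' $$ (i, j) = \<beta> $$ (r * s + i, r' * s' + j)"
    if r: "r < m" "r' < m'" and ij: "i < s" "j < s'" for r r' i j
  proof -
    note b = block_index_less[OF r(1) ij(1)] block_index_less[OF r(2) ij(2)]
    have "(\<beta> * E m' s' r') $$ (K, j) = \<beta> $$ (K, r' * s' + j)" if "K < m * s" for K
      using that ij b by (simp add: scalar_prod_def E_def if_distrib[of "\<lambda>x. _ * x"] cong: if_cong)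
    then have "c r r' $$ (i, j) = (\<Sum>K\<in>{0..<m * s}. (if K = r * s + i then 1 else 0) * \<beta> $$ (K, r' * s' + j))"
      unfolding c_def using ij b
      by (subst index_mult_mat) (auto simp: scalar_prod_def E_def simp del: index_mult_mat(1) intro!: sum.cong)
    also have "\<dots> = \<beta> $$ (r * s + i, r' * s' + j)"
      using b by (simp add: if_distrib[of "\<lambda>x. x * _"] cong: if_cong)
    finally show ?thesis .
  qed
  define \<gamma> where "\<gamma> = mat m m' (\<lambda>(r, r'). \<kappa> r r')"
  have "\<beta> = kron \<gamma> J"
  proof (rule eq_matI)
    fix I I' assume "I < dim_row (kron \<gamma> J)" "I' < dim_col (kron \<gamma> J)"
    then have I: "I < m * s" "I' < m' * s'" by (simp_all add: \<gamma>_def)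
    note I' = div_mod_less_mult[OF I(1)] div_mod_less_mult[OF I(2)]
    have "\<beta> $$ (I, I') = c (I div s) (I' div s') $$ (I mod s, I' mod s')"
      using c_entry[OF I'(1,3,2,4)] by simp
    then show "\<beta> $$ (I, I') = kron \<gamma> J $$ (I, I')"
      using I I' by (simp add: \<kappa> kron_index \<gamma>_def)
  qed (simp_all add: \<gamma>_def)
  moreover have "\<gamma> \<in> carrier_mat m m'" by (simp add: \<gamma>_def)
  ultimately show ?thesis by blast
qed

section \<open>The representations [c] of SL(2) and their invariant pairings\<close>

lemma sym_rep_dim[simp]: "dim_row (sym_rep c A) = c" "dim_col (sym_rep c A) = c"
  by (simp_all add: sym_rep_def)

lemma sym_rep_diag:
  assumes "A $$ (0, 0) = s" "A $$ (1, 1) = t" "A $$ (0, 1) = 0" "A $$ (1, 0) = 0"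
  shows "sym_rep c A = mat c c (\<lambda>(k, i). if k = i then s ^ i * t ^ (c - 1 - i) else 0)"
proof (rule eq_matI)
  fix k i assume "k < dim_row (mat c c (\<lambda>(k, i). if k = i then s ^ i * t ^ (c - 1 - i) else 0))"
    "i < dim_col (mat c c (\<lambda>(k, i). if k = i then s ^ i * t ^ (c - 1 - i) else 0))"
  then have ki: "k < c" "i < c" by simp_all
  have "[:0, s:] ^ i = Polynomial.monom (s ^ i) i"
    using Polynomial.monom_power[of s 1 i] by (simp add: Polynomial.monom_Suc monom_0)
  then have "[:0, s:] ^ i * [:t:] ^ m = Polynomial.monom (s ^ i * t ^ m) i" for m
    by (simp add: Polynomial.poly_const_pow Polynomial.smult_monom mult.commute)
  then show "sym_rep c A $$ (k, i) =
      mat c c (\<lambda>(k, i). if k = i then s ^ i * t ^ (c - 1 - i) else 0) $$ (k, i)"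
    using ki assms by (simp add: sym_rep_def)
qed simp_all

lemma sym_rep_one: "sym_rep c (1\<^sub>m 2) = 1\<^sub>m c"
  by (subst sym_rep_diag[where s = 1 and t = 1]) (auto simp: one_mat_def)

lemma sym_rep_minus_one:
  assumes "c \<ge> 1" shows "sym_rep c (- 1\<^sub>m 2) = (-1) ^ (c - 1) \<cdot>\<^sub>m 1\<^sub>m c"
  by (subst sym_rep_diag[where s = "-1" and t = "-1"])
     (use assms in \<open>auto simp flip: power_add\<close>)

text \<open>As 2 is not a root of unity, this one element separates the weights.\<close>

definition sl2_torus :: "complex mat" where
  "sl2_torus = mat 2 2 (\<lambda>(i, j). if i = j then (if i = 0 then 2 else 1 / 2) else 0)"

text \<open>It acts by X \<mapsto> X + Y and Y \<mapsto> Y, so that its matrices on binary forms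
  consist of binomial coefficients. Together with the torus element it determines the invariant
  pairings.\<close>

definition sl2_unipotent :: "complex mat" where
  "sl2_unipotent = mat 2 2 (\<lambda>(i, j). if i = 0 \<and> j = 1 then 0 else 1)"

lemma sym_rep_torus:
  "sym_rep c sl2_torus = mat c c (\<lambda>(k, i). if k = i then 2 ^ i * (1 / 2) ^ (c - 1 - i) else 0)"
  by (rule sym_rep_diag) (simp_all add: sl2_torus_def)

lemma sym_rep_unipotent: "sym_rep c sl2_unipotent = mat c c (\<lambda>(k, i). of_nat (i choose k))"
proof -
  have "poly.coeff ([:1, 1:] ^ j) i = (of_nat (j choose i) :: complex)" for i j
    by (cases "i \<le> j") (simp_all add: Polynomial.coeff_linear_poly_power coeff_eq_0 degree_power_eq)
  then show ?thesis
    by (intro eq_matI) (simp_all add: sym_rep_def sl2_unipotent_def Polynomial.poly_const_pow)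
qed

lemma sl2_elements:
  "1\<^sub>m 2 \<in> carrier SL2" "- 1\<^sub>m 2 \<in> carrier SL2" "sl2_torus \<in> carrier SL2" "sl2_unipotent \<in> carrier SL2"
proof -
  show "1\<^sub>m 2 \<in> carrier SL2" by (simp add: SL2_def)
  have "det (-1 \<cdot>\<^sub>m 1\<^sub>m 2 :: complex mat) = 1" by (subst det_smult) simp
  moreover have "-1 \<cdot>\<^sub>m 1\<^sub>m 2 = (- 1\<^sub>m 2 :: complex mat)" by (rule eq_matI) auto
  ultimately show "- 1\<^sub>m 2 \<in> carrier SL2" by (simp add: SL2_def)
  have "det sl2_torus = 1"
    by (subst det_lower_triangular[of 2]) (auto simp: sl2_torus_def diag_mat_def numeral_2_eq_2)
  then show "sl2_torus \<in> carrier SL2" by (simp add: SL2_def sl2_torus_def)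
  have "det sl2_unipotent = 1"
    by (subst det_lower_triangular[of 2]) (auto simp: sl2_unipotent_def diag_mat_def numeral_2_eq_2)
  then show "sl2_unipotent \<in> carrier SL2" by (simp add: SL2_def sl2_unipotent_def)
qed

text \<open>The classical invariant pairing on binary forms of degree \<open>a - 1\<close>. Its
  nonzero entries are the solution with initial value 1 of the recursion
  \<open>i * c (i - 1) + (a - i) * c i = 0\<close> along the antidiagonal.\<close>

definition sl2_form :: "nat \<Rightarrow> complex mat" where
  "sl2_form a = mat a a (\<lambda>(i, j). if i + j = a - 1 then (-1) ^ i / of_nat ((a - 1) choose i) else 0)"

lemma sl2_form_carrier: "sl2_form a \<in> carrier_mat a a"
  by (simp add: sl2_form_def)

lemma sl2_form_invertible:
  "\<exists>J' \<in> carrier_mat a a. J' * sl2_form a = 1\<^sub>m a \<and> sl2_form a * J' = 1\<^sub>m a"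
proof -
  define J' :: "complex mat" where
    "J' = mat a a (\<lambda>(i, j). if i + j = a - 1 then (-1) ^ j * of_nat ((a - 1) choose j) else 0)"
  have J': "J' \<in> carrier_mat a a" by (simp add: J'_def)
  have "J' * sl2_form a = 1\<^sub>m a"
  proof (rule eq_matI)
    fix i l assume "i < dim_row (1\<^sub>m a :: complex mat)" "l < dim_col (1\<^sub>m a :: complex mat)"
    then have il: "i < a" "l < a" by simp_all
    have "(J' * sl2_form a) $$ (i, l) = (\<Sum>j\<in>{0..<a}. J' $$ (i, j) * sl2_form a $$ (j, l))"
      using il J' sl2_form_carrier by (auto simp: scalar_prod_def sl2_form_def intro!: sum.cong)
    \<comment> \<open>Only \<open>j = a - 1 - i\<close> contributes; there both factors carry the
      sign \<open>(-1) ^ j\<close>, and the binomial coefficients cancel.\<close>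
    also have "\<dots> = (\<Sum>j\<in>{0..<a}. if j = a - 1 - i then (if i = l then 1 else 0) else 0)"
    proof (rule sum.cong[OF refl])
      fix j assume "j \<in> {0..<a}"
      then have "j < a" by simp
      moreover from this have "((a - 1) choose j) \<noteq> 0" by (simp add: binomial_eq_0_iff)
      ultimately show "J' $$ (i, j) * sl2_form a $$ (j, l) = (if j = a - 1 - i then (if i = l then 1 else 0) else 0)"
        using il by (auto simp: J'_def sl2_form_def simp flip: power_add)
    qed
    also have "\<dots> = 1\<^sub>m a $$ (i, l)" using il by simp
    finally show "(J' * sl2_form a) $$ (i, l) = 1\<^sub>m a $$ (i, l)" .
  qed (use J' sl2_form_carrier[of a] in auto)
  then show ?thesis
    using mat_mult_left_right_inverse[OF J' sl2_form_carrier] J' by blast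
qed

text \<open>The torus leaves only the entries with \<open>i + j = N\<close>, where \<open>2 * N + 2 = a + a'\<close>, and the unipotent
  element yields the recursion \<open>i * c (i - 1) + (N + 1 - i) * c i = 0\<close> along this antidiagonal.\<close>

lemma sl2_form_unique:
  assumes c: "c \<in> carrier_mat a a'" and a: "a \<ge> 1" "a' \<ge> 1"
    and tor: "(sym_rep a sl2_torus)\<^sup>T * (c * sym_rep a' sl2_torus) = c"
    and uni: "(sym_rep a sl2_unipotent)\<^sup>T * (c * sym_rep a' sl2_unipotent) = c"
  shows "\<exists>\<kappa>. c = \<kappa> \<cdot>\<^sub>m (if a = a' then sl2_form a else 0\<^sub>m a a')"
proof -
  have entry: "((sym_rep a A)\<^sup>T * (c * sym_rep a' A)) $$ (i, j) =
      (\<Sum>k\<in>{0..<a}. \<Sum>l\<in>{0..<a'}. sym_rep a A $$ (k, i) * (c $$ (k, l) * sym_rep a' A $$ (l, j)))"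
    if "i < a" "j < a'" for A i j
    using that c by (auto simp: scalar_prod_def sum_distrib_left intro!: sum.cong)
  have cancel: "p * q = 1" if "x = p * (x * q)" "x \<noteq> 0" for x p q :: complex
  proof -
    have "x * (p * q) = p * (x * q)" by (rule mult.left_commute)
    then have "x * (p * q) = x * 1" by (simp only: that(1)[symmetric] mult_1_right)
    then show ?thesis using that(2) by (simp only: mult_cancel_left) simp
  qed
  have cancel_nat: "z = 0" if "of_nat k * z = 0" "k \<noteq> 0" for k and z :: complex
    using that by simp
  \<comment> \<open>The torus scales the entry \<open>(i, j)\<close> by 2 to the power
    \<open>2 * (i + j) + 2 - a - a'\<close>, and a nonzero entry forces the exponent 0.\<close>
  have weight: "2 * (i + j) + 2 = a + a'" if ij: "i < a" "j < a'" and nz: "c $$ (i, j) \<noteq> 0" for i j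
  proof -
    have "c $$ (i, j) = (\<Sum>k\<in>{0..<a}. \<Sum>l\<in>{0..<a'}.
        if k = i then (if l = j then 2 ^ i * (1 / 2) ^ (a - 1 - i) * (c $$ (i, j) * (2 ^ j * (1 / 2) ^ (a' - 1 - j))) else 0) else 0)"
      by (subst tor[symmetric], subst entry[OF ij], intro sum.cong refl)
        (use ij in \<open>auto simp: sym_rep_torus\<close>)
    also have "\<dots> = 2 ^ i * (1 / 2) ^ (a - 1 - i) * (c $$ (i, j) * (2 ^ j * (1 / 2) ^ (a' - 1 - j)))"
    proof -
      have "(\<Sum>k\<in>{0..<a}. \<Sum>l\<in>{0..<a'}. if k = i then (if l = j then x else 0) else 0) =
          (\<Sum>k\<in>{0..<a}. if k = i then x else 0)" for x :: complex
        by (intro sum.cong refl) (use ij in simp)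
      then show ?thesis using ij by simp
    qed
    finally have "(2 :: complex) ^ i * (1 / 2) ^ (a - 1 - i) * (2 ^ j * (1 / 2) ^ (a' - 1 - j)) = 1"
      by (rule cancel) (rule nz)
    then have "(2 :: complex) ^ (i + j) = 2 ^ (a - 1 - i + (a' - 1 - j))"
      by (simp add: power_add power_one_over field_simps)
    \<comment> \<open>Absolute values lead to the ordered field of reals, where powers of 2
      determine the exponent.\<close>
    then have "cmod (2 ^ (i + j)) = cmod (2 ^ (a - 1 - i + (a' - 1 - j)))" by simp
    then have "(2 :: real) ^ (i + j) = 2 ^ (a - 1 - i + (a' - 1 - j))" by (simp only: norm_power norm_numeral)
    then have "i + j = a - 1 - i + (a' - 1 - j)" by (rule power_inject_exp[THEN iffD1, rotated]) simp
    moreover obtain u u' where "a = i + 1 + u" "a' = j + 1 + u'"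
      using ij(1,2) less_iff_Suc_add by (metis Suc_eq_plus1 add.assoc add.commute)
    ultimately show ?thesis by simp
  qed
  show ?thesis
  proof (cases "\<exists>i<a. \<exists>j<a'. c $$ (i, j) \<noteq> 0")
    case False
    then have "c = 0 \<cdot>\<^sub>m (if a = a' then sl2_form a else 0\<^sub>m a a')"
      using c by (intro eq_matI) (auto simp: sl2_form_def split: if_splits)
    then show ?thesis by blast
  next
    case True
    then obtain i0 j0 where ij0: "i0 < a" "j0 < a'" "c $$ (i0, j0) \<noteq> 0" by blast
    define N where "N = i0 + j0"
    have N: "2 * N + 2 = a + a'" using weight[OF ij0] by (simp add: N_def)
    have supp: "c $$ (i, j) = 0" if "i < a" "j < a'" "i + j \<noteq> N" for i j
      using weight[OF that(1,2)] that(3) N by auto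
    \<comment> \<open>For \<open>i + j = N + 1\<close> the entry of \<open>c\<close> itself is 0. In
      the unipotent invariance at \<open>(i, j)\<close> the binomial coefficients vanish beyond
      \<open>i\<close> and \<open>j\<close>, so of the entries with index sum \<open>N\<close> only
      \<open>(i - 1, j)\<close> and \<open>(i, j - 1)\<close> survive, with coefficients
      \<open>i\<close> and \<open>j\<close>.\<close>
    have recursion: "of_nat i * (if i = 0 then 0 else c $$ (i - 1, j)) + of_nat j * (if j = 0 then 0 else c $$ (i, j - 1)) = 0"
      if ij: "i < a" "j < a'" "i + j = N + 1" for i j
    proof -
      have "0 = ((sym_rep a sl2_unipotent)\<^sup>T * (c * sym_rep a' sl2_unipotent)) $$ (i, j)"
        unfolding uni using supp ij by simp
      also have "\<dots> = (\<Sum>k\<in>{0..<a}. \<Sum>l\<in>{0..<a'}. of_nat (i choose k) * (c $$ (k, l) * of_nat (j choose l)))"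
        by (subst entry[OF ij(1,2)], intro sum.cong refl) (use ij in \<open>auto simp: sym_rep_unipotent\<close>)
      also have "\<dots> = (\<Sum>k\<in>{0..<a}. \<Sum>l\<in>{0..<a'}.
          (if k + 1 = i then (if l = j then of_nat i * c $$ (i - 1, j) else 0) else 0) +
          (if k = i then (if l + 1 = j then of_nat j * c $$ (i, j - 1) else 0) else 0))"
      proof (intro sum.cong refl)
        fix k l assume "k \<in> {0..<a}" "l \<in> {0..<a'}"
        then have kl: "k < a" "l < a'" by simp_all
        consider "k > i \<or> l > j" | "k \<le> i" "l \<le> j" "k + l \<noteq> N" | "k + 1 = i" "l = j" | "k = i" "l + 1 = j"
          using ij(3) by linarith
        then show "of_nat (i choose k) * (c $$ (k, l) * of_nat (j choose l)) =
          (if k + 1 = i then (if l = j then of_nat i * c $$ (i - 1, j) else 0) else 0) +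
          (if k = i then (if l + 1 = j then of_nat j * c $$ (i, j - 1) else 0) else 0)"
        proof cases
          case 1
          then show ?thesis using ij by (auto simp: binomial_eq_0)
        next
          case 2
          then show ?thesis using supp[OF kl] ij by auto
        next
          case 3
          then show ?thesis by (auto simp flip: 3(1))
        next
          case 4
          then show ?thesis by (auto simp flip: 4(2))
        qed
      qed
      also have "\<dots> = (\<Sum>k\<in>{0..<a}. if k + 1 = i then of_nat i * c $$ (i - 1, j) else 0) +
          (\<Sum>l\<in>{0..<a'}. if l + 1 = j then of_nat j * c $$ (i, j - 1) else 0)"
      proof -
        have "(\<Sum>k\<in>{0..<a}. \<Sum>l\<in>{0..<a'}. if k + 1 = i then (if l = j then of_nat i * c $$ (i - 1, j) else 0) else 0)
            = (\<Sum>k\<in>{0..<a}. if k + 1 = i then of_nat i * c $$ (i - 1, j) else 0)"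
          by (intro sum.cong refl) (use ij in simp)
        moreover have "(\<Sum>k\<in>{0..<a}. \<Sum>l\<in>{0..<a'}. if k = i then (if l + 1 = j then of_nat j * c $$ (i, j - 1) else 0) else 0)
            = (\<Sum>k\<in>{0..<a}. if k = i then (\<Sum>l\<in>{0..<a'}. if l + 1 = j then of_nat j * c $$ (i, j - 1) else 0) else 0)"
          by (intro sum.cong refl) simp
        ultimately show ?thesis using ij by (simp add: sum.distrib)
      qed
      also have "(\<Sum>k\<in>{0..<a}. if k + 1 = i then of_nat i * c $$ (i - 1, j) else 0) =
          of_nat i * (if i = 0 then 0 else c $$ (i - 1, j))"
        using ij by (cases i) simp_all
      also have "(\<Sum>l\<in>{0..<a'}. if l + 1 = j then of_nat j * c $$ (i, j - 1) else 0) =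
          of_nat j * (if j = 0 then 0 else c $$ (i, j - 1))"
        using ij by (cases j) simp_all
      finally show ?thesis ..
    qed
    define f where "f i = c $$ (i, N - i)" for i
    \<comment> \<open>If the sizes differ, the index \<open>N + 1\<close> is in range on the longer
      side. The recursion there has a single term, so the entry at the end of the antidiagonal
      vanishes, and the vanishing spreads. For equal sizes \<open>N + 1\<close> is out of range and
      that entry stays free.\<close>
    have "a = a'"
    proof (rule ccontr)
      assume "a \<noteq> a'"
      then consider "a < a'" | "a' < a" by linarith
      then show False
      proof cases
        case 1
        then have b: "N + 1 < a'" "a \<le> N" using N by linarith+
        have "f i = 0" if "i < a" for i
          using that
        proof (induction i)
          case 0
          have "of_nat (N + 1) * c $$ (0, N) = 0"
            using recursion[of 0 "N + 1"] 0 b(1) by (simp del: of_nat_add)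
          from cancel_nat[OF this] show ?case by (simp add: f_def)
        next
          case (Suc i)
          have ineq: "Suc i < a" "N - i < a'" "Suc i + (N - i) = N + 1" "N - i \<noteq> 0"
            using Suc.prems b by linarith+
          have "c $$ (i, N - i) = 0" using Suc by (simp add: f_def)
          then have "of_nat (N - i) * c $$ (Suc i, N - Suc i) = 0"
            using recursion[OF ineq(1-3)] ineq(4) by (simp del: of_nat_diff)
          from cancel_nat[OF this ineq(4)] show ?case by (simp add: f_def)
        qed
        moreover have "f i0 = c $$ (i0, j0)" by (simp add: f_def N_def)
        ultimately show False using ij0 by simp
      next
        case 2
        then have b: "N + 1 < a" "a' \<le> N" using N by linarith+
        have "c $$ (N - j, j) = 0" if "j < a'" for j
          using that
        proof (induction j)
          case 0
          have "of_nat (N + 1) * c $$ (N, 0) = 0"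
            using recursion[of "N + 1" 0] 0 b(1) by (simp del: of_nat_add)
          from cancel_nat[OF this] show ?case by simp
        next
          case (Suc j)
          have ineq: "N - j < a" "Suc j < a'" "N - j + Suc j = N + 1" "N - j \<noteq> 0"
            using Suc.prems b by linarith+
          have "c $$ (N - j, j) = 0" using Suc by simp
          then have "of_nat (N - j) * c $$ (N - Suc j, Suc j) = 0"
            using recursion[OF ineq(1-3)] ineq(4) by (simp del: of_nat_diff)
          from cancel_nat[OF this ineq(4)] show ?case by simp
        qed
        from this[OF ij0(2)] show False using ij0(3) by (simp add: N_def)
      qed
    qed
    then have Na: "N = a - 1" using N by simp
    \<comment> \<open>The recursion multiplies \<open>f i\<close> by
      \<open>- (i + 1) / (a - 1 - i)\<close>, the negative of the ratio of consecutive reciprocal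
      binomial coefficients.\<close>
    have f: "f i = f 0 * ((-1) ^ i / of_nat ((a - 1) choose i))" if "i < a" for i
      using that
    proof (induction i)
      case (Suc i)
      let ?C = "of_nat ((a - 1) choose i) :: complex" and ?C' = "of_nat ((a - 1) choose Suc i) :: complex"
        and ?m = "of_nat (a - 1 - i) :: complex" and ?k = "of_nat (Suc i) :: complex"
      have ineq: "Suc i < a" "a - 1 - i < a'" "Suc i + (a - 1 - i) = N + 1" "a - 1 - i \<noteq> 0"
        using Suc.prems \<open>a = a'\<close> Na by linarith+
      have rec: "?k * f i + ?m * f (Suc i) = 0"
        using recursion[OF ineq(1-3)] ineq(4) by (simp add: f_def Na del: of_nat_diff of_nat_Suc)
      have "Suc i * ((a - 1) choose Suc i) = (a - 1 - i) * ((a - 1) choose i)"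
        by (simp only: binomial_absorption binomial_absorb_comp)
      then have CC: "?k * ?C' = ?m * ?C" by (metis of_nat_mult)
      have nz: "?C \<noteq> 0" "?C' \<noteq> 0" "?k \<noteq> 0"
        using Suc.prems by (simp_all add: binomial_eq_0_iff del: of_nat_Suc)
      have IH: "?C * f i = f 0 * (-1) ^ i" using Suc nz by simp
      have "?k * (?C' * f (Suc i)) = ?C * (?m * f (Suc i))"
        using CC by (simp only: mult.assoc[symmetric]) (simp only: mult_ac)
      also have "\<dots> = ?C * (- (?k * f i))" using rec by (simp only: add_eq_0_iff)
      also have "\<dots> = ?k * (- (?C * f i))" by (simp add: mult_ac)
      finally have "?C' * f (Suc i) = - (f 0 * (-1) ^ i)"
        unfolding IH using nz(3) by (simp only: mult_cancel_left) simp
      then show ?case using nz(2) by (simp add: field_simps)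
    qed simp
    have "c = f 0 \<cdot>\<^sub>m sl2_form a"
    proof (rule eq_matI)
      fix i j assume "i < dim_row (f 0 \<cdot>\<^sub>m sl2_form a)" "j < dim_col (f 0 \<cdot>\<^sub>m sl2_form a)"
      then have ij: "i < a" "j < a" by (simp_all add: sl2_form_def)
      show "c $$ (i, j) = (f 0 \<cdot>\<^sub>m sl2_form a) $$ (i, j)"
      proof (cases "i + j = N")
        case True
        then have "j = N - i" by simp
        then have "c $$ (i, j) = f i" by (simp add: f_def)
        then show ?thesis using ij f[OF ij(1)] True by (simp add: sl2_form_def Na)
      next
        case False
        then show ?thesis using ij supp[of i j] \<open>a = a'\<close> by (simp add: sl2_form_def Na)
      qed
    qed (use c \<open>a = a'\<close> in \<open>auto simp: sl2_form_def\<close>)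
    then show ?thesis using \<open>a = a'\<close> by auto
  qed
qed

section \<open>Schur's lemma for invariant pairings\<close>

lemma kernel_subspace:
  fixes A :: "complex mat"
  assumes A: "A \<in> carrier_mat r c"
  shows "subspace class_ring {v \<in> carrier_vec c. A *\<^sub>v v = 0\<^sub>v r} (module_vec TYPE(complex) c)"
  unfolding VectorSpace.subspace_def
proof (intro conjI)
  show "vectorspace (class_ring :: complex ring) (module_vec TYPE(complex) c)" by (rule vec_vs)
  show "submodule class_ring {v \<in> carrier_vec c. A *\<^sub>v v = 0\<^sub>v r} (module_vec TYPE(complex) c)"
    unfolding submodule_def module_vec_simps
    using A by (auto simp: vec_module mult_add_distrib_mat_vec[OF A] mult_mat_vec[OF A])
qed

lemma GL_D:
  assumes "A \<in> carrier (GL n)"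
  shows "A \<in> carrier_mat n n" "\<exists>A' \<in> carrier_mat n n. A * A' = 1\<^sub>m n \<and> A' * A = 1\<^sub>m n"
proof -
  show A: "A \<in> carrier_mat n n" using assms by (simp add: GL_def)
  obtain A' where A': "A * A' = 1\<^sub>m n" "A' * A = 1\<^sub>m (dim_row A')"
    using assms A by (auto simp: GL_def invertible_mat_def inverts_mat_def)
  have "dim_row A' = n" using arg_cong[OF A'(2), of dim_col] carrier_matD[OF A] by simp
  moreover have "dim_col A' = n" using arg_cong[OF A'(1), of dim_col] by simp
  ultimately have "A' \<in> carrier_mat n n" by (rule carrier_matI)
  then show "\<exists>A' \<in> carrier_mat n n. A * A' = 1\<^sub>m n \<and> A' * A = 1\<^sub>m n"
    using A' carrier_matD[OF \<open>A' \<in> carrier_mat n n\<close>] by auto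
qed

text \<open>Invariance gives \<open>\<gamma> * \<rho>' w = s\<^sup>T * \<gamma>\<close> with
  \<open>s\<close> the inverse of \<open>\<rho> w\<close>, so the kernel of \<open>\<gamma>\<close>
  is an invariant subspace; it is not the whole space because \<open>\<gamma>\<close> is
  nonzero.\<close>

lemma kernel_of_invariant_form:
  assumes irr: "irreducible_rep W e \<rho>'" and \<rho>: "\<And>w. w \<in> carrier W \<Longrightarrow> \<rho> w \<in> carrier (GL m)"
    and \<gamma>: "\<gamma> \<in> carrier_mat m e" and inv: "\<And>w. w \<in> carrier W \<Longrightarrow> (\<rho> w)\<^sup>T * (\<gamma> * \<rho>' w) = \<gamma>"
    and nz: "\<gamma> \<noteq> 0\<^sub>m m e" and v: "v \<in> carrier_vec e" "\<gamma> *\<^sub>v v = 0\<^sub>v m"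
  shows "v = 0\<^sub>v e"
proof -
  let ?K = "{v \<in> carrier_vec e. \<gamma> *\<^sub>v v = 0\<^sub>v m}"
  have \<rho>': "\<And>w. w \<in> carrier W \<Longrightarrow> \<rho>' w \<in> carrier_mat e e"
    using irr by (auto simp: irreducible_rep_def mat_rep_def hom_def GL_def)
  have "\<forall>w\<in>carrier W. \<forall>u\<in>?K. \<rho>' w *\<^sub>v u \<in> ?K"
  proof (intro ballI)
    fix w u assume w: "w \<in> carrier W" and u: "u \<in> ?K"
    note r = GL_D(1)[OF \<rho>[OF w]] and r' = \<rho>'[OF w]
    obtain s where s: "s \<in> carrier_mat m m" "\<rho> w * s = 1\<^sub>m m" "s * \<rho> w = 1\<^sub>m m"
      using GL_D(2)[OF \<rho>[OF w]] by blast
    note [simp] = carrier_matD[OF r] carrier_matD[OF r'] carrier_matD[OF s(1)] carrier_matD[OF \<gamma>]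
    have "s\<^sup>T * \<gamma> = s\<^sup>T * ((\<rho> w)\<^sup>T * (\<gamma> * \<rho>' w))" by (simp add: inv w)
    also have "\<dots> = (\<rho> w * s)\<^sup>T * (\<gamma> * \<rho>' w)" by (simp add: mat_transpose_dim mat_assoc_dim)
    finally have g: "\<gamma> * \<rho>' w = s\<^sup>T * \<gamma>" by (simp add: s mat_unit_dim)
    have uc: "u \<in> carrier_vec e" using u by simp
    have "\<gamma> *\<^sub>v (\<rho>' w *\<^sub>v u) = (\<gamma> * \<rho>' w) *\<^sub>v u" using \<gamma> r' uc by (simp add: assoc_mult_mat_vec)
    also have "\<dots> = s\<^sup>T *\<^sub>v (\<gamma> *\<^sub>v u)" unfolding g
      by (rule assoc_mult_mat_vec[of _ m m _ e]) (use s \<gamma> uc in auto)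
    also have "\<dots> = 0\<^sub>v m" using u by (intro eq_vecI) (auto simp: scalar_prod_def)
    finally show "\<rho>' w *\<^sub>v u \<in> ?K" using uc r' by simp
  qed
  then have "?K = {0\<^sub>v e} \<or> ?K = carrier_vec e"
    using irr kernel_subspace[OF \<gamma>] unfolding irreducible_rep_def by blast
  moreover have "?K \<noteq> carrier_vec e"
  proof
    assume K: "?K = carrier_vec e"
    have "\<gamma> = 0\<^sub>m m e"
    proof (rule eq_matI)
      fix i j assume ij: "i < dim_row (0\<^sub>m m e :: complex mat)" "j < dim_col (0\<^sub>m m e :: complex mat)"
      have "unit_vec e j \<in> ?K" unfolding K by simp
      then have "vec_index (\<gamma> *\<^sub>v unit_vec e j) i = 0" using ij by simp
      then show "\<gamma> $$ (i, j) = 0\<^sub>m m e $$ (i, j)" using ij \<gamma> by simp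
    qed (use \<gamma> in auto)
    then show False using nz by simp
  qed
  ultimately show ?thesis using v by blast
qed

text \<open>The transpose is an invariant pairing in the other order. Thus irreducibility of
  \<open>\<rho>'\<close> makes the kernel of \<open>\<gamma>\<close> trivial, and irreducibility of
  \<open>\<rho>\<close> that of its transpose.\<close>

lemma schur_form:
  assumes irr: "irreducible_rep W m \<rho>" "irreducible_rep W e \<rho>'"
    and \<gamma>: "\<gamma> \<in> carrier_mat m e" and inv: "\<And>w. w \<in> carrier W \<Longrightarrow> (\<rho> w)\<^sup>T * (\<gamma> * \<rho>' w) = \<gamma>"
    and nz: "\<gamma> \<noteq> 0\<^sub>m m e"
  shows "m = e \<and> (\<exists>\<gamma>' \<in> carrier_mat e m. \<gamma>' * \<gamma> = 1\<^sub>m e \<and> \<gamma> * \<gamma>' = 1\<^sub>m m)"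
proof (rule invertible_if_trivial_kernels[OF \<gamma>])
  have \<rho>: "\<And>w. w \<in> carrier W \<Longrightarrow> \<rho> w \<in> carrier (GL m)" "\<And>w. w \<in> carrier W \<Longrightarrow> \<rho>' w \<in> carrier (GL e)"
    using irr by (auto simp: irreducible_rep_def mat_rep_def hom_def)
  show "v = 0\<^sub>v e" if "v \<in> carrier_vec e" "\<gamma> *\<^sub>v v = 0\<^sub>v m" for v
    by (rule kernel_of_invariant_form[OF irr(2) \<rho>(1) \<gamma> inv nz that])
  have "(\<rho>' w)\<^sup>T * (\<gamma>\<^sup>T * \<rho> w) = \<gamma>\<^sup>T" if w: "w \<in> carrier W" for w
  proof -
    note [simp] = carrier_matD[OF GL_D(1)[OF \<rho>(1)[OF w]]] carrier_matD[OF GL_D(1)[OF \<rho>(2)[OF w]]] carrier_matD[OF \<gamma>]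
    have "(\<rho>' w)\<^sup>T * (\<gamma>\<^sup>T * \<rho> w) = ((\<rho> w)\<^sup>T * (\<gamma> * \<rho>' w))\<^sup>T" by (simp add: mat_transpose_dim mat_assoc_dim)
    then show ?thesis by (simp only: inv[OF w])
  qed
  moreover have "\<gamma>\<^sup>T \<noteq> 0\<^sub>m e m" using nz by (metis transpose_transpose zero_transpose_mat)
  ultimately show "v = 0\<^sub>v m" if "v \<in> carrier_vec m" "\<gamma>\<^sup>T *\<^sub>v v = 0\<^sub>v e" for v
    using kernel_of_invariant_form[OF irr(1) \<rho>(2) _ _ _ that] \<gamma> by simp
qed

section \<open>Identity and inverses in the Weil group\<close>

lemma poly_map_to_ac:
  "poly (map_poly to_ac p) x = (\<Sum>i\<le>degree p. to_ac (poly.coeff p i) * x ^ i)"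
proof -
  have "degree (map_poly to_ac p) = degree p"
    by (rule degree_map_poly) (metis to_ac_0 to_ac_eq_iff)
  then show ?thesis by (simp add: poly_altdef coeff_map_poly)
qed

lemma Galois_aut_zero: "Galois_aut \<sigma> \<Longrightarrow> \<sigma> 0 = 0"
  by (metis Galois_aut_def add_cancel_right_right)

lemma Galois_aut_sum:
  assumes "Galois_aut \<sigma>"
  shows "\<sigma> (\<Sum>i\<in>I. f i) = (\<Sum>i\<in>I. \<sigma> (f i))"
proof (induction I rule: infinite_finite_induct)
  case (insert i I)
  then show ?case using assms by (simp add: Galois_aut_def)
qed (simp_all add: Galois_aut_zero[OF assms])

lemma Galois_aut_power: "Galois_aut \<sigma> \<Longrightarrow> \<sigma> (x ^ k) = \<sigma> x ^ k"
proof (induction k)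
  case 0
  then show ?case by (metis Galois_aut_def power_0 to_ac_1)
qed (simp add: Galois_aut_def)

lemma Galois_aut_int_closure:
  assumes \<sigma>: "Galois_aut \<sigma>" and x: "x \<in> int_closure v"
  shows "\<sigma> x \<in> int_closure v"
proof -
  obtain p where p: "lead_coeff p = 1" "\<forall>i. poly.coeff p i \<in> val_ring v" "poly (map_poly to_ac p) x = 0"
    using x by (auto simp: int_closure_def)
  have "poly (map_poly to_ac p) (\<sigma> x) = \<sigma> (poly (map_poly to_ac p) x)"
    unfolding poly_map_to_ac Galois_aut_sum[OF \<sigma>]
    using \<sigma> by (simp add: Galois_aut_def flip: Galois_aut_power[OF \<sigma>])
  then have "poly (map_poly to_ac p) (\<sigma> x) = 0" using p(3) Galois_aut_zero[OF \<sigma>] by simp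
  then show ?thesis using p by (auto simp: int_closure_def)
qed

lemma (in nonarch_local_field) val_one: "v 1 = 0"
  using val_mult[of 1 1] by simp

lemma (in nonarch_local_field) val_ring_uminus_power:
  assumes "c \<in> val_ring v"
  shows "(-1) ^ k * c \<in> val_ring v"
proof -
  have "v (-1) = 0" using val_mult[of "-1" "-1"] val_one by simp
  then have "c \<noteq> 0 \<Longrightarrow> v (-c) = v c" using val_mult[of "-1" c] by simp
  then have "-c \<in> val_ring v" using assms by (cases "c = 0") (auto simp: val_ring_def val_ge_def)
  then show ?thesis using assms by (cases "even k") auto
qed

text \<open>The witness is \<open>p\<close> evaluated at the negated variable, normalised by the
  sign \<open>(-1) ^ degree p\<close> that keeps it monic.\<close>

lemma (in nonarch_local_field) int_closure_uminus:
  assumes "x \<in> int_closure v"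
  shows "- x \<in> int_closure v"
proof -
  obtain p where p: "lead_coeff p = 1" "\<forall>i. poly.coeff p i \<in> val_ring v" "poly (map_poly to_ac p) x = 0"
    using assms by (auto simp: int_closure_def)
  define q where "q = smult ((-1) ^ degree p) (pcompose p (Polynomial.monom (-1) (Suc 0)))"
  have coeff_q: "poly.coeff q i = (-1) ^ (degree p + i) * poly.coeff p i" for i
    by (simp add: q_def power_add mult.assoc)
  have deg: "degree q = degree p"
    by (simp add: q_def degree_pcompose Polynomial.degree_monom_eq)
  have "poly (map_poly to_ac q) (- x) = (\<Sum>i\<le>degree p. (-1) ^ degree p * (to_ac (poly.coeff p i) * x ^ i))"
    unfolding poly_map_to_ac deg coeff_q
  proof (rule sum.cong[OF refl])
    fix i
    have "(-1 :: 'f alg_closure) ^ (degree p + i) * (-1) ^ i = (-1) ^ degree p"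
      by (simp add: power_add mult.assoc flip: power_mult_distrib)
    moreover have "to_ac ((-1) ^ (degree p + i) * poly.coeff p i) * (- x) ^ i =
        ((-1) ^ (degree p + i) * to_ac (poly.coeff p i)) * ((-1) ^ i * x ^ i)"
      by (subst power_minus) simp
    moreover have "\<dots> = ((-1) ^ (degree p + i) * (-1) ^ i) * (to_ac (poly.coeff p i) * x ^ i)"
      by (simp only: mult_ac)
    ultimately show "to_ac ((-1) ^ (degree p + i) * poly.coeff p i) * (- x) ^ i =
        (-1) ^ degree p * (to_ac (poly.coeff p i) * x ^ i)"
      by (simp only:)
  qed
  also have "\<dots> = 0" using p(3) by (simp add: poly_map_to_ac flip: sum_distrib_left)
  finally have "poly (map_poly to_ac q) (- x) = 0" .
  moreover have "lead_coeff q = 1" using p(1) by (simp add: deg coeff_q)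
  moreover have "\<forall>i. poly.coeff q i \<in> val_ring v" using p(2) val_ring_uminus_power by (simp add: coeff_q)
  ultimately show ?thesis by (auto simp: int_closure_def)
qed

text \<open>The congruences in \<open>induces_Frob_power\<close> are written as differences in a
  fixed order, and passing to an inverse reverses this order.\<close>

lemma (in nonarch_local_field) int_closure_max_ideal_diff_swap:
  assumes "x - y \<in> int_closure_max_ideal v"
  shows "y - x \<in> int_closure_max_ideal v"
proof -
  have "y - x \<in> int_closure v"
    using assms int_closure_uminus[of "x - y"] by (simp add: int_closure_max_ideal_def)
  moreover have "\<not> (\<exists>t\<in>int_closure v. (y - x) * t = 1)"
  proof
    assume "\<exists>t\<in>int_closure v. (y - x) * t = 1"
    then obtain t where t: "t \<in> int_closure v" "(y - x) * t = 1" by blast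
    have "(x - y) * (- t) = 1" using t(2) by (simp add: algebra_simps)
    then show False using assms int_closure_uminus[OF t(1)] by (auto simp: int_closure_max_ideal_def)
  qed
  ultimately show ?thesis by (simp add: int_closure_max_ideal_def)
qed

lemma (in nonarch_local_field) id_Weil_group: "id \<in> carrier (Weil_group v)"
proof -
  \<comment> \<open>For the exponent 0 the differences are all 0, and 0 lies in the maximal ideal:
    it is integral as a root of the variable, and not a unit.\<close>
  have "poly (map_poly to_ac (Polynomial.monom 1 1)) (0 :: 'f alg_closure) = 0"
    by (simp add: poly_map_to_ac Polynomial.degree_monom_eq)
  moreover have "poly.coeff (Polynomial.monom 1 1) i \<in> val_ring v" for i
    by (simp add: val_ring_def val_ge_def val_one)
  moreover have "lead_coeff (Polynomial.monom 1 1 :: 'f poly) = 1"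
    by (simp add: Polynomial.degree_monom_eq)
  ultimately have "0 \<in> int_closure v" unfolding int_closure_def by blast
  then have "0 \<in> int_closure_max_ideal v" by (simp add: int_closure_max_ideal_def)
  then have "induces_Frob_power v id 0" by (simp add: induces_Frob_power_def)
  then show ?thesis by (auto simp: Weil_group_def Galois_aut_def)
qed

text \<open>\<open>dual_rep\<close> evaluates representations at inverses, which therefore have to
  lie in the group. If \<open>\<sigma>\<close> induces the \<open>m\<close>-th Frobenius power, its
  congruence evaluated at \<open>\<tau> x\<close> is the congruence of exponent \<open>- m\<close>
  for the inverse \<open>\<tau>\<close>, with the two sides exchanged.\<close>

lemma (in nonarch_local_field) Weil_group_inverse:
  assumes "\<sigma> \<in> carrier (Weil_group v)"
  shows "inv\<^bsub>Weil_group v\<^esub> \<sigma> \<in> carrier (Weil_group v)"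
    and "\<sigma> \<circ> inv\<^bsub>Weil_group v\<^esub> \<sigma> = id"
proof -
  obtain m where \<sigma>: "Galois_aut \<sigma>" and m: "induces_Frob_power v \<sigma> m"
    using assms by (auto simp: Weil_group_def)
  have bij: "bij \<sigma>" using \<sigma> by (simp add: Galois_aut_def)
  define \<tau> where "\<tau> = inv_into UNIV \<sigma>"
  have \<sigma>\<tau>: "\<sigma> (\<tau> x) = x" and \<tau>\<sigma>: "\<tau> (\<sigma> x) = x" for x
    using bij by (simp_all add: \<tau>_def bij_is_surj surj_f_inv_f bij_is_inj)
  have \<tau>: "Galois_aut \<tau>"
    unfolding Galois_aut_def
  proof (intro conjI allI)
    show "bij \<tau>" unfolding \<tau>_def using bij by (rule bij_imp_bij_inv)
    have add: "\<sigma> (x + y) = \<sigma> x + \<sigma> y" and mult: "\<sigma> (x * y) = \<sigma> x * \<sigma> y" and const: "\<sigma> (to_ac c) = to_ac c"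
      for x y c using \<sigma> by (auto simp: Galois_aut_def)
    show "\<tau> (x + y) = \<tau> x + \<tau> y" for x y
      using \<tau>\<sigma>[of "\<tau> x + \<tau> y"] by (simp add: add \<sigma>\<tau>)
    show "\<tau> (x * y) = \<tau> x * \<tau> y" for x y
      using \<tau>\<sigma>[of "\<tau> x * \<tau> y"] by (simp add: mult \<sigma>\<tau>)
    show "\<tau> (to_ac c) = to_ac c" for c
      using \<tau>\<sigma>[of "to_ac c"] by (simp add: const)
  qed
  have "induces_Frob_power v \<tau> (- m)"
    unfolding induces_Frob_power_def
  proof
    fix x assume x: "x \<in> int_closure v"
    have "if m \<ge> 0 then x - \<tau> x ^ (residue_card v ^ nat m) \<in> int_closure_max_ideal v
        else x ^ (residue_card v ^ nat (- m)) - \<tau> x \<in> int_closure_max_ideal v"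
      using m Galois_aut_int_closure[OF \<tau> x] unfolding induces_Frob_power_def by (metis \<sigma>\<tau>)
    then show "if - m \<ge> 0 then \<tau> x - x ^ (residue_card v ^ nat (- m)) \<in> int_closure_max_ideal v
        else \<tau> x ^ (residue_card v ^ nat (- (- m))) - x \<in> int_closure_max_ideal v"
      by (cases "m = 0") (auto dest: int_closure_max_ideal_diff_swap split: if_splits)
  qed
  with \<tau> have \<tau>W: "\<tau> \<in> carrier (Weil_group v)" by (auto simp: Weil_group_def)
  have inv: "inv\<^bsub>Weil_group v\<^esub> \<sigma> = \<tau>"
    unfolding m_inv_def
  proof (rule the_equality)
    show "\<tau> \<in> carrier (Weil_group v) \<and> \<sigma> \<otimes>\<^bsub>Weil_group v\<^esub> \<tau> = \<one>\<^bsub>Weil_group v\<^esub> \<and>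
        \<tau> \<otimes>\<^bsub>Weil_group v\<^esub> \<sigma> = \<one>\<^bsub>Weil_group v\<^esub>"
      using \<tau>W by (auto simp: Weil_group_def \<sigma>\<tau> \<tau>\<sigma>)
    fix y assume "y \<in> carrier (Weil_group v) \<and> \<sigma> \<otimes>\<^bsub>Weil_group v\<^esub> y = \<one>\<^bsub>Weil_group v\<^esub> \<and>
        y \<otimes>\<^bsub>Weil_group v\<^esub> \<sigma> = \<one>\<^bsub>Weil_group v\<^esub>"
    then have "\<sigma> \<circ> y = id" by (simp add: Weil_group_def)
    then show "y = \<tau>" by (metis \<tau>\<sigma> comp_apply ext id_apply)
  qed
  then show "inv\<^bsub>Weil_group v\<^esub> \<sigma> \<in> carrier (Weil_group v)" "\<sigma> \<circ> inv\<^bsub>Weil_group v\<^esub> \<sigma> = id"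
    unfolding inv using \<tau>W by (auto simp: \<sigma>\<tau>)
qed

lemma GL_I:
  assumes "A \<in> carrier_mat n n" "A' \<in> carrier_mat n n" "A * A' = 1\<^sub>m n" "A' * A = 1\<^sub>m n"
  shows "A \<in> carrier (GL n)"
  using assms by (auto simp: GL_def invertible_mat_def inverts_mat_def)

text \<open>\<open>hom\<close> speaks only of products; but \<open>\<rho> id\<close> is idempotent
  and invertible, hence the identity matrix.\<close>

lemma (in nonarch_local_field) irreducible_rep_id:
  assumes "irreducible_rep (Weil_group v) m \<rho>"
  shows "\<rho> id = 1\<^sub>m m"
proof -
  have \<rho>: "\<rho> \<in> hom (Weil_group v) (GL m)" using assms by (simp add: irreducible_rep_def mat_rep_def)
  have "\<rho> (id \<circ> id) = \<rho> id * \<rho> id"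
    using hom_mult[OF \<rho> id_Weil_group id_Weil_group] by (simp add: Weil_group_def GL_def)
  then have idem: "\<rho> id * \<rho> id = \<rho> id" by simp
  have g: "\<rho> id \<in> carrier (GL m)" using \<rho> id_Weil_group by (auto simp: hom_def)
  obtain r where r: "r \<in> carrier_mat m m" "r * \<rho> id = 1\<^sub>m m" using GL_D(2)[OF g] by blast
  note [simp] = carrier_matD[OF GL_D(1)[OF g]] carrier_matD[OF r(1)]
  have "r * (\<rho> id * \<rho> id) = \<rho> id"
    by (simp add: mat_prod_rewrite[OF r(2)] mat_unit_dim)
  then show ?thesis by (simp add: idem r(2))
qed

text \<open>\<open>\<gamma>\<close> intertwines \<open>\<rho>'\<close> with the dual of
  \<open>\<rho>\<close>, and the matrix \<open>P\<close> from self-duality intertwines that dual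
  with \<open>\<rho>\<close>, so \<open>P * \<gamma>\<close> is an isomorphism.\<close>

lemma (in nonarch_local_field) equiv_of_invariant_form:
  assumes irr: "irreducible_rep (Weil_group v) m \<rho>" "irreducible_rep (Weil_group v) m \<rho>'"
    and sd: "self_dual (Weil_group v) m \<rho>"
    and \<gamma>: "\<gamma> \<in> carrier (GL m)"
    and inv: "\<And>w. w \<in> carrier (Weil_group v) \<Longrightarrow> (\<rho> w)\<^sup>T * (\<gamma> * \<rho>' w) = \<gamma>"
  shows "rep_equiv (Weil_group v) m \<rho> \<rho>'"
proof -
  obtain P where P: "P \<in> carrier (GL m)"
    "\<And>w. w \<in> carrier (Weil_group v) \<Longrightarrow> \<rho> w * P = P * (\<rho> (inv\<^bsub>Weil_group v\<^esub> w))\<^sup>T"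
    using sd by (auto simp: self_dual_def rep_equiv_def dual_rep_def)
  obtain P' \<gamma>' where P': "P' \<in> carrier_mat m m" "P * P' = 1\<^sub>m m" "P' * P = 1\<^sub>m m"
    and \<gamma>': "\<gamma>' \<in> carrier_mat m m" "\<gamma> * \<gamma>' = 1\<^sub>m m" "\<gamma>' * \<gamma> = 1\<^sub>m m"
    using GL_D(2)[OF P(1)] GL_D(2)[OF \<gamma>] by blast
  have hom: "\<rho> \<in> hom (Weil_group v) (GL m)" "\<rho>' \<in> hom (Weil_group v) (GL m)"
    using irr by (simp_all add: irreducible_rep_def mat_rep_def)
  have car: "\<rho> w \<in> carrier_mat m m" "\<rho>' w \<in> carrier_mat m m" if "w \<in> carrier (Weil_group v)" for w
    using hom that by (auto simp: hom_def GL_def)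
  note [simp] = carrier_matD[OF car(1)] carrier_matD[OF car(2)] carrier_matD[OF P'(1)] carrier_matD[OF \<gamma>'(1)]
    carrier_matD[OF GL_D(1)[OF P(1)]] carrier_matD[OF GL_D(1)[OF \<gamma>]] Weil_group_inverse(1)
  have "P * \<gamma> \<in> carrier (GL m)"
  proof (rule GL_I)
    show "P * \<gamma> \<in> carrier_mat m m" "\<gamma>' * P' \<in> carrier_mat m m" by (intro carrier_matI; simp)+
    show "P * \<gamma> * (\<gamma>' * P') = 1\<^sub>m m" "\<gamma>' * P' * (P * \<gamma>) = 1\<^sub>m m"
      by (simp_all add: mat_assoc_dim mat_prod_rewrite[OF \<gamma>'(2)] mat_prod_rewrite[OF P'(3)] mat_unit_dim P' \<gamma>')
  qed
  moreover have "\<rho> w * (P * \<gamma>) = (P * \<gamma>) * \<rho>' w" if w: "w \<in> carrier (Weil_group v)" for w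
  proof -
    let ?i = "inv\<^bsub>Weil_group v\<^esub> w"
    note [simp] = w
    have one: "\<rho> w * \<rho> ?i = 1\<^sub>m m"
      using hom_mult[OF hom(1) w Weil_group_inverse(1)[OF w]] Weil_group_inverse(2)[OF w] irreducible_rep_id[OF irr(1)]
      by (simp add: Weil_group_def GL_def)
    have "(\<rho> ?i)\<^sup>T * \<gamma> = (\<rho> ?i)\<^sup>T * ((\<rho> w)\<^sup>T * (\<gamma> * \<rho>' w))" by (simp add: inv)
    also have "\<dots> = (\<rho> w * \<rho> ?i)\<^sup>T * (\<gamma> * \<rho>' w)" by (simp add: mat_transpose_dim mat_assoc_dim)
    finally have "(\<rho> ?i)\<^sup>T * \<gamma> = \<gamma> * \<rho>' w" by (simp add: one mat_unit_dim)
    then show ?thesis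
      by (simp add: mat_prod_rewrite[OF P(2)[OF w]] mat_assoc_dim)
  qed
  ultimately show ?thesis
    using car unfolding rep_equiv_def by blast
qed

section \<open>Schur's lemma for \<rho> \<otimes> [a] \<otimes> [b]\<close>

lemma triple_rep_carrier:
  assumes "irreducible_rep (Weil_group v) (rep_dim (Weil_group v) \<rho>) \<rho>" "g \<in> carrier (param_group v)"
  shows "triple_rep (\<rho>, a, b) g \<in> carrier_mat (triple_dim v (\<rho>, a, b)) (triple_dim v (\<rho>, a, b))"
proof -
  obtain w s t where g: "g = (w, s, t)" "w \<in> carrier (Weil_group v)"
    using assms(2) by (cases g) (auto simp: param_group_def)
  have "\<rho> w \<in> carrier_mat (rep_dim (Weil_group v) \<rho>) (rep_dim (Weil_group v) \<rho>)"
    using assms(1) g(2) by (auto simp: irreducible_rep_def mat_rep_def hom_def GL_def)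
  then show ?thesis by (intro carrier_matI) (simp_all add: g triple_rep_def triple_dim_def)
qed

text \<open>The elements \<open>(1, t)\<close> give \<open>c = kron \<gamma> ?Jb\<close>. If
  \<open>?Jb\<close> is zero, so is \<open>c\<close>; otherwise it can be cancelled from the
  invariance under \<open>(s, 1)\<close>, which leaves \<open>\<gamma>\<close> an invariant pairing
  for the first factor.\<close>

lemma sl2_pair_form_unique:
  assumes c: "c \<in> carrier_mat (a * b) (a' * b')" and ge: "a \<ge> 1" "b \<ge> 1" "a' \<ge> 1" "b' \<ge> 1"
    and inv: "\<And>s t. s \<in> carrier SL2 \<Longrightarrow> t \<in> carrier SL2 \<Longrightarrow>
      (kron (sym_rep a s) (sym_rep b t))\<^sup>T * (c * kron (sym_rep a' s) (sym_rep b' t)) = c"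
  shows "\<exists>\<kappa>. c = \<kappa> \<cdot>\<^sub>m kron (if a = a' then sl2_form a else 0\<^sub>m a a') (if b = b' then sl2_form b else 0\<^sub>m b b')"
proof -
  let ?Ja = "if a = a' then sl2_form a else 0\<^sub>m a a'" and ?Jb = "if b = b' then sl2_form b else 0\<^sub>m b b'"
  have J: "?Ja \<in> carrier_mat a a'" "?Jb \<in> carrier_mat b b'" by (simp_all add: sl2_form_carrier)
  have "\<exists>\<gamma> \<in> carrier_mat a a'. c = kron \<gamma> ?Jb"
  proof (rule invariant_form_kron[OF c J(2), where H = "carrier SL2" and S = "sym_rep b" and S' = "sym_rep b'"])
    show "(kron (1\<^sub>m a) (sym_rep b h))\<^sup>T * (c * kron (1\<^sub>m a') (sym_rep b' h)) = c" if "h \<in> carrier SL2" for h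
      using inv[OF sl2_elements(1) that] by (simp add: sym_rep_one)
    show "\<exists>\<kappa>. e = \<kappa> \<cdot>\<^sub>m ?Jb"
      if "e \<in> carrier_mat b b'" "\<And>h. h \<in> carrier SL2 \<Longrightarrow> (sym_rep b h)\<^sup>T * (e * sym_rep b' h) = e" for e
      using sl2_form_unique[OF that(1) ge(2,4)] that(2) sl2_elements(3,4) by blast
  qed (auto intro: carrier_matI)
  then obtain \<gamma> where \<gamma>: "\<gamma> \<in> carrier_mat a a'" "c = kron \<gamma> ?Jb" by blast
  note [simp] = carrier_matD[OF \<gamma>(1)] carrier_matD[OF J(2)] carrier_matD[OF J(1)]
  show ?thesis
  proof (cases "?Jb = 0\<^sub>m b b'")
    case True
    then have "c = 0 \<cdot>\<^sub>m kron ?Ja ?Jb" unfolding \<gamma>(2) True kron_zero by (intro eq_matI) simp_all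
    then show ?thesis by blast
  next
    case False
    have "(sym_rep a s)\<^sup>T * (\<gamma> * sym_rep a' s) = \<gamma>" if s: "s \<in> carrier SL2" for s
    proof (rule kron_right_cancel)
      have "kron ((sym_rep a s)\<^sup>T * (\<gamma> * sym_rep a' s)) ((1\<^sub>m b)\<^sup>T * (?Jb * 1\<^sub>m b')) =
          (kron (sym_rep a s) (1\<^sub>m b))\<^sup>T * (kron \<gamma> ?Jb * kron (sym_rep a' s) (1\<^sub>m b'))"
        by (simp add: kron_mult kron_transpose)
      also have "\<dots> = kron \<gamma> ?Jb"
        using inv[OF s sl2_elements(1)] by (simp only: sym_rep_one \<gamma>(2))
      finally show "kron ((sym_rep a s)\<^sup>T * (\<gamma> * sym_rep a' s)) ?Jb = kron \<gamma> ?Jb"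
        by (simp only: mat_unit_dim transpose_one carrier_matD[OF J(2)] index_mult_mat)
    qed (use False in simp_all)
    then obtain \<kappa> where "\<gamma> = \<kappa> \<cdot>\<^sub>m ?Ja"
      using sl2_form_unique[OF \<gamma>(1) ge(1,3)] sl2_elements(3,4) by blast
    then show ?thesis using \<gamma>(2) by (metis kron_smult(1))
  qed
qed

text \<open>The two SL(2) factors force \<open>\<beta> = kron \<gamma> ?J\<close>, where
  \<open>?J\<close> vanishes unless \<open>a = a'\<close> and \<open>b = b'\<close>. What remains is
  a nonzero pairing \<open>\<gamma>\<close> for the Weil group. It is invertible by
  \<open>schur_form\<close>, and self-duality turns it into an isomorphism, so that the chosen
  representatives coincide.\<close>

lemma (in nonarch_local_field) triple_rep_schur:
  assumes ge: "a \<ge> 1" "b \<ge> 1" "a' \<ge> 1" "b' \<ge> 1"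
    and irr: "irreducible_rep (Weil_group v) (rep_dim (Weil_group v) \<rho>) \<rho>"
      "irreducible_rep (Weil_group v) (rep_dim (Weil_group v) \<rho>') \<rho>'"
    and sd: "self_dual (Weil_group v) (rep_dim (Weil_group v) \<rho>) \<rho>"
    and eq: "rep_equiv (Weil_group v) (rep_dim (Weil_group v) \<rho>) \<rho> \<rho>' \<Longrightarrow> \<rho> = \<rho>'"
    and \<beta>: "\<beta> \<in> carrier_mat (triple_dim v (\<rho>, a, b)) (triple_dim v (\<rho>', a', b'))"
    and inv: "\<And>g. g \<in> carrier (param_group v) \<Longrightarrow>
      (triple_rep (\<rho>, a, b) g)\<^sup>T * (\<beta> * triple_rep (\<rho>', a', b') g) = \<beta>"
    and nz: "\<beta> \<noteq> 0\<^sub>m (triple_dim v (\<rho>, a, b)) (triple_dim v (\<rho>', a', b'))"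
  shows "(\<rho>, a, b) = (\<rho>', a', b') \<and> (\<exists>\<beta>' \<in> carrier_mat (triple_dim v (\<rho>, a, b)) (triple_dim v (\<rho>, a, b)).
    \<beta>' * \<beta> = 1\<^sub>m (triple_dim v (\<rho>, a, b)) \<and> \<beta> * \<beta>' = 1\<^sub>m (triple_dim v (\<rho>, a, b)))"
proof -
  let ?W = "Weil_group v"
  let ?m = "rep_dim ?W \<rho>" and ?e = "rep_dim ?W \<rho>'"
  let ?Ja = "if a = a' then sl2_form a else 0\<^sub>m a a'" and ?Jb = "if b = b' then sl2_form b else 0\<^sub>m b b'"
  let ?J = "kron ?Ja ?Jb"
  have J: "?J \<in> carrier_mat (a * b) (a' * b')"
    by (intro carrier_matI) (simp_all add: carrier_matD[OF sl2_form_carrier])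
  have inv': "(kron (\<rho> w) (kron (sym_rep a s) (sym_rep b t)))\<^sup>T * (\<beta> * kron (\<rho>' w) (kron (sym_rep a' s) (sym_rep b' t))) = \<beta>"
    if "w \<in> carrier ?W" "s \<in> carrier SL2" "t \<in> carrier SL2" for w s t
    using inv[of "(w, s, t)"] that by (simp add: param_group_def triple_rep_def)
  have \<beta>c: "\<beta> \<in> carrier_mat (?m * (a * b)) (?e * (a' * b'))" using \<beta> by (simp add: triple_dim_def)
  have "\<exists>\<gamma> \<in> carrier_mat ?m ?e. \<beta> = kron \<gamma> ?J"
  proof (rule invariant_form_kron[OF \<beta>c J, where H = "carrier SL2 \<times> carrier SL2"
        and S = "\<lambda>(s, t). kron (sym_rep a s) (sym_rep b t)" and S' = "\<lambda>(s, t). kron (sym_rep a' s) (sym_rep b' t)"])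
    show "(kron (1\<^sub>m ?m) (case h of (s, t) \<Rightarrow> kron (sym_rep a s) (sym_rep b t)))\<^sup>T *
        (\<beta> * kron (1\<^sub>m ?e) (case h of (s, t) \<Rightarrow> kron (sym_rep a' s) (sym_rep b' t))) = \<beta>"
      if "h \<in> carrier SL2 \<times> carrier SL2" for h
      using inv'[OF id_Weil_group, of "fst h" "snd h"] that irreducible_rep_id[OF irr(1)] irreducible_rep_id[OF irr(2)]
      by (auto simp: case_prod_beta)
    show "\<exists>\<kappa>. c = \<kappa> \<cdot>\<^sub>m ?J"
      if c: "c \<in> carrier_mat (a * b) (a' * b')" and c_inv: "\<And>h. h \<in> carrier SL2 \<times> carrier SL2 \<Longrightarrow>
        (case h of (s, t) \<Rightarrow> kron (sym_rep a s) (sym_rep b t))\<^sup>T *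
        (c * (case h of (s, t) \<Rightarrow> kron (sym_rep a' s) (sym_rep b' t))) = c" for c
    proof (rule sl2_pair_form_unique[OF c ge])
      show "(kron (sym_rep a s) (sym_rep b t))\<^sup>T * (c * kron (sym_rep a' s) (sym_rep b' t)) = c"
        if "s \<in> carrier SL2" "t \<in> carrier SL2" for s t
        using that c_inv[of "(s, t)"] by simp
    qed
  qed (auto intro!: carrier_matI)
  then obtain \<gamma> where \<gamma>: "\<gamma> \<in> carrier_mat ?m ?e" "\<beta> = kron \<gamma> ?J" by blast
  have Jnz: "?J \<noteq> 0\<^sub>m (a * b) (a' * b')"
    using nz carrier_matD[OF \<gamma>(1)] unfolding \<gamma>(2) triple_dim_def by (auto simp only: kron_zero prod.case)
  then have ab: "a = a'" "b = b'"
    by (auto simp: kron_zero carrier_matD[OF sl2_form_carrier] split: if_splits)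
  have \<gamma>nz: "\<gamma> \<noteq> 0\<^sub>m ?m ?e"
    using nz unfolding \<gamma>(2) triple_dim_def prod.case by (auto simp only: kron_zero carrier_matD[OF J])
  have car: "\<rho> w \<in> carrier_mat ?m ?m" "\<rho>' w \<in> carrier_mat ?e ?e" if "w \<in> carrier ?W" for w
    using irr that by (auto simp: irreducible_rep_def mat_rep_def hom_def GL_def)
  note [simp] = carrier_matD[OF \<gamma>(1)] carrier_matD[OF J] carrier_matD[OF car(1)] carrier_matD[OF car(2)]
  have inv\<gamma>: "(\<rho> w)\<^sup>T * (\<gamma> * \<rho>' w) = \<gamma>" if w: "w \<in> carrier ?W" for w
  proof (rule kron_right_cancel)
    have "kron ((\<rho> w)\<^sup>T * (\<gamma> * \<rho>' w)) ((1\<^sub>m (a * b))\<^sup>T * (?J * 1\<^sub>m (a' * b'))) =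
        (kron (\<rho> w) (1\<^sub>m (a * b)))\<^sup>T * (kron \<gamma> ?J * kron (\<rho>' w) (1\<^sub>m (a' * b')))"
      using w by (simp add: kron_mult kron_transpose del: kron_dim)
    also have "\<dots> = kron \<gamma> ?J"
      using inv'[OF w sl2_elements(1) sl2_elements(1)] by (simp only: sym_rep_one kron_one \<gamma>(2))
    finally show "kron ((\<rho> w)\<^sup>T * (\<gamma> * \<rho>' w)) ?J = kron \<gamma> ?J"
      by (simp only: mat_unit_dim transpose_one carrier_matD[OF J] index_mult_mat)
    show "?J \<noteq> 0\<^sub>m (dim_row ?J) (dim_col ?J)" unfolding carrier_matD[OF J] by (rule Jnz)
  qed (use w in simp_all)
  from schur_form[OF irr \<gamma>(1) inv\<gamma> \<gamma>nz] obtain \<gamma>' where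
    me: "?m = ?e" and \<gamma>': "\<gamma>' \<in> carrier_mat ?e ?m" "\<gamma>' * \<gamma> = 1\<^sub>m ?e" "\<gamma> * \<gamma>' = 1\<^sub>m ?m" by blast
  have "rep_equiv ?W ?m \<rho> \<rho>'"
  proof (rule equiv_of_invariant_form[OF irr(1) _ sd _ inv\<gamma>])
    show "\<gamma> \<in> carrier (GL ?m)" by (rule GL_I[of _ _ \<gamma>']) (use \<gamma> \<gamma>' me in simp_all)
  qed (use irr me in simp_all)
  then have "\<rho> = \<rho>'" by (rule eq)
  obtain Ja' Jb' where J': "Ja' \<in> carrier_mat a a" "Ja' * sl2_form a = 1\<^sub>m a" "sl2_form a * Ja' = 1\<^sub>m a"
    "Jb' \<in> carrier_mat b b" "Jb' * sl2_form b = 1\<^sub>m b" "sl2_form b * Jb' = 1\<^sub>m b"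
    using sl2_form_invertible by metis
  note [simp] = carrier_matD[OF \<gamma>'(1)] carrier_matD[OF J'(1)] carrier_matD[OF J'(4)] carrier_matD[OF sl2_form_carrier]
  let ?\<beta>' = "kron \<gamma>' (kron Ja' Jb')"
  have \<beta>eq: "\<beta> = kron \<gamma> (kron (sl2_form a) (sl2_form b))" using \<gamma>(2) ab by simp
  have "?\<beta>' * \<beta> = 1\<^sub>m (?m * (a * b))" "\<beta> * ?\<beta>' = 1\<^sub>m (?m * (a * b))"
    unfolding \<beta>eq using me by (simp_all add: kron_mult J' \<gamma>' kron_one)
  moreover have "?\<beta>' \<in> carrier_mat (?m * (a * b)) (?m * (a * b))"
    by (intro carrier_matI) (simp_all add: me)
  ultimately show ?thesis using ab \<open>\<rho> = \<rho>'\<close> by (auto simp: triple_dim_def)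
qed

section \<open>Adapted bases\<close>

definition coord_incl :: "nat \<Rightarrow> nat \<Rightarrow> nat \<Rightarrow> complex mat" where
  "coord_incl n l d = mat n d (\<lambda>(i, j). if i = l + j then 1 else 0)"

lemma coord_incl_dim[simp]: "dim_row (coord_incl n l d) = n" "dim_col (coord_incl n l d) = d"
  by (simp_all add: coord_incl_def)

lemma mult_coord_incl:
  assumes "dim_col M = n" "l + d \<le> n" "i < dim_row M" "j < d"
  shows "(M * coord_incl n l d) $$ (i, j) = M $$ (i, l + j)"
  using assms by (simp add: scalar_prod_def coord_incl_def if_distrib[of "\<lambda>x. _ * x"] cong: if_cong)

lemma coord_incl_mult:
  assumes "dim_row A = d" "l + d \<le> n" "i < n" "j < dim_col A"
  shows "(coord_incl n l d * A) $$ (i, j) = (if l \<le> i \<and> i < l + d then A $$ (i - l, j) else 0)"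
proof -
  have "(coord_incl n l d * A) $$ (i, j) = (\<Sum>m\<in>{0..<d}. if i = l + m then A $$ (m, j) else 0)"
    using assms by (simp add: scalar_prod_def coord_incl_def if_distrib[of "\<lambda>x. x * _"] cong: if_cong)
  also have "\<dots> = (\<Sum>m\<in>{0..<d}. if m = i - l then (if l \<le> i then A $$ (m, j) else 0) else 0)"
    by (rule sum.cong) auto
  finally show ?thesis by auto
qed

lemma transpose_coord_incl_mult:
  assumes "dim_row M = n" "l + d \<le> n" "i < d" "j < dim_col M"
  shows "((coord_incl n l d)\<^sup>T * M) $$ (i, j) = M $$ (l + i, j)"
proof -
  have "((coord_incl n l d)\<^sup>T * M) = (M\<^sup>T * coord_incl n l d)\<^sup>T"
    using assms by (simp add: mat_transpose_dim)
  then show ?thesis using assms mult_coord_incl[of "M\<^sup>T" n l d j i] by simp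
qed

text \<open>\<open>P\<close> continues \<open>p\<close> and its inverse \<open>Q\<close> continues
  \<open>h\<close>, so the remaining columns of \<open>P\<close> span the kernel of
  \<open>h\<close>.\<close>

lemma adapted_basis:
  assumes p: "p \<in> carrier_mat n d" and h: "h \<in> carrier_mat d n" "h * p = 1\<^sub>m d"
  obtains P Q where "d \<le> n" "P \<in> carrier_mat n n" "Q \<in> carrier_mat n n" "Q * P = 1\<^sub>m n" "P * Q = 1\<^sub>m n"
    "Q * p = coord_incl n 0 d" "h * P = (coord_incl n 0 d)\<^sup>T"
proof -
  obtain P Q where dn: "d \<le> n" and P: "P \<in> carrier_mat n n" "Q \<in> carrier_mat n n" "Q * P = 1\<^sub>m n"
    and cols: "\<forall>i<n. \<forall>j<d. P $$ (i, j) = p $$ (i, j)" and rows: "\<forall>i<d. \<forall>j<n. Q $$ (i, j) = h $$ (i, j)"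
    using extend_to_invertible[OF p h] by blast
  note [simp] = carrier_matD[OF p] carrier_matD[OF h(1)] carrier_matD[OF P(1)] carrier_matD[OF P(2)]
  have PQ: "P * Q = 1\<^sub>m n" by (rule mat_mult_left_right_inverse[OF P(2,1,3)])
  have "p = P * coord_incl n 0 d"
    by (rule eq_matI) (use dn cols in \<open>simp_all add: mult_coord_incl del: index_mult_mat(1)\<close>)
  then have "Q * p = (Q * P) * coord_incl n 0 d" by (simp add: mat_assoc_dim)
  moreover have "h = (coord_incl n 0 d)\<^sup>T * Q"
    by (rule eq_matI) (use dn rows in \<open>simp_all add: transpose_coord_incl_mult del: index_mult_mat(1)\<close>)
  then have "h * P = (coord_incl n 0 d)\<^sup>T * (Q * P)" by (simp add: mat_assoc_dim)
  ultimately show thesis using that[OF dn P PQ] P(3) by (simp add: mat_unit_dim)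
qed

text \<open>The kernel of \<open>h\<close> is an invariant complement of the copy. In the basis
  \<open>P\<close>, the matrix \<open>p * h\<close> is the projection to the first coordinates, and
  the two intertwining relations say that \<open>\<psi> g\<close> has \<open>triple_rep x g\<close>
  as first block and zero off-diagonal blocks.\<close>

lemma minus_on_one_copyI:
  assumes p: "p \<in> carrier_mat n (triple_dim v x)" and h: "h \<in> carrier_mat (triple_dim v x) n"
    and hp: "h * p = 1\<^sub>m (triple_dim v x)"
    and \<psi>: "\<And>g. g \<in> carrier (param_group v) \<Longrightarrow> \<psi> g \<in> carrier_mat n n"
    and R: "\<And>g. g \<in> carrier (param_group v) \<Longrightarrow> triple_rep x g \<in> carrier_mat (triple_dim v x) (triple_dim v x)"
    and p\<psi>: "\<And>g. g \<in> carrier (param_group v) \<Longrightarrow> \<psi> g * p = p * triple_rep x g"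
    and h\<psi>: "\<And>g. g \<in> carrier (param_group v) \<Longrightarrow> h * \<psi> g = triple_rep x g * h"
  shows "minus_on_one_copy v n \<psi> x (1\<^sub>m n - p * h - p * h)"
proof -
  let ?d = "triple_dim v x"
  let ?e = "n - ?d"
  let ?I = "coord_incl n 0 ?d"
  obtain P Q where dn: "?d \<le> n" and P: "P \<in> carrier_mat n n" "Q \<in> carrier_mat n n" "Q * P = 1\<^sub>m n" "P * Q = 1\<^sub>m n"
    and Qp: "Q * p = ?I" and hP: "h * P = ?I\<^sup>T"
    using adapted_basis[OF p h hp] by blast
  note [simp] = carrier_matD[OF p] carrier_matD[OF h(1)] carrier_matD[OF P(1)] carrier_matD[OF P(2)]
    carrier_matD[OF \<psi>] carrier_matD[OF R]
  have PI: "P * ?I = p"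
    using mat_prod_rewrite[OF P(4), of p] by (simp add: Qp mat_unit_dim)
  have II: "(?I * ?I\<^sup>T) $$ (i, j) = (if i = j \<and> i < ?d then 1 else 0)" if "i < n" "j < n" for i j
    using that dn by (subst coord_incl_mult) (auto simp: coord_incl_def)
  have "(1\<^sub>m n - p * h - p * h) * P = P * (1\<^sub>m n - ?I * ?I\<^sup>T - ?I * ?I\<^sup>T)"
    by (simp add: mat_minus_distrib_dim mat_unit_dim mat_assoc_dim mat_prod_rewrite[OF PI] hP)
  also have "1\<^sub>m n - ?I * ?I\<^sup>T - ?I * ?I\<^sup>T = four_block_mat (- 1\<^sub>m ?d) (0\<^sub>m ?d ?e) (0\<^sub>m ?e ?d) (1\<^sub>m ?e)"
    by (rule eq_matI) (use dn in \<open>auto simp: II simp del: index_mult_mat(1)\<close>)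
  finally have refl: "(1\<^sub>m n - p * h - p * h) * P = P * four_block_mat (- 1\<^sub>m ?d) (0\<^sub>m ?d ?e) (0\<^sub>m ?e ?d) (1\<^sub>m ?e)" .
  have blocks: "\<exists>D \<in> carrier_mat ?e ?e. \<psi> g * P = P * four_block_mat (triple_rep x g) (0\<^sub>m ?d ?e) (0\<^sub>m ?e ?d) D"
    if g: "g \<in> carrier (param_group v)" for g
  proof -
    let ?M = "Q * (\<psi> g * P)" and ?r = "triple_rep x g"
    define D where "D = mat ?e ?e (\<lambda>(i, j). ?M $$ (?d + i, ?d + j))"
    note [simp] = g
    have MI: "?M * ?I = ?I * ?r"
      by (simp add: mat_assoc_dim PI p\<psi> mat_prod_rewrite[OF Qp])
    have IM: "?I\<^sup>T * ?M = ?r * ?I\<^sup>T"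
      by (simp flip: hP add: mat_assoc_dim mat_prod_rewrite[OF P(4)] mat_unit_dim mat_prod_rewrite[OF h\<psi>])
    have "?M = four_block_mat ?r (0\<^sub>m ?d ?e) (0\<^sub>m ?e ?d) D"
    proof (rule eq_matI)
      fix i j assume "i < dim_row (four_block_mat ?r (0\<^sub>m ?d ?e) (0\<^sub>m ?e ?d) D)"
        "j < dim_col (four_block_mat ?r (0\<^sub>m ?d ?e) (0\<^sub>m ?e ?d) D)"
      then have ij: "i < n" "j < n" using dn by (simp_all add: D_def)
      consider "j < ?d" | "i < ?d" "\<not> j < ?d" | "\<not> i < ?d" "\<not> j < ?d" by blast
      then show "?M $$ (i, j) = four_block_mat ?r (0\<^sub>m ?d ?e) (0\<^sub>m ?e ?d) D $$ (i, j)"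
      proof cases
        case 1
        have "?M $$ (i, j) = (?I * ?r) $$ (i, j)"
          using mult_coord_incl[of ?M n 0 ?d i j] ij dn 1 by (simp add: MI del: index_mult_mat(1))
        then show ?thesis using ij dn 1 by (simp add: coord_incl_mult D_def del: index_mult_mat(1))
      next
        case 2
        have "?M $$ (i, j) = (?r * ?I\<^sup>T) $$ (i, j)"
          using transpose_coord_incl_mult[of ?M n 0 ?d i j] ij dn 2 by (simp add: IM del: index_mult_mat(1))
        also have "\<dots> = (?I * ?r\<^sup>T)\<^sup>T $$ (i, j)" by (simp add: mat_transpose_dim)
        also have "\<dots> = 0" using ij dn 2 by (simp add: coord_incl_mult del: index_mult_mat(1))
        finally show ?thesis using ij dn 2 by (simp add: D_def del: index_mult_mat(1))
      next
        case 3
        then show ?thesis using ij dn by (simp add: D_def del: index_mult_mat(1))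
      qed
    qed (use dn in \<open>simp_all add: D_def\<close>)
    then have "P * four_block_mat ?r (0\<^sub>m ?d ?e) (0\<^sub>m ?e ?d) D = P * ?M" by simp
    also have "\<dots> = \<psi> g * P" by (simp add: mat_prod_rewrite[OF P(4)] mat_unit_dim)
    finally show ?thesis by (intro bexI[of _ D]) (simp_all add: D_def)
  qed
  have "P \<in> carrier (GL n)" by (rule GL_I[OF P(1,2,4,3)])
  then show ?thesis
    unfolding minus_on_one_copy_def Let_def using dn refl blocks by blast
qed

text \<open>Indices are positions in \<open>xs\<close>, so equal triples count as separate blocks.
  The last clause says dually that the blocks span the space, as in
  \<open>decomposes\<close>.\<close>

definition block_inclusions ::
  "'g set \<Rightarrow> ('x \<Rightarrow> 'g \<Rightarrow> complex mat) \<Rightarrow> ('x \<Rightarrow> nat) \<Rightarrow> 'x list \<Rightarrow> nat \<Rightarrow>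
     (nat \<Rightarrow> complex mat) \<Rightarrow> (nat \<Rightarrow> complex mat) \<Rightarrow> bool" where
  "block_inclusions G A D xs N p q \<longleftrightarrow>
    (\<forall>i<length xs. p i \<in> carrier_mat N (D (xs ! i)) \<and> q i \<in> carrier_mat (D (xs ! i)) N \<and>
      q i * p i = 1\<^sub>m (D (xs ! i)) \<and>
      (\<forall>g\<in>G. diag_block_mat (map (\<lambda>y. A y g) xs) * p i = p i * A (xs ! i) g)) \<and>
    (\<forall>i<length xs. \<forall>j<length xs. i \<noteq> j \<longrightarrow> q i * p j = 0\<^sub>m (D (xs ! i)) (D (xs ! j))) \<and>
    (\<forall>m. \<forall>M \<in> carrier_mat m N. (\<forall>i<length xs. M * p i = 0\<^sub>m m (D (xs ! i))) \<longrightarrow> M = 0\<^sub>m m N)"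

lemma exists_block_inclusions:
  assumes "\<And>y g. y \<in> set xs \<Longrightarrow> g \<in> G \<Longrightarrow> A y g \<in> carrier_mat (D y) (D y)"
    and "N = sum_list (map D xs)"
  shows "\<exists>p q. block_inclusions G A D xs N p q"
  using assms
proof (induction xs arbitrary: N)
  case Nil
  then show ?case by (auto simp: block_inclusions_def intro!: eq_matI)
next
  case (Cons x xs)
  define N' where "N' = sum_list (map D xs)"
  have N: "N = D x + N'" using Cons.prems(2) by (simp add: N'_def)
  obtain p q where "block_inclusions G A D xs N' p q"
    using Cons.IH[OF _ N'_def] Cons.prems(1) by auto
  then have pq: "\<And>i. i < length xs \<Longrightarrow> p i \<in> carrier_mat N' (D (xs ! i))"
      "\<And>i. i < length xs \<Longrightarrow> q i \<in> carrier_mat (D (xs ! i)) N'"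
      "\<And>i. i < length xs \<Longrightarrow> q i * p i = 1\<^sub>m (D (xs ! i))"
      "\<And>i g. i < length xs \<Longrightarrow> g \<in> G \<Longrightarrow> diag_block_mat (map (\<lambda>y. A y g) xs) * p i = p i * A (xs ! i) g"
      "\<And>i j. i < length xs \<Longrightarrow> j < length xs \<Longrightarrow> i \<noteq> j \<Longrightarrow> q i * p j = 0\<^sub>m (D (xs ! i)) (D (xs ! j))"
      "\<And>m M. M \<in> carrier_mat m N' \<Longrightarrow> (\<forall>i<length xs. M * p i = 0\<^sub>m m (D (xs ! i))) \<Longrightarrow> M = 0\<^sub>m m N'"
    unfolding block_inclusions_def by blast+
  have Ax: "A x g \<in> carrier_mat (D x) (D x)" if "g \<in> G" for g using Cons.prems(1) that by simp
  have Axs: "A (xs ! i) g \<in> carrier_mat (D (xs ! i)) (D (xs ! i))" if "i < length xs" "g \<in> G" for i g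
    using Cons.prems(1) that by simp
  define E where "E g = diag_block_mat (map (\<lambda>y. A y g) xs)" for g
  have E: "E g \<in> carrier_mat N' N'" if g: "g \<in> G" for g
  proof (rule carrier_matI)
    show "dim_row (E g) = N'" "dim_col (E g) = N'"
      unfolding E_def dim_diag_block_mat N'_def map_map
      using carrier_matD[OF Cons.prems(1)] g by (auto intro!: arg_cong[of _ _ sum_list] map_cong)
  qed
  define F where "F g = four_block_mat (A x g) (0\<^sub>m (D x) N') (0\<^sub>m N' (D x)) (E g)" for g
  have F: "diag_block_mat (map (\<lambda>y. A y g) (x # xs)) = F g" if "g \<in> G" for g
    using carrier_matD[OF Ax[OF that]] carrier_matD[OF E[OF that]] by (simp add: F_def E_def Let_def)
  note [simp] = carrier_matD[OF pq(1)] carrier_matD[OF pq(2)] carrier_matD[OF Ax] carrier_matD[OF E] carrier_matD[OF Axs]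
  have Fd[simp]: "dim_row (F g) = N" "dim_col (F g) = N" if "g \<in> G" for g using that by (simp_all add: F_def N)
  let ?L = "coord_incl N 0 (D x)" and ?R = "coord_incl N (D x) N'"
  have LL: "?L\<^sup>T * ?L = 1\<^sub>m (D x)" and RR: "?R\<^sup>T * ?R = 1\<^sub>m N'"
    and LR: "?L\<^sup>T * ?R = 0\<^sub>m (D x) N'" and RL: "?R\<^sup>T * ?L = 0\<^sub>m N' (D x)"
    by (rule eq_matI; simp add: N mult_coord_incl del: index_mult_mat(1); simp add: coord_incl_def)+
  have FL: "F g * ?L = ?L * A x g" and FR: "F g * ?R = ?R * E g" if g: "g \<in> G" for g
    using g by (intro eq_matI; simp add: N mult_coord_incl coord_incl_mult del: index_mult_mat(1);
      simp add: F_def N)+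
  \<comment> \<open>The new block comes first, and the earlier inclusions move behind it by
    \<open>D x\<close> coordinates.\<close>
  define p' where "p' i = (case i of 0 \<Rightarrow> ?L | Suc i \<Rightarrow> ?R * p i)" for i
  define q' where "q' i = (case i of 0 \<Rightarrow> ?L\<^sup>T | Suc i \<Rightarrow> q i * ?R\<^sup>T)" for i
  have p'_simps: "p' 0 = ?L" "p' (Suc i) = ?R * p i" "q' 0 = ?L\<^sup>T" "q' (Suc i) = q i * ?R\<^sup>T" for i
    by (simp_all add: p'_def q'_def)
  have "p' i \<in> carrier_mat N (D ((x # xs) ! i)) \<and> q' i \<in> carrier_mat (D ((x # xs) ! i)) N \<and>
      q' i * p' i = 1\<^sub>m (D ((x # xs) ! i)) \<and>
      (\<forall>g\<in>G. diag_block_mat (map (\<lambda>y. A y g) (x # xs)) * p' i = p' i * A ((x # xs) ! i) g)"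
    if i: "i < length (x # xs)" for i
  proof (cases i)
    case 0
    have "?L \<in> carrier_mat N (D x)" by (rule carrier_matI) simp_all
    then show ?thesis using 0 F FL by (simp add: p'_simps LL del: diag_block_mat.simps list.map)
  next
    case (Suc i')
    then have i': "i' < length xs" using i by simp
    have "?R * p i' \<in> carrier_mat N (D (xs ! i'))" "q i' * ?R\<^sup>T \<in> carrier_mat (D (xs ! i')) N"
      using i' by (intro carrier_matI; simp)+
    moreover have "q i' * ?R\<^sup>T * (?R * p i') = 1\<^sub>m (D (xs ! i'))"
      using i' by (simp add: mat_assoc_dim mat_prod_rewrite[OF RR] mat_unit_dim pq(3))
    moreover have "F g * (?R * p i') = ?R * p i' * A (xs ! i') g" if g: "g \<in> G" for g
      using g i' pq(4)[OF i' g] by (simp add: mat_assoc_dim mat_prod_rewrite[OF FR[OF g]] flip: E_def)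
    ultimately show ?thesis using Suc F by (simp add: p'_simps del: diag_block_mat.simps list.map)
  qed
  moreover have "q' i * p' j = 0\<^sub>m (D ((x # xs) ! i)) (D ((x # xs) ! j))"
    if "i < length (x # xs)" "j < length (x # xs)" "i \<noteq> j" for i j
    using that by (cases i; cases j) (simp_all add: p'_simps mat_assoc_dim mat_unit_dim RL
        mat_prod_rewrite[OF LR] mat_prod_rewrite[OF RR] pq(5))
  moreover have "M = 0\<^sub>m m N"
    if M: "M \<in> carrier_mat m N" and zero: "\<forall>i<length (x # xs). M * p' i = 0\<^sub>m m (D ((x # xs) ! i))" for m M
  proof -
    note [simp] = carrier_matD[OF M]
    have L: "M * ?L = 0\<^sub>m m (D x)" using zero by (force simp: p'_simps)
    have MR: "M * ?R \<in> carrier_mat m N'" by (rule carrier_matI) simp_all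
    have "M * ?R * p i = 0\<^sub>m m (D (xs ! i))" if "i < length xs" for i
      using zero[rule_format, of "Suc i"] that by (simp add: p'_simps mat_assoc_dim)
    then have R: "M * ?R = 0\<^sub>m m N'" using pq(6)[OF MR] by blast
    show ?thesis
    proof (rule eq_matI)
      fix i j assume ij: "i < dim_row (0\<^sub>m m N :: complex mat)" "j < dim_col (0\<^sub>m m N :: complex mat)"
      show "M $$ (i, j) = 0\<^sub>m m N $$ (i, j)"
      proof (cases "j < D x")
        case True
        then show ?thesis using mult_coord_incl[of M N 0 "D x" i j] L ij
            by (simp add: N del: index_mult_mat(1))
      next
        case False
        then show ?thesis using mult_coord_incl[of M N "D x" N' i "j - D x"] R ij
            by (simp add: N del: index_mult_mat(1))
      qed
    qed simp_all
  qed
  ultimately have "block_inclusions G A D (x # xs) N p' q'"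
    unfolding block_inclusions_def by blast
  then show ?case by blast
qed

section \<open>Counting pairs\<close>

lemma size_filter_as_sum: "size (filter_mset P M) = (\<Sum>x\<in>#M. if P x then 1 else 0)"
  by (induction M) auto

lemma size_Z_set_restrict:
  "size (filter_mset (\<lambda>p. Q (fst p)) (Z_set k J)) = (\<Sum>x\<in>#J. \<Sum>y\<in>#J. if Q x \<and> in_Z_kind k (x, y) then 1 else 0)"
proof -
  have "size (filter_mset (\<lambda>p. Q (fst p)) (filter_mset (in_Z_kind k) (\<Sum>x\<in>#M. image_mset (Pair x) J))) =
      (\<Sum>x\<in>#M. \<Sum>y\<in>#J. if Q x \<and> in_Z_kind k (x, y) then 1 else 0)" for M
    by (induction M) (simp_all add: size_filter_as_sum filter_filter_mset image_mset.compositionality o_def conj_commute)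
  then show ?thesis by (simp add: Z_set_def)
qed

lemma size_Z_at: "size (Z_at k J x) = (\<Sum>y\<in>#J. if in_Z_kind k (x, y) then 1 else 0)"
  by (simp add: Z_at_def size_filter_as_sum)

text \<open>The fibres of \<open>Z_set\<close> over the first members selected by \<open>Q\<close>
  add up in the exponent. All members will give the value at the central element, those with even
  \<open>b\<close> the value at \<open>c2\<close>.\<close>

lemma prod_eps:
  "(\<Prod>x\<in>#J. if Q x then eps k J x else 1) = (-1) ^ size (filter_mset (\<lambda>p. Q (fst p)) (Z_set k J))"
proof -
  have "(\<Prod>x\<in>#M. if Q x then eps k J x else 1) = (-1) ^ (\<Sum>x\<in>#M. if Q x then size (Z_at k J x) else 0)" for M
    by (induction M) (simp_all add: eps_def power_add)
  moreover have "(\<Sum>x\<in>#J. if Q x then size (Z_at k J x) else 0) =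
      (\<Sum>x\<in>#J. \<Sum>y\<in>#J. if Q x \<and> in_Z_kind k (x, y) then 1 else 0)"
    by (intro arg_cong[of _ _ sum_mset] image_mset_cong) (simp add: size_Z_at)
  ultimately show ?thesis by (simp add: size_Z_set_restrict)
qed

lemma prod_eps_all: "(\<Prod>x\<in>#J. eps k J x) = 1"
  using prod_eps[of "\<lambda>_. True" k J] even_size_Z_set[of k J] by simp

text \<open>Exactly one of \<open>b\<close>, \<open>b'\<close> is even for a pair in \<open>\<Z>\<close>, so the pairs with \<open>b\<close> even are half of
  all pairs.\<close>

lemma size_Z_set_even_first: "size (filter_mset (\<lambda>p. even (snd (snd (fst p)))) (Z_set k J)) = size (Z_set k J) div 2"
proof -
  let ?ev = "\<lambda>x. even (snd (snd x))"
  have opp: "?ev x \<longleftrightarrow> \<not> ?ev y" if "in_Z_kind k (x, y)" for x y :: "'a \<times> nat \<times> nat"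
    using that by (cases k; cases x; cases y) (auto simp: in_Z_def max_def min_def split: if_splits)
  have "(\<Sum>x\<in>#J. \<Sum>y\<in>#J. if ?ev x \<and> in_Z_kind k (x, y) then 1 else 0 :: nat) =
      (\<Sum>y\<in>#J. \<Sum>x\<in>#J. if ?ev x \<and> in_Z_kind k (x, y) then 1 else 0)"
    by (rule sum_mset.swap)
  \<comment> \<open>By symmetry the second member of a pair may be read as the first, and its
    \<open>b\<close> is odd exactly when that of the other is even.\<close>
  also have "\<dots> = (\<Sum>y\<in>#J. \<Sum>x\<in>#J. if \<not> ?ev y \<and> in_Z_kind k (y, x) then 1 else 0)"
    by (intro arg_cong[of _ _ sum_mset] image_mset_cong if_cong refl) (use opp in_Z_kind_sym in metis)
  finally have "size (filter_mset (\<lambda>p. ?ev (fst p)) (Z_set k J)) = size (filter_mset (\<lambda>p. \<not> ?ev (fst p)) (Z_set k J))"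
    by (simp only: size_Z_set_restrict[of ?ev] size_Z_set_restrict[of "\<lambda>x. \<not> ?ev x"])
  moreover have "size (Z_set k J) = size (filter_mset (\<lambda>p. ?ev (fst p)) (Z_set k J)) +
      size (filter_mset (\<lambda>p. \<not> ?ev (fst p)) (Z_set k J))"
    by (simp only: size_union[symmetric] multiset_partition[symmetric])
  ultimately show ?thesis by linarith
qed

lemma prod_eps_even: "(\<Prod>x\<in>#J. if even (snd (snd x)) then eps k J x else 1) = z_sign k J"
  using prod_eps[of "\<lambda>x. even (snd (snd x))" k J] size_Z_set_even_first[of k J]
  by (simp add: z_sign_def)

section \<open>The values of the character\<close>

lemma mat_uminus_eq_smult: "- A = (- 1) \<cdot>\<^sub>m (A :: complex mat)"
  by (rule eq_matI) auto

text \<open>Both groups are brought to the shape required by \<open>invariant_form\<close>. For odd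
  \<open>n\<close> this is the full orthogonal group, in which the centralizer is taken, and not
  only \<open>SO_group\<close>.\<close>

lemma exists_invariant_form:
  obtains B B' :: "complex mat" and \<delta> :: complex
  where "B \<in> carrier_mat n n" "B' \<in> carrier_mat n n" "B' * B = 1\<^sub>m n" "B\<^sup>T = \<delta> \<cdot>\<^sub>m B" "\<delta> * \<delta> = 1"
    "\<And>A. A \<in> (if even n then Sp n else O_group n) \<longleftrightarrow> A \<in> carrier_mat n n \<and> A\<^sup>T * (B * A) = B"
proof (cases "even n")
  case True
  define k where "k = n div 2"
  have n: "n = k + k" using True by (auto simp: k_def)
  define \<Omega> :: "complex mat" where "\<Omega> = four_block_mat (0\<^sub>m k k) (1\<^sub>m k) (- 1\<^sub>m k) (0\<^sub>m k k)"
  have \<Omega>: "\<Omega> \<in> carrier_mat n n" by (simp add: \<Omega>_def n)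
  note [simp] = carrier_matD[OF \<Omega>]
  have "\<Omega>\<^sup>T * \<Omega> = 1\<^sub>m n"
    unfolding \<Omega>_def n
    by (subst transpose_four_block_mat[of _ k k _ k _ k], simp_all add: transpose_uminus)
       (subst mult_four_block_mat[of _ k k _ k _ k _ _ k _ k], simp_all add: mat_uminus_eq_smult mat_dim_simps)
  moreover have "\<Omega>\<^sup>T = (- 1) \<cdot>\<^sub>m \<Omega>"
    unfolding \<Omega>_def
    by (subst transpose_four_block_mat[of _ k k _ k _ k], simp_all add: transpose_uminus)
       (subst smult_four_block_mat[of _ k k _ k _ k], simp_all add: mat_uminus_eq_smult mat_dim_simps)
  moreover have "A \<in> Sp n \<longleftrightarrow> A \<in> carrier_mat n n \<and> A\<^sup>T * (\<Omega> * A) = \<Omega>" for A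
    by (auto simp: Sp_def Let_def mat_assoc_dim simp flip: \<Omega>_def k_def)
  ultimately show ?thesis using that[of \<Omega> "\<Omega>\<^sup>T" "-1"] \<Omega> True by simp
next
  case False
  have "A \<in> O_group n \<longleftrightarrow> A \<in> carrier_mat n n \<and> A\<^sup>T * (1\<^sub>m n * A) = 1\<^sub>m n" for A
    by (auto simp: O_group_def)
  then show ?thesis using that[of "1\<^sub>m n" "1\<^sub>m n" 1] False by (simp add: mat_unit_dim)
qed

text \<open>Negating both variables changes binary forms of degree \<open>b - 1\<close> by
  \<open>(-1) ^ (b - 1)\<close>, and the other two tensor factors see an identity element.\<close>

lemma (in nonarch_local_field) triple_rep_c2:
  assumes "irreducible_rep (Weil_group v) (rep_dim (Weil_group v) \<rho>) \<rho>" "b \<ge> 1"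
  shows "triple_rep (\<rho>, a, b) (id, 1\<^sub>m 2, - 1\<^sub>m 2) = (-1) ^ (b - 1) \<cdot>\<^sub>m 1\<^sub>m (triple_dim v (\<rho>, a, b))"
  by (simp add: triple_rep_def triple_dim_def irreducible_rep_id[OF assms(1)] sym_rep_one
      sym_rep_minus_one[OF assms(2)] kron_smult kron_one)

theorem mainTheorem7:
  fixes v :: "'f::field \<Rightarrow> int"
    and n :: nat
    and \<psi> :: "'f param_elt \<Rightarrow> complex mat"
    and J :: "('f Weil_rep \<times> nat \<times> nat) multiset"
    and k :: Z_kind
    and \<chi> :: "complex mat \<Rightarrow> complex"
  assumes "nonarch_local_field v"
    and "parameter v n \<psi>"
    and "is_Jord v n \<psi> J"
    and "is_character_of v n \<psi> J (eps k J) \<chi>"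
  shows "\<chi> (central_z n) = 1 \<and> \<chi> (c2 \<psi>) = of_int (z_sign k J)"
proof -
  interpret nonarch_local_field v by (rule assms(1))
  let ?G = "carrier (param_group v)" and ?W = "Weil_group v"
  let ?d = "triple_dim v" and ?\<epsilon> = "\<lambda>x. of_int (eps k J x) :: complex"
  obtain B B' \<delta> where B: "B \<in> carrier_mat n n" "B' \<in> carrier_mat n n" "B' * B = 1\<^sub>m n" "B\<^sup>T = \<delta> \<cdot>\<^sub>m B" "\<delta> * \<delta> = 1"
    and B_iff: "\<And>A. A \<in> (if even n then Sp n else O_group n) \<longleftrightarrow> A \<in> carrier_mat n n \<and> A\<^sup>T * (B * A) = B"
    by (rule exists_invariant_form[of n]) (rule that)
  have \<psi>: "\<psi> g \<in> carrier_mat n n" "(\<psi> g)\<^sup>T * (B * \<psi> g) = B" if "g \<in> ?G" for g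
  proof -
    have "\<psi> g \<in> dual_group n" using assms(2) that by (simp add: parameter_def)
    then have "\<psi> g \<in> (if even n then Sp n else O_group n)"
      by (auto simp: dual_group_def SO_group_def)
    then show "\<psi> g \<in> carrier_mat n n" "(\<psi> g)\<^sup>T * (B * \<psi> g) = B" unfolding B_iff by auto
  qed
  have ge: "a \<ge> 1" "b \<ge> 1" and irr: "irreducible_rep ?W (rep_dim ?W \<rho>) \<rho>"
    and sd: "self_dual ?W (rep_dim ?W \<rho>) \<rho>" if "(\<rho>, a, b) \<in># J" for \<rho> a b
    using assms(3) that unfolding is_Jord_def by fast+
  have equiv_eq: "\<rho> = \<rho>'" if "(\<rho>, a, b) \<in># J" "(\<rho>', a', b') \<in># J" "rep_equiv ?W (rep_dim ?W \<rho>) \<rho> \<rho>'"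
    for \<rho> a b \<rho>' a' b'
    using assms(3) that unfolding is_Jord_def by fast
  have R: "triple_rep y g \<in> carrier_mat (?d y) (?d y)" if "y \<in># J" "g \<in> ?G" for y g
    using that irr by (cases y) (metis triple_rep_carrier)
  interpret invariant_form n B B' \<delta> ?G \<psi> "set_mset J" ?d triple_rep
  proof
    fix y assume "y \<in># J"
    then show "?d y > 0"
      using ge irr by (cases y) (auto simp: triple_dim_def irreducible_rep_def Suc_le_eq)
  next
    fix y y' \<beta>
    assume y: "y \<in># J" "y' \<in># J" and \<beta>: "\<beta> \<in> carrier_mat (?d y) (?d y')" "\<beta> \<noteq> 0\<^sub>m (?d y) (?d y')"
      and inv: "\<And>g. g \<in> ?G \<Longrightarrow> (triple_rep y g)\<^sup>T * (\<beta> * triple_rep y' g) = \<beta>"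
    obtain \<rho> a b \<rho>' a' b' where yy: "y = (\<rho>, a, b)" "y' = (\<rho>', a', b')" by (cases y; cases y')
    show "y = y' \<and> (\<exists>\<beta>'\<in>carrier_mat (?d y) (?d y). \<beta>' * \<beta> = 1\<^sub>m (?d y) \<and> \<beta> * \<beta>' = 1\<^sub>m (?d y))"
      using y \<beta> inv unfolding yy
      by (intro triple_rep_schur ge[OF y(1)[unfolded yy]] ge[OF y(2)[unfolded yy]] irr[OF y(1)[unfolded yy]]
          irr[OF y(2)[unfolded yy]] sd[OF y(1)[unfolded yy]] equiv_eq[OF y[unfolded yy]])
  qed (use B \<psi> R in simp_all)
  have iso: "isometries = carrier (centralizer v n \<psi>)"
    by (auto simp: isometries_def centralizer_def B_iff simp del: if_split)
  have \<chi>: "\<chi> \<in> hom (centralizer v n \<psi>) complex_units"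
    "\<And>x s. x \<in># J \<Longrightarrow> s \<in> isometries \<Longrightarrow> minus_on_one_copy v n \<psi> x s \<Longrightarrow> \<chi> s = ?\<epsilon> x"
    using assms(4) unfolding is_character_of_def iso by auto
  interpret invariant_form_character n B B' \<delta> ?G \<psi> "set_mset J" ?d triple_rep \<chi> ?\<epsilon>
  proof
    show "\<chi> (s * t) = \<chi> s * \<chi> t" if "s \<in> isometries" "t \<in> isometries" for s t
      using hom_mult[OF \<chi>(1)] that by (simp add: iso complex_units_def centralizer_def)
    show "\<chi> s \<noteq> 0" if "s \<in> isometries" for s
      using \<chi>(1) that by (auto simp: iso complex_units_def hom_def)
    show "?\<epsilon> y * ?\<epsilon> y = 1" for y
      by (simp add: eps_def flip: power_add mult_2)
    fix y p h
    assume p: "intertwiner y p" and h: "h \<in> carrier_mat (?d y) n" "h * p = 1\<^sub>m (?d y)"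
      "\<And>g. g \<in> ?G \<Longrightarrow> h * \<psi> g = triple_rep y g * h" and s: "1\<^sub>m n - p * h - p * h \<in> isometries"
    show "\<chi> (1\<^sub>m n - p * h - p * h) = ?\<epsilon> y"
      by (rule \<chi>(2)[OF intertwinerD(1)[OF p] s minus_on_one_copyI[OF intertwinerD(2)[OF p] h(1,2) \<psi>(1)
            R[OF intertwinerD(1)[OF p]] intertwinerD(5)[OF p] h(3)]])
  qed
  obtain xs P where xs: "mset xs = J" and P: "P \<in> carrier (GL n)"
    and diag: "\<And>g. g \<in> ?G \<Longrightarrow> diag_block_mat (map (\<lambda>x. triple_rep x g) xs) \<in> carrier_mat n n \<and>
      \<psi> g * P = P * diag_block_mat (map (\<lambda>x. triple_rep x g) xs)"
    using assms(3) unfolding is_Jord_def rep_equiv_def by blast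
  obtain P' where P': "P' \<in> carrier_mat n n" "P * P' = 1\<^sub>m n" "P' * P = 1\<^sub>m n"
    using GL_D(2)[OF P] by blast
  have xsJ: "xs ! i \<in># J" if "i < length xs" for i using that xs by (metis nth_mem set_mset_mset)
  \<comment> \<open>This element maps to \<open>c2 \<psi>\<close>; it also serves as a sample
    element at which the size of the block matrix is read off.\<close>
  define g1 where "g1 = (id :: 'f alg_closure \<Rightarrow> 'f alg_closure, 1\<^sub>m 2 :: complex mat, - 1\<^sub>m 2 :: complex mat)"
  have g1: "g1 \<in> ?G" by (simp add: g1_def param_group_def id_Weil_group sl2_elements)
  have n: "n = sum_list (map ?d xs)"
  proof -
    have "dim_row (diag_block_mat (map (\<lambda>x. triple_rep x g1) xs)) = n"
      using diag[OF g1] by auto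
    moreover have "map (dim_row \<circ> (\<lambda>x. triple_rep x g1)) xs = map ?d xs"
      using carrier_matD(1)[OF R[OF _ g1]] xs by (intro map_cong) auto
    ultimately show ?thesis by (simp add: dim_diag_block_mat)
  qed
  obtain p q where pq: "block_inclusions ?G triple_rep ?d xs n p q"
    using exists_block_inclusions[OF _ n, of ?G triple_rep] R xs by auto
  have p: "p i \<in> carrier_mat n (?d (xs ! i))" "q i \<in> carrier_mat (?d (xs ! i)) n"
      "q i * p i = 1\<^sub>m (?d (xs ! i))"
      "\<And>g. g \<in> ?G \<Longrightarrow> diag_block_mat (map (\<lambda>x. triple_rep x g) xs) * p i = p i * triple_rep (xs ! i) g"
    if "i < length xs" for i
    using pq that unfolding block_inclusions_def by blast+
  note [simp] = carrier_matD[OF p(1)] carrier_matD[OF p(2)] carrier_matD[OF P'(1)] carrier_matD[OF GL_D(1)[OF P]]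
  \<comment> \<open>The change of basis \<open>P\<close> carries the block inclusions to the space
    of \<open>\<psi>\<close>. As they span all of it, the projection is the identity.\<close>
  have dec: "decomposes (1\<^sub>m n) {..<length xs} (\<lambda>i. P * p i) (\<lambda>i. q i * P') (\<lambda>i. xs ! i)"
    unfolding decomposes_def
  proof (intro conjI ballI allI impI)
    fix i assume "i \<in> {..<length xs}"
    then have i: "i < length xs" by simp
    show "intertwiner (xs ! i) (P * p i)"
      unfolding intertwiner_def
    proof (intro conjI ballI)
      fix g assume g: "g \<in> ?G"
      let ?D = "diag_block_mat (map (\<lambda>x. triple_rep x g) xs)"
      have D: "dim_row ?D = n" "dim_col ?D = n" using diag[OF g] by auto
      have "\<psi> g * (P * p i) = (\<psi> g * P) * p i" using i g by (simp add: mat_assoc_dim)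
      also have "\<dots> = P * (?D * p i)" using i D diag[OF g] by (simp add: mat_assoc_dim)
      also have "\<dots> = P * p i * triple_rep (xs ! i) g"
        using i g xsJ by (simp add: mat_assoc_dim p(4))
      finally show "\<psi> g * (P * p i) = P * p i * triple_rep (xs ! i) g" .
    qed (use i xsJ in \<open>auto intro: carrier_matI\<close>)
    show "q i * P' \<in> carrier_mat (?d (xs ! i)) n" using i by (intro carrier_matI) simp_all
    show "q i * P' * (P * p i) = 1\<^sub>m (?d (xs ! i))"
      using i by (simp add: mat_assoc_dim mat_prod_rewrite[OF P'(3)] mat_unit_dim p(3))
    show "1\<^sub>m n * (P * p i) = P * p i" using i by (simp add: mat_unit_dim)
  next
    fix i j assume "i \<in> {..<length xs}" "j \<in> {..<length xs}" "i \<noteq> j"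
    then have i: "i < length xs" "j < length xs" and "q i * p j = 0\<^sub>m (?d (xs ! i)) (?d (xs ! j))"
      using pq unfolding block_inclusions_def by auto
    then show "q i * P' * (P * p j) = 0\<^sub>m (?d (xs ! i)) (?d (xs ! j))"
      by (simp add: mat_assoc_dim mat_prod_rewrite[OF P'(3)] mat_unit_dim)
  next
    fix m A
    assume A: "A \<in> carrier_mat m n" "\<forall>i\<in>{..<length xs}. A * (P * p i) = 0\<^sub>m m (?d (xs ! i))"
    note [simp] = carrier_matD[OF A(1)]
    have "A * P \<in> carrier_mat m n" by (rule carrier_matI) simp_all
    moreover have "\<forall>i<length xs. A * P * p i = 0\<^sub>m m (?d (xs ! i))"
      using A(2) by (simp add: mat_assoc_dim)
    ultimately have "A * P = 0\<^sub>m m n" using pq unfolding block_inclusions_def by blast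
    then have "A * (P * P') = 0\<^sub>m m n" by (simp add: mat_unit_dim flip: mat_assoc_dim)
    then show "A * 1\<^sub>m n = 0\<^sub>m m n" by (simp only: P')
  qed (simp_all add: mat_unit_dim)
  \<comment> \<open>For \<open>f = 1\<close> the element \<open>1 - f + z * f\<close> is
    \<open>z\<close>, and a product over the positions of \<open>xs\<close> is a product over
    \<open>J\<close> with multiplicities.\<close>
  have chi_value: "\<chi> z = (\<Prod>x\<in>#J. if \<sigma> x = -1 then ?\<epsilon> x else 1)"
    if z: "z \<in> carrier_mat n n" "\<And>y r. intertwiner y r \<Longrightarrow> z * r = \<sigma> y \<cdot>\<^sub>m r"
      "\<And>y. y \<in># J \<Longrightarrow> \<sigma> y = 1 \<or> \<sigma> y = -1" for z \<sigma>
  proof -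
    have "\<chi> (1\<^sub>m n - 1\<^sub>m n + z * 1\<^sub>m n) = (\<Prod>i<length xs. if \<sigma> (xs ! i) = -1 then ?\<epsilon> (xs ! i) else 1)"
      using character_value[OF dec z(1), of \<sigma>] z(2,3) by blast
    moreover have "1\<^sub>m n - 1\<^sub>m n + z * 1\<^sub>m n = z"
      using carrier_matD[OF z(1)] by (simp add: mat_unit_dim)
    moreover have "(\<Prod>i<length xs. f (xs ! i)) = (\<Prod>x\<in>#J. f x)" for f :: "_ \<Rightarrow> complex"
      using prod_mset_prod_list[of "map f xs"]
      unfolding xs[symmetric] mset_map prod.list_conv_set_nth by (simp add: lessThan_atLeast0)
    ultimately show ?thesis by simp
  qed
  have of_int_prod: "(\<Prod>x\<in>#M. of_int (f x)) = (of_int (\<Prod>x\<in>#M. f x) :: complex)" for f :: "_ \<Rightarrow> int" and M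
    by (induction M) simp_all
  have "\<chi> (central_z n) = (\<Prod>x\<in>#J. if (-1 :: complex) = -1 then ?\<epsilon> x else 1)"
  proof (rule chi_value[of "central_z n" "\<lambda>_. -1"])
    show "central_z n \<in> carrier_mat n n" by (intro carrier_matI) (simp_all add: central_z_def)
    show "central_z n * r = (-1) \<cdot>\<^sub>m r" if "intertwiner y r" for y r
      using intertwinerD(3)[OF that]
      by (simp add: central_z_def mat_uminus_eq_smult mat_smult_dim mat_unit_dim)
  qed simp
  then have "\<chi> (central_z n) = 1"
    using prod_eps_all[of k J] by (simp add: of_int_prod)
  moreover have "\<chi> (c2 \<psi>) = (\<Prod>x\<in>#J. if (-1 :: complex) ^ (snd (snd x) - 1) = -1 then ?\<epsilon> x else 1)"
  proof (rule chi_value[of "c2 \<psi>" "\<lambda>x. (-1) ^ (snd (snd x) - 1)"])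
    show "c2 \<psi> \<in> carrier_mat n n" using \<psi>(1)[OF g1] by (simp add: c2_def g1_def)
    fix y r assume r: "intertwiner y r"
    note r' = intertwinerD[OF r]
    obtain \<rho> a b where y: "y = (\<rho>, a, b)" by (cases y)
    have "triple_rep y g1 = (-1) ^ (b - 1) \<cdot>\<^sub>m 1\<^sub>m (?d y)"
      using triple_rep_c2 irr ge(2) r'(1) unfolding y g1_def by blast
    then have "\<psi> g1 * r = (-1) ^ (b - 1) \<cdot>\<^sub>m r"
      using r'(4) r'(5)[OF g1] by (simp add: mat_smult_dim mat_unit_dim)
    then show "c2 \<psi> * r = (-1) ^ (snd (snd y) - 1) \<cdot>\<^sub>m r" by (simp add: c2_def g1_def y)
  qed (simp add: minus_one_power_iff)
  \<comment> \<open>As \<open>b\<close> is at least 1, the truncated \<open>b - 1\<close> is odd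
    exactly when \<open>b\<close> is even.\<close>
  moreover have "(if (-1 :: complex) ^ (snd (snd x) - 1) = -1 then ?\<epsilon> x else 1) =
      of_int (if even (snd (snd x)) then eps k J x else 1)" if "x \<in># J" for x
    using that ge(2) by (cases x) (auto simp: minus_one_power_iff)
  ultimately have "\<chi> (central_z n) = 1" "\<chi> (c2 \<psi>) = (\<Prod>x\<in>#J. of_int (if even (snd (snd x)) then eps k J x else 1))"
    by (auto intro!: arg_cong[of _ _ prod_mset] image_mset_cong)
  then show ?thesis
    using prod_eps_even[of k J] by (simp only: of_int_prod)
qed

end
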